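(* The model-checking problem for stateless quantum pushdown systems (qBPA) against probabilistic computational tree logic (PCTL) is undecidable: there is no algorithm which, given a qBPA $\triangle=(\Gamma,\delta,\mathcal{Q})$, a simple regular assignment $\nu$, a configuration $\gamma\in\Gamma^*$ and a PCTL state formula $\Psi$, decides whether $\widehat{M}_{\triangle},\gamma\models^{\nu}\Psi$.
   Context: A (discrete) quantum Markov chain (QMC) is a triple $\widehat{M}=(S,\delta,\mathcal{Q})$ with $S$ a finite or countably infinite set of basic states, $\delta\subseteq S\times S$ a transition relation such that every $s$ has some $(s,t)\in\delta$, and $\mathcal{Q}:\delta\to\mathbb{C}$ assigning quantum amplitudes with $\sum_t|\mathcal{Q}(s,t)|^2=1$ for every $s$. Runs are infinite paths $w=s_0s_1\cdots$ with $(s_i,s_{i+1})\in\delta$. For each $s$, $Run(s)$ carries the $\sigma$-field generated by cylinders $Cyl(w)$ ($w$ a finite path from $s$) and the probability measure with $\mathcal{P}(Cyl(s_1\cdots s_k))=\left|\prod_{i=1}^{k-1}\mathcal{Q}(s_i,s_{i+1})\right|^2$. A stateless quantum pushdown system (qBPA) is a triple $\triangle=(\Gamma,\delta,\mathcal{Q})$ with $\Gamma$ a finite stack alphabet, $\delta$ a finite set of rules $X\to\alpha$ ($X\in\Gamma$, $\alpha\in\Gamma^*$, $|\alpha|\le2$), at least one for each $X$, and $\mathcal{Q}$ assigning each rule an amplitude in $\mathbb{C}$ with $\sum_\alpha|\mathcal{Q}(X\to\alpha)|^2=1$ for each $X$. Configurations are words in $\Gamma^*$ (top at left); $X\to\alpha$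 takes $X\beta$ to $\alpha\beta$ with amplitude $\mathcal{Q}(X\to\alpha)$. This induces an infinite-state QMC $\widehat{M}_{\triangle}$. PCTL: state formulas $\Phi::=p\mid\neg\Phi\mid\Phi_1\wedge\Phi_2\mid\mathcal{P}_{\bowtie r}(\varphi)$, path formulas $\varphi::={\bf X}\Phi\mid\Phi_1{\bf U}\Phi_2$, $\bowtie\in\{>,=\}$, $r\in[0,1]$ rational. Semantics over $\widehat{M}$ with assignment $\nu$: $s\models p$ iff $s\in\nu(p)$; Boolean connectives as usual; $s\models\mathcal{P}_{\bowtie r}(\varphi)$ iff the probability (under the measure above) of $\{w\in Run(s):w\models\varphi\}$ is $\bowtie r$; $w\models{\bf X}\Phi$ iff $w(1)\models\Phi$; $w\models\Phi_1{\bf U}\Phi_2$ iff some $k\ge0$ has $w(k)\models\Phi_2$ and $w(j)\models\Phi_1$ for all $j<k$. An assignment $\nu:AP\to2^{\Gamma^*}$ is regular if each $\nu(p)$ is regular, and simple if for each $p$ there is $H_p\subseteq\Gamma$ with $\gamma\beta\in\nu(p)$ iff $\gamma\in H_p$. *)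

theory Defs
  imports "HOL-Analysis.Analysis" "HOL-Library.Nat_Bijection"
begin

section \<open>Quantum Markov chains\<close>

record 's qmc =
  states :: "'s set"
  trans :: "('s \<times> 's) set"
  amplitude :: "'s \<times> 's \<Rightarrow> complex"

text \<open>The value of \<^term>\<open>amplitude\<close> outside \<^term>\<open>trans\<close> is never used.\<close>

definition is_qmc :: "'s qmc \<Rightarrow> bool" where
  "is_qmc M \<longleftrightarrow>
     countable (states M) \<and>
     trans M \<subseteq> states M \<times> states M \<and>
     (\<forall>s\<in>states M. \<exists>t. (s, t) \<in> trans M) \<and>
     (\<forall>s\<in>states M. ((\<lambda>t. (cmod (amplitude M (s, t)))\<^sup>2) has_sum 1) {t. (s, t) \<in> trans M})"

definition runs :: "'s qmc \<Rightarrow> 's \<Rightarrow> (nat \<Rightarrow> 's) set" where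
  "runs M s = {\<omega>. \<omega> 0 = s \<and> (\<forall>i. (\<omega> i, \<omega> (Suc i)) \<in> trans M)}"

definition finite_paths :: "'s qmc \<Rightarrow> 's \<Rightarrow> 's list set" where
  "finite_paths M s =
     {w. w \<noteq> [] \<and> hd w = s \<and> (\<forall>i. Suc i < length w \<longrightarrow> (w ! i, w ! Suc i) \<in> trans M)}"

definition cylinder :: "'s qmc \<Rightarrow> 's \<Rightarrow> 's list \<Rightarrow> (nat \<Rightarrow> 's) set" where
  "cylinder M s w = {\<omega> \<in> runs M s. \<forall>i<length w. \<omega> i = w ! i}"

definition path_prob :: "'s qmc \<Rightarrow> 's list \<Rightarrow> real" where
  "path_prob M w = (cmod (\<Prod>i<length w - 1. amplitude M (w ! i, w ! Suc i)))\<^sup>2"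

text \<open>
  The measure on the \<open>\<sigma>\<close>-field generated by the cylinders of runs from \<open>s\<close> that
  extends \<^term>\<open>path_prob M\<close>. For a quantum Markov chain such an extension exists,
  and it is unique because two cylinders are nested or disjoint.
\<close>

definition run_measure :: "'s qmc \<Rightarrow> 's \<Rightarrow> (nat \<Rightarrow> 's) measure" where
  "run_measure M s =
     extend_measure (runs M s) (finite_paths M s) (cylinder M s) (\<lambda>w. ennreal (path_prob M w))"

section \<open>Stateless quantum pushdown systems\<close>

record 'g qbpa =
  alphabet :: "'g set"
  rules :: "('g \<times> 'g list) set"
  rule_amplitude :: "'g \<times> 'g list \<Rightarrow> complex"

definition is_qbpa :: "'g qbpa \<Rightarrow> bool" where
  "is_qbpa \<Delta> \<longleftrightarrow>
     finite (alphabet \<Delta>) \<and>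
     finite (rules \<Delta>) \<and>
     (\<forall>(X, \<alpha>)\<in>rules \<Delta>. X \<in> alphabet \<Delta> \<and> \<alpha> \<in> lists (alphabet \<Delta>) \<and> length \<alpha> \<le> 2) \<and>
     (\<forall>X\<in>alphabet \<Delta>. \<exists>\<alpha>. (X, \<alpha>) \<in> rules \<Delta>) \<and>
     (\<forall>X\<in>alphabet \<Delta>. (\<Sum>\<alpha> | (X, \<alpha>) \<in> rules \<Delta>. (cmod (rule_amplitude \<Delta> (X, \<alpha>)))\<^sup>2) = 1)"

text \<open>
  No rule applies to the empty stack; as every state of a quantum Markov chain needs a
  successor, the empty stack gets a self-loop of amplitude 1. A step from \<open>X # \<beta>\<close> to \<open>t\<close>
  comes from a unique rule \<open>(X, \<alpha>)\<close>, where \<open>\<alpha>\<close> is \<open>t\<close> without its suffix \<open>\<beta>\<close>.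
\<close>

definition qmc_of :: "'g qbpa \<Rightarrow> 'g list qmc" where
  "qmc_of \<Delta> = \<lparr>
     states = lists (alphabet \<Delta>),
     trans = {(X # \<beta>, \<alpha> @ \<beta>) | X \<alpha> \<beta>. (X, \<alpha>) \<in> rules \<Delta> \<and> \<beta> \<in> lists (alphabet \<Delta>)} \<union> {([], [])},
     amplitude = (\<lambda>(s, t). case s of [] \<Rightarrow> 1
        | X # \<beta> \<Rightarrow> rule_amplitude \<Delta> (X, take (length t - length \<beta>) t)) \<rparr>"

lemma is_qmc_qmc_of:
  assumes "is_qbpa \<Delta>"
  shows "is_qmc (qmc_of \<Delta>)"
proof -
  let ?M = "qmc_of \<Delta>"
  have fin: "finite (alphabet \<Delta>)" "finite (rules \<Delta>)"
    and rl: "\<And>X \<alpha>. (X, \<alpha>) \<in> rules \<Delta> \<Longrightarrow> X \<in> alphabet \<Delta> \<and> \<alpha> \<in> lists (alphabet \<Delta>)"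
    and ex: "\<And>X. X \<in> alphabet \<Delta> \<Longrightarrow> \<exists>\<alpha>. (X, \<alpha>) \<in> rules \<Delta>"
    and one: "\<And>X. X \<in> alphabet \<Delta> \<Longrightarrow>
      (\<Sum>\<alpha> | (X, \<alpha>) \<in> rules \<Delta>. (cmod (rule_amplitude \<Delta> (X, \<alpha>)))\<^sup>2) = 1"
    using assms unfolding is_qbpa_def by auto
  have "countable (states ?M)"
    using fin by (simp add: qmc_of_def countable_finite)
  moreover have "trans ?M \<subseteq> states ?M \<times> states ?M"
    using rl by (fastforce simp: qmc_of_def)
  moreover have "\<exists>t. (s, t) \<in> trans ?M" if "s \<in> states ?M" for s
    using that ex by (cases s) (fastforce simp: qmc_of_def)+
  moreover have "((\<lambda>t. (cmod (amplitude ?M (s, t)))\<^sup>2) has_sum 1) {t. (s, t) \<in> trans ?M}"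
    if s: "s \<in> states ?M" for s
  proof (cases s)
    case Nil
    then have "{t. (s, t) \<in> trans ?M} = {[]}" by (auto simp: qmc_of_def)
    moreover have "(cmod (amplitude ?M (s, [])))\<^sup>2 = 1" using Nil by (simp add: qmc_of_def)
    ultimately show ?thesis by (simp add: has_sum_finite_iff)
  next
    case (Cons X \<beta>)
    let ?A = "{\<alpha>. (X, \<alpha>) \<in> rules \<Delta>}"
    have X: "X \<in> alphabet \<Delta>" "\<beta> \<in> lists (alphabet \<Delta>)" using s Cons by (auto simp: qmc_of_def)
    have succ: "{t. (s, t) \<in> trans ?M} = (\<lambda>\<alpha>. \<alpha> @ \<beta>) ` ?A"
      using Cons X by (auto simp: qmc_of_def)
    have "?A = snd ` (rules \<Delta> \<inter> {X} \<times> UNIV)" by force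
    then have finA: "finite ?A" using fin by auto
    have "(\<Sum>t\<in>(\<lambda>\<alpha>. \<alpha> @ \<beta>) ` ?A. (cmod (amplitude ?M (s, t)))\<^sup>2)
        = (\<Sum>\<alpha>\<in>?A. (cmod (amplitude ?M (s, \<alpha> @ \<beta>)))\<^sup>2)"
      by (subst sum.reindex) (auto simp: inj_on_def)
    also have "\<dots> = (\<Sum>\<alpha>\<in>?A. (cmod (rule_amplitude \<Delta> (X, \<alpha>)))\<^sup>2)"
      using Cons by (simp add: qmc_of_def)
    also have "\<dots> = 1" using one X by simp
    finally show ?thesis unfolding succ using finA by (simp add: has_sum_finite_iff)
  qed
  ultimately show ?thesis unfolding is_qmc_def by blast
qed

section \<open>PCTL\<close>

datatype comparison = Greater | Equal

datatype state_formula =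
    Atom nat
  | Neg state_formula
  | Conj state_formula state_formula
  | Prob comparison rat path_formula
and path_formula =
    Next state_formula
  | Until state_formula state_formula

primrec compares :: "comparison \<Rightarrow> real \<Rightarrow> real \<Rightarrow> bool" where
  "compares Greater x r \<longleftrightarrow> x > r"
| "compares Equal x r \<longleftrightarrow> x = r"

primrec sat :: "'s qmc \<Rightarrow> (nat \<Rightarrow> 's set) \<Rightarrow> state_formula \<Rightarrow> 's \<Rightarrow> bool"
  and path_sat :: "'s qmc \<Rightarrow> (nat \<Rightarrow> 's set) \<Rightarrow> path_formula \<Rightarrow> (nat \<Rightarrow> 's) \<Rightarrow> bool" where
  "sat M \<nu> (Atom p) s \<longleftrightarrow> s \<in> \<nu> p"
| "sat M \<nu> (Neg \<Phi>) s \<longleftrightarrow> \<not> sat M \<nu> \<Phi> s"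
| "sat M \<nu> (Conj \<Phi> \<Phi>') s \<longleftrightarrow> sat M \<nu> \<Phi> s \<and> sat M \<nu> \<Phi>' s"
| "sat M \<nu> (Prob cmp r \<phi>) s \<longleftrightarrow>
     compares cmp (measure (run_measure M s) {\<omega> \<in> runs M s. path_sat M \<nu> \<phi> \<omega>}) (of_rat r)"
| "path_sat M \<nu> (Next \<Phi>) \<omega> \<longleftrightarrow> sat M \<nu> \<Phi> (\<omega> 1)"
| "path_sat M \<nu> (Until \<Phi> \<Phi>') \<omega> \<longleftrightarrow> (\<exists>k. sat M \<nu> \<Phi>' (\<omega> k) \<and> (\<forall>j<k. sat M \<nu> \<Phi> (\<omega> j)))"

primrec wf_state_formula :: "state_formula \<Rightarrow> bool"
  and wf_path_formula :: "path_formula \<Rightarrow> bool" where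
  "wf_state_formula (Atom p) \<longleftrightarrow> True"
| "wf_state_formula (Neg \<Phi>) \<longleftrightarrow> wf_state_formula \<Phi>"
| "wf_state_formula (Conj \<Phi> \<Phi>') \<longleftrightarrow> wf_state_formula \<Phi> \<and> wf_state_formula \<Phi>'"
| "wf_state_formula (Prob cmp r \<phi>) \<longleftrightarrow> 0 \<le> r \<and> r \<le> 1 \<and> wf_path_formula \<phi>"
| "wf_path_formula (Next \<Phi>) \<longleftrightarrow> wf_state_formula \<Phi>"
| "wf_path_formula (Until \<Phi> \<Phi>') \<longleftrightarrow> wf_state_formula \<Phi> \<and> wf_state_formula \<Phi>'"

primrec state_atoms :: "state_formula \<Rightarrow> nat set"
  and path_atoms :: "path_formula \<Rightarrow> nat set" where
  "state_atoms (Atom p) = {p}"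
| "state_atoms (Neg \<Phi>) = state_atoms \<Phi>"
| "state_atoms (Conj \<Phi> \<Phi>') = state_atoms \<Phi> \<union> state_atoms \<Phi>'"
| "state_atoms (Prob cmp r \<phi>) = path_atoms \<phi>"
| "path_atoms (Next \<Phi>) = state_atoms \<Phi>"
| "path_atoms (Until \<Phi> \<Phi>') = state_atoms \<Phi> \<union> state_atoms \<Phi>'"

section \<open>Assignments\<close>

definition regular_language :: "'g set \<Rightarrow> 'g list set \<Rightarrow> bool" where
  "regular_language \<Gamma> L \<longleftrightarrow>
     (\<exists>(Q :: nat set) q\<^sub>0 step F.
        finite Q \<and> q\<^sub>0 \<in> Q \<and> F \<subseteq> Q \<and> (\<forall>q\<in>Q. \<forall>X\<in>\<Gamma>. step X q \<in> Q) \<and>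
        L = {w \<in> lists \<Gamma>. fold step w q\<^sub>0 \<in> F})"

definition regular_assignment :: "'g set \<Rightarrow> (nat \<Rightarrow> 'g list set) \<Rightarrow> bool" where
  "regular_assignment \<Gamma> \<nu> \<longleftrightarrow> (\<forall>p. regular_language \<Gamma> (\<nu> p))"

text \<open>A simple assignment may or may not put the empty stack into \<open>\<nu> p\<close>.\<close>

definition simple_assignment :: "'g set \<Rightarrow> (nat \<Rightarrow> 'g list set) \<Rightarrow> bool" where
  "simple_assignment \<Gamma> \<nu> \<longleftrightarrow>
     (\<forall>p. \<exists>H\<subseteq>\<Gamma>. \<forall>X\<in>\<Gamma>. \<forall>\<beta>\<in>lists \<Gamma>. X # \<beta> \<in> \<nu> p \<longleftrightarrow> X \<in> H)"

section \<open>Partial recursive functions\<close>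

datatype recf =
    Zero
  | Succ
  | Proj nat
  | Comp recf "recf list"
  | Prim_Rec recf recf
  | Minimize recf

text \<open>\<open>evaluates f xs y\<close>: the partial recursive function \<open>f\<close> is defined at \<open>xs\<close>, with value \<open>y\<close>.\<close>

inductive evaluates :: "recf \<Rightarrow> nat list \<Rightarrow> nat \<Rightarrow> bool" where
  zero: "evaluates Zero xs 0"
| succ: "evaluates Succ [x] (Suc x)"
| proj: "i < length xs \<Longrightarrow> evaluates (Proj i) xs (xs ! i)"
| comp: "length gs = length ys \<Longrightarrow> (\<And>i. i < length gs \<Longrightarrow> evaluates (gs ! i) xs (ys ! i)) \<Longrightarrow>
    evaluates f ys z \<Longrightarrow> evaluates (Comp f gs) xs z"
| prim_rec_0: "evaluates f xs y \<Longrightarrow> evaluates (Prim_Rec f g) (0 # xs) y"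
| prim_rec_Suc: "evaluates (Prim_Rec f g) (n # xs) r \<Longrightarrow> evaluates g (n # r # xs) y \<Longrightarrow>
    evaluates (Prim_Rec f g) (Suc n # xs) y"
| minimize: "evaluates f (n # xs) 0 \<Longrightarrow> (\<And>m. m < n \<Longrightarrow> \<exists>k. evaluates f (m # xs) (Suc k)) \<Longrightarrow>
    evaluates (Minimize f) xs n"

inductive_cases evaluates_elims:
  "evaluates Zero xs y"
  "evaluates Succ xs y"
  "evaluates (Proj i) xs y"
  "evaluates (Comp f gs) xs y"
  "evaluates (Prim_Rec f g) (0 # xs) y"
  "evaluates (Prim_Rec f g) (Suc n # xs) y"
  "evaluates (Minimize f) xs y"

lemma evaluates_deterministic:
  "evaluates f xs y \<Longrightarrow> evaluates f xs z \<Longrightarrow> y = z"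
proof (induction arbitrary: z rule: evaluates.induct)
  case (zero xs)
  then show ?case by (rule evaluates_elims(1)) simp
next
  case (succ x)
  then show ?case by (rule evaluates_elims(2)) (metis list.inject)
next
  case (proj i xs)
  from proj.prems show ?case by (rule evaluates_elims(3)) simp
next
  case (comp gs ys xs f w)
  from comp.prems obtain ys' where ys': "length gs = length ys'"
    "\<And>i. i < length gs \<Longrightarrow> evaluates (gs ! i) xs (ys' ! i)" "evaluates f ys' z"
    by (rule evaluates_elims(4)) (rule that, simp_all)
  have "ys = ys'"
  proof (rule nth_equalityI)
    show len: "length ys = length ys'" using comp.hyps(1) ys'(1) by simp
    fix i assume "i < length ys"
    then have i: "i < length gs" using comp.hyps(1) by simp
    from i ys'(2)[OF i] show "ys ! i = ys' ! i" by (rule comp.IH(1))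
  qed
  then show ?case using comp.IH(2) ys'(3) by blast
next
  case (prim_rec_0 f xs y g)
  from prim_rec_0.prems have "evaluates f xs z" by (rule evaluates_elims(5)) simp
  then show ?case by (rule prim_rec_0.IH)
next
  case (prim_rec_Suc f g n xs r y)
  from prim_rec_Suc.prems obtain r' where
    "evaluates (Prim_Rec f g) (n # xs) r'" "evaluates g (n # r' # xs) z"
    by (rule evaluates_elims(6)) (rule that)
  then show ?case using prim_rec_Suc.IH by blast
next
  case (minimize f n xs)
  have z: "evaluates f (z # xs) 0"
    using minimize.prems by (rule evaluates_elims(7))
  have less: "\<exists>k. evaluates f (m # xs) (Suc k)" if "m < z" for m
    using minimize.prems by (rule evaluates_elims(7)) (simp add: that)
  have "\<not> z < n" using minimize.IH(2) z by fastforce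
  moreover have "\<not> n < z" using minimize.IH(1) less by fastforce
  ultimately show ?case by simp
qed

section \<open>Instances of the model-checking problem as natural numbers\<close>

definition code_rat :: "rat \<Rightarrow> nat" where
  "code_rat r = (case quotient_of r of (a, b) \<Rightarrow> prod_encode (int_encode a, int_encode b))"

primrec code_comparison :: "comparison \<Rightarrow> nat" where
  "code_comparison Greater = 0"
| "code_comparison Equal = 1"

primrec code_state_formula :: "state_formula \<Rightarrow> nat"
  and code_path_formula :: "path_formula \<Rightarrow> nat" where
  "code_state_formula (Atom p) = prod_encode (0, p)"
| "code_state_formula (Neg \<Phi>) = prod_encode (1, code_state_formula \<Phi>)"
| "code_state_formula (Conj \<Phi> \<Phi>') =
     prod_encode (2, prod_encode (code_state_formula \<Phi>, code_state_formula \<Phi>'))"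
| "code_state_formula (Prob cmp r \<phi>) =
     prod_encode (3, prod_encode (code_comparison cmp, prod_encode (code_rat r, code_path_formula \<phi>)))"
| "code_path_formula (Next \<Phi>) = prod_encode (0, code_state_formula \<Phi>)"
| "code_path_formula (Until \<Phi> \<Phi>') =
     prod_encode (1, prod_encode (code_state_formula \<Phi>, code_state_formula \<Phi>'))"

definition code_rule :: "nat \<times> nat list \<times> nat \<Rightarrow> nat" where
  "code_rule = (\<lambda>(X, \<alpha>, k). prod_encode (X, prod_encode (list_encode \<alpha>, k)))"

definition code_valuation :: "nat \<times> nat list \<times> bool \<Rightarrow> nat" where
  "code_valuation = (\<lambda>(p, Hs, e). prod_encode (p, prod_encode (list_encode Hs, of_bool e)))"

text \<open>
  \<open>amp\<close> is a system of names for amplitudes: \<open>amp k\<close> is the complex number named by \<open>k\<close>, if any.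
  An instance is given by a listing of the stack alphabet; a listing of the rules, each with a name
  of its amplitude; for each atomic proposition \<open>p\<close> in the formula (the others are irrelevant), a
  listing of \<open>H\<^sub>p\<close> and a flag that tells whether \<open>\<nu> p\<close> contains the empty stack; the
  configuration; and the formula.
\<close>

definition instance_code ::
  "(nat \<Rightarrow> complex option) \<Rightarrow> nat qbpa \<Rightarrow> (nat \<Rightarrow> nat list set) \<Rightarrow> nat list \<Rightarrow> state_formula \<Rightarrow> nat \<Rightarrow> bool"
where
  "instance_code amp \<Delta> \<nu> \<gamma> \<Psi> c \<longleftrightarrow>
     (\<exists>Xs rs vs.
        set Xs = alphabet \<Delta> \<and>
        {(X, \<alpha>) | X \<alpha> k. (X, \<alpha>, k) \<in> set rs} = rules \<Delta> \<and>
        (\<forall>(X, \<alpha>, k)\<in>set rs. amp k = Some (rule_amplitude \<Delta> (X, \<alpha>))) \<and>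
        {p | p Hs e. (p, Hs, e) \<in> set vs} = state_atoms \<Psi> \<and>
        (\<forall>(p, Hs, e)\<in>set vs. set Hs = {X \<in> alphabet \<Delta>. [X] \<in> \<nu> p} \<and> (e \<longleftrightarrow> [] \<in> \<nu> p)) \<and>
        c = list_encode [list_encode Xs, list_encode (map code_rule rs),
              list_encode (map code_valuation vs), list_encode \<gamma>, code_state_formula \<Psi>])"

text \<open>
  A number codes at most one instance, up to data that the semantics ignores, so
  the answer to the model-checking problem is a function of the code.
\<close>

lemma code_rat_inject: "code_rat r = code_rat r' \<Longrightarrow> r = r'"
  by (auto simp: code_rat_def prod_encode_eq int_encode_eq split: prod.splits
      intro: quotient_of_inject)

lemma code_comparison_inject: "code_comparison x = code_comparison y \<Longrightarrow> x = y"
  by (cases x; cases y) simp_all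

lemma
  shows code_state_formula_inject: "code_state_formula \<Phi> = code_state_formula \<Psi> \<Longrightarrow> \<Phi> = \<Psi>"
    and code_path_formula_inject: "code_path_formula \<phi> = code_path_formula \<psi> \<Longrightarrow> \<phi> = \<psi>"
proof (induction \<Phi> and \<phi> arbitrary: \<Psi> and \<psi>)
  case (Atom p)
  then show ?case by (cases \<Psi>) (simp_all add: prod_encode_eq)
next
  case (Neg \<Phi>)
  then show ?case by (cases \<Psi>) (simp_all add: prod_encode_eq)
next
  case (Conj \<Phi> \<Phi>')
  then show ?case by (cases \<Psi>) (simp_all add: prod_encode_eq)
next
  case (Prob cmp r \<phi>)
  then show ?case
    by (cases \<Psi>) (simp_all add: prod_encode_eq code_rat_inject code_comparison_inject)
next
  case (Next \<Phi>)
  then show ?case by (cases \<psi>) (simp_all add: prod_encode_eq)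
next
  case (Until \<Phi> \<Phi>')
  then show ?case by (cases \<psi>) (simp_all add: prod_encode_eq)
qed

lemma list_encode_map_inject:
  assumes "inj code" "list_encode (map code xs) = list_encode (map code ys)"
  shows "xs = ys"
  using assms by (simp add: list_encode_eq inj_map_eq_map)

lemma inj_code_rule: "inj code_rule"
  by (rule injI) (auto simp: code_rule_def prod_encode_eq list_encode_eq split: prod.splits)

lemma inj_code_valuation: "inj code_valuation"
  by (rule injI) (auto simp: code_valuation_def prod_encode_eq list_encode_eq of_bool_def
      split: prod.splits if_splits)

lemma run_measure_cong:
  assumes "trans M = trans N" "\<And>e. e \<in> trans M \<Longrightarrow> amplitude M e = amplitude N e"
  shows "run_measure M s = run_measure N s"
proof -
  have runs: "runs M s = runs N s" and paths: "finite_paths M s = finite_paths N s"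
    and cyl: "cylinder M s = cylinder N s"
    using assms(1) by (simp_all add: runs_def finite_paths_def cylinder_def fun_eq_iff)
  have prob: "path_prob M w = path_prob N w" if "w \<in> finite_paths N s" for w
  proof -
    have "(\<Prod>i<length w - 1. amplitude M (w ! i, w ! Suc i))
        = (\<Prod>i<length w - 1. amplitude N (w ! i, w ! Suc i))"
      using that assms by (intro prod.cong) (auto simp: finite_paths_def)
    then show ?thesis by (simp add: path_prob_def)
  qed
  have "(\<forall>w\<in>finite_paths N s. \<mu>' (cylinder N s w) = ennreal (path_prob M w))
      = (\<forall>w\<in>finite_paths N s. \<mu>' (cylinder N s w) = ennreal (path_prob N w))" for \<mu>'
    using prob by simp
  moreover have "(\<forall>w\<in>finite_paths N s. ennreal (path_prob M w) = 0)
      = (\<forall>w\<in>finite_paths N s. ennreal (path_prob N w) = 0)"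
    using prob by simp
  ultimately show ?thesis
    unfolding run_measure_def extend_measure_def runs paths cyl by (simp only:)
qed

lemma
  assumes tr: "trans M = trans N" "trans M \<subseteq> S \<times> S"
    and am: "\<And>e. e \<in> trans M \<Longrightarrow> amplitude M e = amplitude N e"
  shows sat_cong: "(\<And>p s. p \<in> state_atoms \<Phi> \<Longrightarrow> s \<in> S \<Longrightarrow> s \<in> \<nu> p \<longleftrightarrow> s \<in> \<nu>' p) \<Longrightarrow>
      s \<in> S \<Longrightarrow> sat M \<nu> \<Phi> s \<longleftrightarrow> sat N \<nu>' \<Phi> s"
    and path_sat_cong: "(\<And>p s. p \<in> path_atoms \<phi> \<Longrightarrow> s \<in> S \<Longrightarrow> s \<in> \<nu> p \<longleftrightarrow> s \<in> \<nu>' p) \<Longrightarrow>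
      (\<And>i. \<omega> i \<in> S) \<Longrightarrow> path_sat M \<nu> \<phi> \<omega> \<longleftrightarrow> path_sat N \<nu>' \<phi> \<omega>"
proof (induction \<Phi> and \<phi> arbitrary: s and \<omega>)
  case (Prob cmp r \<phi>)
  have "\<omega> i \<in> S" if "\<omega> \<in> runs M s" for \<omega> i
    using that tr(2) by (auto simp: runs_def)
  then have "path_sat M \<nu> \<phi> \<omega> \<longleftrightarrow> path_sat N \<nu>' \<phi> \<omega>" if "\<omega> \<in> runs M s" for \<omega>
    using Prob.IH Prob.prems(1) that by simp
  moreover have "runs M s = runs N s" using tr(1) by (simp add: runs_def)
  ultimately have "{\<omega> \<in> runs M s. path_sat M \<nu> \<phi> \<omega>} = {\<omega> \<in> runs N s. path_sat N \<nu>' \<phi> \<omega>}"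
    by auto
  then show ?case using run_measure_cong[OF tr(1) am] by simp
qed simp_all

lemma instance_code_determines_answer:
  assumes qbpa: "is_qbpa \<Delta>" "is_qbpa \<Delta>'"
    and simple: "simple_assignment (alphabet \<Delta>) \<nu>" "simple_assignment (alphabet \<Delta>') \<nu>'"
    and \<gamma>: "\<gamma> \<in> lists (alphabet \<Delta>)"
    and code: "instance_code amp \<Delta> \<nu> \<gamma> \<Psi> c" "instance_code amp \<Delta>' \<nu>' \<gamma>' \<Psi>' c"
  shows "sat (qmc_of \<Delta>) \<nu> \<Psi> \<gamma> \<longleftrightarrow> sat (qmc_of \<Delta>') \<nu>' \<Psi>' \<gamma>'"
proof -
  obtain Xs rs vs where 1: "set Xs = alphabet \<Delta>"
    "{(X, \<alpha>) | X \<alpha> k. (X, \<alpha>, k) \<in> set rs} = rules \<Delta>"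
    "\<forall>(X, \<alpha>, k)\<in>set rs. amp k = Some (rule_amplitude \<Delta> (X, \<alpha>))"
    "{p | p Hs e. (p, Hs, e) \<in> set vs} = state_atoms \<Psi>"
    "\<forall>(p, Hs, e)\<in>set vs. set Hs = {X \<in> alphabet \<Delta>. [X] \<in> \<nu> p} \<and> (e \<longleftrightarrow> [] \<in> \<nu> p)"
    "c = list_encode [list_encode Xs, list_encode (map code_rule rs),
       list_encode (map code_valuation vs), list_encode \<gamma>, code_state_formula \<Psi>]"
    using code(1) unfolding instance_code_def by blast
  obtain Xs' rs' vs' where 2: "set Xs' = alphabet \<Delta>'"
    "{(X, \<alpha>) | X \<alpha> k. (X, \<alpha>, k) \<in> set rs'} = rules \<Delta>'"
    "\<forall>(X, \<alpha>, k)\<in>set rs'. amp k = Some (rule_amplitude \<Delta>' (X, \<alpha>))"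
    "{p | p Hs e. (p, Hs, e) \<in> set vs'} = state_atoms \<Psi>'"
    "\<forall>(p, Hs, e)\<in>set vs'. set Hs = {X \<in> alphabet \<Delta>'. [X] \<in> \<nu>' p} \<and> (e \<longleftrightarrow> [] \<in> \<nu>' p)"
    "c = list_encode [list_encode Xs', list_encode (map code_rule rs'),
       list_encode (map code_valuation vs'), list_encode \<gamma>', code_state_formula \<Psi>']"
    using code(2) unfolding instance_code_def by blast
  have "[list_encode Xs, list_encode (map code_rule rs),
       list_encode (map code_valuation vs), list_encode \<gamma>, code_state_formula \<Psi>] =
     [list_encode Xs', list_encode (map code_rule rs'),
       list_encode (map code_valuation vs'), list_encode \<gamma>', code_state_formula \<Psi>']"
    using 1(6) 2(6) by (simp only: list_encode_eq)
  then have eq: "Xs' = Xs" "rs' = rs" "vs' = vs" "\<gamma>' = \<gamma>" "\<Psi>' = \<Psi>"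
    using list_encode_map_inject[OF inj_code_rule] list_encode_map_inject[OF inj_code_valuation]
      code_state_formula_inject by (auto simp: list_encode_eq)
  have al: "alphabet \<Delta>' = alphabet \<Delta>" and ru: "rules \<Delta>' = rules \<Delta>"
    using 1(1,2) 2(1,2) eq by simp_all
  have am: "rule_amplitude \<Delta> x = rule_amplitude \<Delta>' x" if "x \<in> rules \<Delta>" for x
  proof -
    have "x \<in> {(X, \<alpha>) | X \<alpha> k. (X, \<alpha>, k) \<in> set rs}" using that by (simp only: 1(2))
    then obtain X \<alpha> k where "x = (X, \<alpha>)" "(X, \<alpha>, k) \<in> set rs" by blast
    then show ?thesis using 1(3) 2(3) eq by fastforce
  qed
  show ?thesis unfolding eq
  proof (rule sat_cong[where S = "lists (alphabet \<Delta>)"])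
    show "trans (qmc_of \<Delta>) = trans (qmc_of \<Delta>')" using al ru by (simp add: qmc_of_def)
    show "trans (qmc_of \<Delta>) \<subseteq> lists (alphabet \<Delta>) \<times> lists (alphabet \<Delta>)"
      using is_qmc_qmc_of[OF qbpa(1)] by (simp add: is_qmc_def qmc_of_def)
    show "amplitude (qmc_of \<Delta>) e = amplitude (qmc_of \<Delta>') e" if "e \<in> trans (qmc_of \<Delta>)" for e
      using that am by (auto simp: qmc_of_def)
    show "\<gamma> \<in> lists (alphabet \<Delta>)" by (rule \<gamma>)
    fix p s assume p: "p \<in> state_atoms \<Psi>" and s: "s \<in> lists (alphabet \<Delta>)"
    have "p \<in> {p | p Hs e. (p, Hs, e) \<in> set vs}" using p by (simp only: 1(4))
    then obtain Hs e where mem: "(p, Hs, e) \<in> set vs" by blast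
    have v: "set Hs = {X \<in> alphabet \<Delta>. [X] \<in> \<nu> p} \<and> (e \<longleftrightarrow> [] \<in> \<nu> p)"
      using 1(5) mem by blast
    have v': "set Hs = {X \<in> alphabet \<Delta>. [X] \<in> \<nu>' p} \<and> (e \<longleftrightarrow> [] \<in> \<nu>' p)"
      using 2(5) mem eq al by fastforce
    show "s \<in> \<nu> p \<longleftrightarrow> s \<in> \<nu>' p"
    proof (cases s)
      case Nil
      then show ?thesis using v v' by blast
    next
      case (Cons X \<beta>)
      then have X: "X \<in> alphabet \<Delta>" "\<beta> \<in> lists (alphabet \<Delta>)" using s by auto
      have "X # \<beta> \<in> \<nu> p \<longleftrightarrow> [X] \<in> \<nu> p" "X # \<beta> \<in> \<nu>' p \<longleftrightarrow> [X] \<in> \<nu>' p"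
        using simple X unfolding simple_assignment_def al by (meson lists.Nil)+
      then show ?thesis using v v' X Cons by blast
    qed
  qed
qed

end

theory Submission
  imports Defs "HOL-Probability.Probability"
begin

text \<open>
  The domain of a partial recursive function is described by a regular set of words over the
  counter operations \<open>Add2\<close> (add 2), \<open>Dec\<close> (subtract 1) and \<open>Test\<close> (for zero): an argument
  vector is in the domain iff some word of the set leads from it to the zero store.

  Without control states there is no evident way to compare two numbers stored in the stack, but
  a formula can compare one such number with a rational constant. The qBPA guesses a word of the regular set
  backwards and pushes it, with a binary digit added to each letter. Popping a letter of register
  \<open>r\<close> maps the probability \<open>x\<close> of reaching a goal of register \<open>r\<close> to \<open>(4x + d)/5\<close> for \<open>Add2\<close> and
  to \<open>(x + d)/2\<close> for \<open>Dec\<close>. Read from the top of the stack, these maps are inverted: they expand the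
  interval, so that digits that keep \<open>x\<close> inside always exist, while the exponent of 2 in the
  denominator of \<open>x\<close> grows by 2 or drops by 1, whatever the digits are. A counter value \<open>k\<close> is
  thus the same as the denominator \<open>2^(k+1)\<close>. The initial values are fixed by the constants
  \<open>1/2^(k+1)\<close> in the formula, and the tests require \<open>x = 1/2\<close>, which is the only
  number between 0 and 1 with denominator 2.

  As initial values enter through the formula alone, a decision procedure can be applied to an
  instance that contains the code of its own remaining parts, which is a contradiction.
\<close>

section \<open>Counter programs for partial recursive functions\<close>

text \<open>The system \<open>amp\<close> of names is not assumed to be computable, so the
  construction never computes a name: alphabet, rules and valuation of an instance enter as three
  fixed numbers, and only the formula around them is computed. Only amplitudes with rational real
  and imaginary parts are known to have names, so every probability has to be a sum of two rational
  squares. The two-digit map that adds 1 to the exponent, \<open>(2x + d)/3\<close>, is ruled out: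
  1/3 is no such sum. The numbers 4/5 and 1/5 are, which explains the odd choice of adding 2; an
  increment is \<open>Add2\<close> followed by \<open>Dec\<close>. The two conditional operations
  are treated differently. A \<open>Dec\<close> at value 0 excludes itself: it would leave an
  integer, and there is none strictly between 0 and 1. A \<open>Test\<close> leaves the value alone,
  so the digits cannot enforce it; the formula has to inspect every suffix of the stack at which a
  test is on top.\<close>

type_synonym store = "nat \<Rightarrow> nat"

datatype op = Add2 nat | Dec nat | Test nat

datatype prog = Op op | Seq prog prog | Star prog

primrec op_rel :: "op \<Rightarrow> (store \<times> store) set" where
  "op_rel (Add2 r) = {(s, t). t = s(r := s r + 2)}"
| "op_rel (Dec r) = {(s, t). s r > 0 \<and> t = s(r := s r - 1)}"
| "op_rel (Test r) = {(s, t). s r = 0 \<and> t = s}"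

primrec sem :: "prog \<Rightarrow> (store \<times> store) set" where
  "sem (Op a) = op_rel a"
| "sem (Seq p q) = sem p O sem q"
| "sem (Star p) = (sem p)\<^sup>*"

section \<open>Derived commands for counters\<close>

definition Inc :: "nat \<Rightarrow> prog" where
  "Inc r = Seq (Op (Add2 r)) (Op (Dec r))"

text \<open>The regular expressions \<open>prog\<close> have neither a unit nor a zero. Both are
  built on register 0, which may hold an input: \<open>Skip\<close> restores it, and
  \<open>Abort\<close> tests it when it is surely positive.\<close>

definition Skip :: prog where
  "Skip = Seq (Inc 0) (Op (Dec 0))"

definition Abort :: prog where
  "Abort = Seq (Inc 0) (Op (Test 0))"

definition Clear :: "nat \<Rightarrow> prog" where
  "Clear r = Seq (Star (Op (Dec r))) (Op (Test r))"

definition Move :: "nat \<Rightarrow> nat \<Rightarrow> prog" where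
  "Move r q = Seq (Star (Seq (Op (Dec r)) (Inc q))) (Op (Test r))"

definition Copy :: "nat \<Rightarrow> nat \<Rightarrow> nat \<Rightarrow> prog" where
  "Copy r q u = Seq (Seq (Star (Seq (Op (Dec r)) (Seq (Inc q) (Inc u)))) (Op (Test r))) (Move u r)"

primrec For :: "(nat \<Rightarrow> prog) \<Rightarrow> nat \<Rightarrow> prog" where
  "For c 0 = Skip"
| "For c (Suc k) = Seq (For c k) (c k)"

lemma sem_Seq: "(s, t) \<in> sem (Seq p q) \<longleftrightarrow> (\<exists>u. (s, u) \<in> sem p \<and> (u, t) \<in> sem q)"
  by auto

lemma sem_Seq_chain:
  assumes "\<And>u. (s, u) \<in> sem p \<longleftrightarrow> (\<exists>y. P y \<and> u = F y)"
    and "\<And>y. P y \<Longrightarrow> (F y, t) \<in> sem q \<longleftrightarrow> Q y"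
  shows "(s, t) \<in> sem (Seq p q) \<longleftrightarrow> (\<exists>y. P y \<and> Q y)"
  unfolding sem_Seq assms(1) using assms(2) by auto

text \<open>The fixpoint equation of a loop. Applied once to a loop that starts with
  \<open>Dec r\<close> and is followed by \<open>Test r\<close>, it leaves exactly one alternative
  for each value of \<open>r\<close>, so that nondeterministic exits do no harm.\<close>

lemma sem_Star_Seq:
  "(s, t) \<in> sem (Seq (Star p) q) \<longleftrightarrow>
     (s, t) \<in> sem q \<or> (\<exists>u. (s, u) \<in> sem p \<and> (u, t) \<in> sem (Seq (Star p) q))"
  by (auto elim: converse_rtranclE intro: converse_rtrancl_into_rtrancl)

lemma sem_Inc: "(s, t) \<in> sem (Inc r) \<longleftrightarrow> t = s(r := Suc (s r))"
proof -
  have "(s(r := s r + 2))(r := (s(r := s r + 2)) r - 1) = s(r := Suc (s r))" by simp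
  then show ?thesis unfolding Inc_def sem_Seq by (simp del: fun_upd_upd)
qed

lemma sem_Skip: "(s, t) \<in> sem Skip \<longleftrightarrow> t = s"
  unfolding Skip_def by (auto simp: sem_Inc relcomp_unfold)

lemma sem_Abort: "(s, t) \<notin> sem Abort"
  unfolding Abort_def by (auto simp: sem_Inc relcomp_unfold)

lemma sem_Clear: "(s, t) \<in> sem (Clear r) \<longleftrightarrow> t = s(r := 0)"
proof (induction "s r" arbitrary: s)
  case 0
  then show ?case unfolding Clear_def by (subst sem_Star_Seq) auto
next
  case (Suc k)
  let ?s = "s(r := s r - 1)"
  have "(s, t) \<in> sem (Clear r) \<longleftrightarrow> (?s, t) \<in> sem (Clear r)"
    unfolding Clear_def using Suc.hyps(2) by (subst sem_Star_Seq) (auto simp: relcomp_unfold)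
  also have "\<dots> \<longleftrightarrow> t = ?s(r := 0)" using Suc.hyps by (metis diff_Suc_1 fun_upd_same)
  finally show ?case by simp
qed

lemma sem_Move:
  assumes "r \<noteq> q"
  shows "(s, t) \<in> sem (Move r q) \<longleftrightarrow> t = s(r := 0, q := s q + s r)"
proof (induction "s r" arbitrary: s)
  case 0
  then show ?case unfolding Move_def by (subst sem_Star_Seq) (auto simp: fun_eq_iff)
next
  case (Suc k)
  let ?s = "s(r := s r - 1, q := Suc (s q))"
  have "(s, u) \<in> sem (Seq (Op (Dec r)) (Inc q)) \<longleftrightarrow> u = ?s" for u
    unfolding sem_Seq sem_Inc using Suc.hyps(2) assms by auto
  then have "(s, t) \<in> sem (Move r q) \<longleftrightarrow> (?s, t) \<in> sem (Move r q)"
    unfolding Move_def using Suc.hyps(2) by (subst sem_Star_Seq) (auto simp: relcomp_unfold)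
  also have "\<dots> \<longleftrightarrow> t = ?s(r := 0, q := ?s q + ?s r)"
    by (rule Suc.hyps(1)) (use Suc.hyps(2) assms in simp)
  also have "?s(r := 0, q := ?s q + ?s r) = s(r := 0, q := s q + s r)"
    using Suc.hyps(2) assms by (auto simp: fun_eq_iff)
  finally show ?case .
qed

lemma sem_Copy:
  assumes "r \<noteq> q" "u \<noteq> q" "u \<noteq> r" "s u = 0"
  shows "(s, t) \<in> sem (Copy r q u) \<longleftrightarrow> t = s(q := s q + s r)"
proof -
  let ?b = "Seq (Op (Dec r)) (Seq (Inc q) (Inc u))"
  \<comment> \<open>Stated for an arbitrary store \<open>v\<close>, because \<open>u\<close> does
    not stay zero inside the loop; \<open>s u = 0\<close> matters only when \<open>r\<close> is
    refilled from \<open>u\<close>.\<close>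
  have loop: "(v, t) \<in> sem (Seq (Star ?b) (Op (Test r))) \<longleftrightarrow>
      t = v(r := 0, q := v q + v r, u := v u + v r)" for v t
  proof (induction "v r" arbitrary: v)
    case 0
    then show ?case by (subst sem_Star_Seq) (auto simp: fun_eq_iff)
  next
    case (Suc k)
    let ?s = "v(r := v r - 1, q := Suc (v q), u := Suc (v u))"
    have "(v, x) \<in> sem ?b \<longleftrightarrow> x = ?s" for x
      unfolding sem_Seq sem_Inc using Suc.hyps(2) assms by auto
    then have "(v, t) \<in> sem (Seq (Star ?b) (Op (Test r))) \<longleftrightarrow>
        (?s, t) \<in> sem (Seq (Star ?b) (Op (Test r)))"
      using Suc.hyps(2) by (subst sem_Star_Seq) (auto simp: relcomp_unfold)
    also have "\<dots> \<longleftrightarrow> t = ?s(r := 0, q := ?s q + ?s r, u := ?s u + ?s r)"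
      by (rule Suc.hyps(1)) (use Suc.hyps(2) assms in simp)
    also have "?s(r := 0, q := ?s q + ?s r, u := ?s u + ?s r) = v(r := 0, q := v q + v r, u := v u + v r)"
      using Suc.hyps(2) assms by (auto simp: fun_eq_iff)
    finally show ?case .
  qed
  let ?v = "s(r := 0, q := s q + s r, u := s u + s r)"
  have "(s, t) \<in> sem (Copy r q u) \<longleftrightarrow> (?v, t) \<in> sem (Move u r)"
    unfolding Copy_def sem_Seq[of _ _ _ "Move u r"] loop by simp
  also have "\<dots> \<longleftrightarrow> t = ?v(u := 0, r := ?v r + ?v u)" by (rule sem_Move) (rule assms)
  also have "?v(u := 0, r := ?v r + ?v u) = s(q := s q + s r)"
    using assms by (auto simp: fun_eq_iff)
  finally show ?thesis .
qed

lemma sem_For_Clear: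
  "(s, t) \<in> sem (For (\<lambda>i. Clear (n + i)) k) \<longleftrightarrow> t = (\<lambda>r. if n \<le> r \<and> r < n + k then 0 else s r)"
proof (induction k arbitrary: t)
  case 0
  have "(\<lambda>r. if n \<le> r \<and> r < n + 0 then 0 else s r) = s" by auto
  then show ?case by (simp add: sem_Skip)
next
  case (Suc k)
  have "(\<lambda>r. if n \<le> r \<and> r < n + k then 0 else s r)(n + k := 0) =
      (\<lambda>r. if n \<le> r \<and> r < n + Suc k then 0 else s r)"
    by (auto simp: fun_eq_iff)
  then show ?case unfolding For.simps sem_Seq Suc.IH sem_Clear by auto
qed

section \<open>Compilation of partial recursive functions\<close>

text \<open>\<open>rs\<close> are the input registers, \<open>q\<close> is the output and
  \<open>n\<close> the first scratch register; they are bound by lambdas so that the nested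
  recursion can be written \<open>map compile gs\<close>. In \<open>Prim_Rec\<close> the registers
  \<open>n\<close> to \<open>n + 3\<close> hold the recursion index, the value at that index, the
  number of iterations left and the next value; in \<open>Minimize\<close>, \<open>n\<close> and
  \<open>n + 1\<close> hold the candidate and its value.\<close>

primrec compile :: "recf \<Rightarrow> nat list \<Rightarrow> nat \<Rightarrow> nat \<Rightarrow> prog" where
  "compile Zero = (\<lambda>rs q n. Skip)"
| "compile Succ = (\<lambda>rs q n. if length rs = 1 then Seq (Copy (hd rs) q n) (Inc q) else Abort)"
| "compile (Proj i) = (\<lambda>rs q n. if i < length rs then Copy (rs ! i) q n else Abort)"
| "compile (Comp f gs) = (\<lambda>rs q n.
     let k = length gs; cs = map compile gs in
     Seq (For (\<lambda>i. (cs ! i) rs (n + i) (n + k)) k)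
       (Seq (compile f [n..<n + k] q (n + k)) (For (\<lambda>i. Clear (n + i)) k)))"
| "compile (Prim_Rec f g) = (\<lambda>rs q n.
     if rs = [] then Abort else
     Seq (Seq (Copy (hd rs) (n + 2) (n + 4)) (compile f (tl rs) (n + 1) (n + 4)))
       (Seq (Seq (Star (Seq (Op (Dec (n + 2)))
             (Seq (compile g (n # Suc n # tl rs) (n + 3) (n + 4))
               (Seq (Clear (n + 1)) (Seq (Move (n + 3) (n + 1)) (Inc n))))))
             (Op (Test (n + 2))))
       (Seq (Move (n + 1) q) (Clear n))))"
| "compile (Minimize f) = (\<lambda>rs q n.
     Seq (Seq (Star (Seq (compile f (n # rs) (n + 1) (n + 2))
           (Seq (Op (Dec (n + 1))) (Seq (Clear (n + 1)) (Inc n)))))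
         (Seq (compile f (n # rs) (n + 1) (n + 2)) (Op (Test (n + 1)))))
       (Move n q))"

text \<open>Registers from \<open>n\<close> on are scratch; they are zero before and after a run.\<close>

definition admissible :: "nat list \<Rightarrow> nat \<Rightarrow> nat \<Rightarrow> store \<Rightarrow> bool" where
  "admissible rs q n s \<longleftrightarrow> set rs \<subseteq> {..<n} \<and> q < n \<and> q \<notin> set rs \<and> s q = 0 \<and> (\<forall>r\<ge>n. s r = 0)"

text \<open>Programs are nondeterministic, so the equivalence has to cover every final store: it
  also excludes wrong results from a loop that is left too early. As only \<open>q\<close> changes,
  inputs can be read again in later calls.\<close>

definition compiles :: "recf \<Rightarrow> bool" where
  "compiles f \<longleftrightarrow> (\<forall>rs q n s t. admissible rs q n s \<longrightarrow>
     ((s, t) \<in> sem (compile f rs q n) \<longleftrightarrow> (\<exists>y. evaluates f (map s rs) y \<and> t = s(q := y))))"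

lemma compilesD:
  "compiles f \<Longrightarrow> admissible rs q n s \<Longrightarrow>
     (s, t) \<in> sem (compile f rs q n) \<longleftrightarrow> (\<exists>y. evaluates f (map s rs) y \<and> t = s(q := y))"
  unfolding compiles_def by blast

lemma evaluates_Zero_iff: "evaluates Zero xs y \<longleftrightarrow> y = 0"
  by (auto intro: evaluates.zero elim: evaluates_elims)

lemma evaluates_Succ_iff: "evaluates Succ xs y \<longleftrightarrow> (\<exists>x. xs = [x] \<and> y = Suc x)"
  by (auto intro: evaluates.succ elim: evaluates_elims)

lemma evaluates_Proj_iff: "evaluates (Proj i) xs y \<longleftrightarrow> i < length xs \<and> y = xs ! i"
  by (auto intro: evaluates.proj elim: evaluates_elims)

lemma evaluates_Comp_iff:
  "evaluates (Comp f gs) xs z \<longleftrightarrow>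
     (\<exists>ys. length ys = length gs \<and> (\<forall>i<length gs. evaluates (gs ! i) xs (ys ! i)) \<and> evaluates f ys z)"
  by (auto elim!: evaluates_elims(4)) (metis evaluates.comp)

lemma evaluates_Prim_Rec_0_iff: "evaluates (Prim_Rec f g) (0 # xs) y \<longleftrightarrow> evaluates f xs y"
  by (auto intro: evaluates.prim_rec_0 elim: evaluates_elims)

lemma evaluates_Prim_Rec_Suc_iff:
  "evaluates (Prim_Rec f g) (Suc n # xs) y \<longleftrightarrow>
     (\<exists>r. evaluates (Prim_Rec f g) (n # xs) r \<and> evaluates g (n # r # xs) y)"
  by (auto intro: evaluates.prim_rec_Suc elim: evaluates_elims)

lemma evaluates_Prim_Rec_Nil: "\<not> evaluates (Prim_Rec f g) [] y"
  by (auto elim: evaluates.cases)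

lemma evaluates_Minimize_iff:
  "evaluates (Minimize f) xs n \<longleftrightarrow>
     evaluates f (n # xs) 0 \<and> (\<forall>m<n. \<exists>k. evaluates f (m # xs) (Suc k))"
  by (auto intro: evaluates.minimize elim!: evaluates_elims(7))

lemma compiles_Zero: "compiles Zero"
  unfolding compiles_def by (auto simp: sem_Skip evaluates_Zero_iff admissible_def)

lemma compiles_Proj: "compiles (Proj i)"
  unfolding compiles_def
proof (intro allI impI)
  fix rs q n s t assume a: "admissible rs q n s"
  show "(s, t) \<in> sem (compile (Proj i) rs q n) \<longleftrightarrow> (\<exists>y. evaluates (Proj i) (map s rs) y \<and> t = s(q := y))"
  proof (cases "i < length rs")
    case True
    then have "rs ! i \<in> set rs" by simp
    then have "rs ! i \<noteq> q" "n \<noteq> q" "n \<noteq> rs ! i" "s n = 0" "s q = 0"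
      using a unfolding admissible_def by auto
    then show ?thesis using True by (simp add: sem_Copy evaluates_Proj_iff)
  qed (simp add: evaluates_Proj_iff sem_Abort)
qed

lemma compiles_Succ: "compiles Succ"
  unfolding compiles_def
proof (intro allI impI)
  fix rs q n s t assume a: "admissible rs q n s"
  show "(s, t) \<in> sem (compile Succ rs q n) \<longleftrightarrow> (\<exists>y. evaluates Succ (map s rs) y \<and> t = s(q := y))"
  proof (cases "length rs = 1")
    case True
    then obtain r where r: "rs = [r]" by (cases rs) auto
    then have "r \<noteq> q" "n \<noteq> q" "n \<noteq> r" "s n = 0" "s q = 0"
      using a unfolding admissible_def by auto
    then have "(s, u) \<in> sem (Copy r q n) \<longleftrightarrow> u = s(q := s r)" for u by (simp add: sem_Copy)
    then show ?thesis using r by (auto simp: sem_Seq sem_Inc evaluates_Succ_iff simp del: sem.simps)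
  qed (auto simp: evaluates_Succ_iff sem_Abort)
qed

text \<open>The arguments pile up in registers \<open>n\<close> to \<open>n + ?k - 1\<close>, while
  every inner call takes its scratch registers from \<open>n + ?k\<close> on, so no call disturbs a
  value computed earlier.\<close>

lemma compiles_Comp:
  assumes f: "compiles f" and gs: "\<And>g. g \<in> set gs \<Longrightarrow> compiles g"
  shows "compiles (Comp f gs)"
  unfolding compiles_def
proof (intro allI impI)
  fix rs q n s t assume a: "admissible rs q n s"
  let ?k = "length gs"
  define args :: "nat list \<Rightarrow> store" where
    "args ys = (\<lambda>r. if n \<le> r \<and> r < n + length ys then ys ! (r - n) else s r)" for ys
  have rs: "\<And>r. r \<in> set rs \<Longrightarrow> r < n" and q: "q < n" "q \<notin> set rs" "s q = 0"
    and z: "\<And>r. n \<le> r \<Longrightarrow> s r = 0"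
    using a unfolding admissible_def by auto
  define good where
    "good ys j \<longleftrightarrow> length ys = j \<and> (\<forall>i<j. evaluates (gs ! i) (map s rs) (ys ! i))" for ys j
  have good_Suc: "good (ys @ [y]) (Suc j) \<longleftrightarrow> good ys j \<and> evaluates (gs ! j) (map s rs) y" for ys y j
    by (auto simp: good_def nth_append less_Suc_eq)
  have good_snoc: "\<exists>zs y. ys = zs @ [y]" if "good ys (Suc j)" for ys j
    using that unfolding good_def by (metis length_Suc_conv_rev)
  have first: "j \<le> ?k \<Longrightarrow> (s, u) \<in> sem (For (\<lambda>i. (map compile gs ! i) rs (n + i) (n + ?k)) j) \<longleftrightarrow>
      (\<exists>ys. good ys j \<and> u = args ys)" for j u
  proof (induction j arbitrary: u)
    case 0
    have "args [] = s" by (auto simp: args_def)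
    then show ?case by (simp add: sem_Skip good_def)
  next
    case (Suc j)
    let ?c = "(map compile gs ! j) rs (n + j) (n + ?k)"
    have step: "(args ys, u) \<in> sem ?c \<longleftrightarrow>
        (\<exists>y. evaluates (gs ! j) (map s rs) y \<and> u = args (ys @ [y]))" if "good ys j" for ys u
    proof -
      have len: "length ys = j" using that by (simp add: good_def)
      \<comment> \<open>The output register \<open>n + j\<close> is still zero: exactly
        \<open>j\<close> arguments have been stored, in the registers below it.\<close>
      have "admissible rs (n + j) (n + ?k) (args ys)"
        using Suc.prems len z rs by (force simp: admissible_def args_def)
      then have "(args ys, u) \<in> sem (compile (gs ! j) rs (n + j) (n + ?k)) \<longleftrightarrow>
          (\<exists>y. evaluates (gs ! j) (map (args ys) rs) y \<and> u = (args ys)(n + j := y))"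
        using gs Suc.prems by (intro compilesD) auto
      moreover have "map (args ys) rs = map s rs" using rs by (force simp: args_def)
      moreover have "(args ys)(n + j := y) = args (ys @ [y])" for y
        using len by (auto simp: args_def fun_eq_iff nth_append)
      ultimately show ?thesis using Suc.prems by simp
    qed
    have "(s, u) \<in> sem (For (\<lambda>i. (map compile gs ! i) rs (n + i) (n + ?k)) (Suc j)) \<longleftrightarrow>
      (\<exists>v. (\<exists>ys. good ys j \<and> v = args ys) \<and> (v, u) \<in> sem ?c)"
      unfolding For.simps sem_Seq using Suc.IH Suc.prems by (simp only: Suc_leD)
    also have "\<dots> \<longleftrightarrow> (\<exists>ys. good ys j \<and> (args ys, u) \<in> sem ?c)"
      by blast
    also have "\<dots> \<longleftrightarrow> (\<exists>ys y. good (ys @ [y]) (Suc j) \<and> u = args (ys @ [y]))"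
      unfolding good_Suc using step by (simp cong: conj_cong)
    also have "\<dots> \<longleftrightarrow> (\<exists>ys. good ys (Suc j) \<and> u = args ys)"
      using good_snoc by metis
    finally show ?case .
  qed
  have second: "(args ys, u) \<in> sem (compile f [n..<n + ?k] q (n + ?k)) \<longleftrightarrow>
      (\<exists>y. evaluates f ys y \<and> u = (args ys)(q := y))" if "length ys = ?k" for ys u
  proof -
    have "admissible [n..<n + ?k] q (n + ?k) (args ys)"
      using that q z by (auto simp: admissible_def args_def)
    moreover have "map (args ys) [n..<n + ?k] = ys"
      using that by (intro nth_equalityI) (auto simp: args_def)
    ultimately show ?thesis using compilesD[OF f] by simp
  qed
  have third: "((args ys)(q := y), u) \<in> sem (For (\<lambda>i. Clear (n + i)) ?k) \<longleftrightarrow> u = s(q := y)"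
    if "length ys = ?k" for ys y u
  proof -
    have "(\<lambda>r. if n \<le> r \<and> r < n + ?k then 0 else ((args ys)(q := y)) r) = s(q := y)"
      using that q z by (auto simp: args_def fun_eq_iff)
    then show ?thesis by (simp add: sem_For_Clear)
  qed
  show "(s, t) \<in> sem (compile (Comp f gs) rs q n) \<longleftrightarrow>
      (\<exists>y. evaluates (Comp f gs) (map s rs) y \<and> t = s(q := y))"
  proof -
    have "(s, t) \<in> sem (compile (Comp f gs) rs q n) \<longleftrightarrow>
        (\<exists>ys. good ys ?k \<and> (\<exists>v. (args ys, v) \<in> sem (compile f [n..<n + ?k] q (n + ?k)) \<and>
           (v, t) \<in> sem (For (\<lambda>i. Clear (n + i)) ?k)))"
      unfolding compile.simps Let_def sem_Seq first[OF order_refl] by blast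
    also have "\<dots> \<longleftrightarrow> (\<exists>ys. good ys ?k \<and> (\<exists>y. evaluates f ys y \<and> t = s(q := y)))"
    proof (intro ex_cong1 conj_cong refl)
      fix ys assume "good ys ?k"
      then have len: "length ys = ?k" by (simp add: good_def)
      show "(\<exists>v. (args ys, v) \<in> sem (compile f [n..<n + ?k] q (n + ?k)) \<and>
           (v, t) \<in> sem (For (\<lambda>i. Clear (n + i)) ?k)) \<longleftrightarrow> (\<exists>y. evaluates f ys y \<and> t = s(q := y))"
        unfolding second[OF len] using third[OF len] by blast
    qed
    finally show ?thesis unfolding evaluates_Comp_iff good_def by blast
  qed
qed

text \<open>The program computes the recursion upwards from 0, whereas \<open>evaluates\<close>
  descends. A value at the top guarantees that no intermediate stage of the program gets
  stuck.\<close>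

lemma Prim_Rec_defined_mono:
  "evaluates (Prim_Rec f g) ((i + k) # xs) y \<Longrightarrow> \<exists>r. evaluates (Prim_Rec f g) (i # xs) r"
  by (induction k arbitrary: y) (auto simp: evaluates_Prim_Rec_Suc_iff)

lemma compiles_Prim_Rec:
  assumes f: "compiles f" and g: "compiles g"
  shows "compiles (Prim_Rec f g)"
  unfolding compiles_def
proof (intro allI impI)
  fix rs q n s t assume a: "admissible rs q n s"
  show "(s, t) \<in> sem (compile (Prim_Rec f g) rs q n) \<longleftrightarrow>
      (\<exists>y. evaluates (Prim_Rec f g) (map s rs) y \<and> t = s(q := y))"
  proof (cases rs)
    case Nil
    then show ?thesis by (simp add: sem_Abort evaluates_Prim_Rec_Nil)
  next
    case (Cons r rs')
    let ?xs = "map s rs'"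
    have rs: "r < n" "r \<noteq> q" "\<And>r. r \<in> set rs' \<Longrightarrow> r < n" and q: "q < n" "q \<notin> set rs'" "s q = 0"
      and z: "\<And>r. n \<le> r \<Longrightarrow> s r = 0"
      using a Cons unfolding admissible_def by auto
    define S where "S i acc c = s(n := i, n + 1 := acc, n + 2 := c)" for i acc c :: nat
    have same: "map (S i acc c) rs' = ?xs" for i acc c using rs(3) by (force simp: S_def)
    have first: "(s, u) \<in> sem (Copy r (n + 2) (n + 4)) \<longleftrightarrow> u = S 0 0 (s r)" for u
    proof -
      have "s(n + 2 := s (n + 2) + s r) = S 0 0 (s r)" using z by (auto simp: S_def fun_eq_iff)
      then show ?thesis using rs z by (subst sem_Copy) auto
    qed
    have second: "(S 0 0 c, u) \<in> sem (compile f rs' (n + 1) (n + 4)) \<longleftrightarrow>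
        (\<exists>y. evaluates (Prim_Rec f g) (0 # ?xs) y \<and> u = S 0 y c)" for c u
    proof -
      have "admissible rs' (n + 1) (n + 4) (S 0 0 c)"
        using rs z by (force simp: admissible_def S_def)
      moreover have "(S 0 0 c)(n + 1 := y) = S 0 y c" for y by (auto simp: S_def fun_eq_iff)
      ultimately show ?thesis using compilesD[OF f] by (simp add: same evaluates_Prim_Rec_0_iff)
    qed
    let ?body = "Seq (Op (Dec (n + 2))) (Seq (compile g (n # Suc n # rs') (n + 3) (n + 4))
               (Seq (Clear (n + 1)) (Seq (Move (n + 3) (n + 1)) (Inc n))))"
    have stuck: "(S i acc 0, u) \<notin> sem ?body" for i acc u by (auto simp: S_def)
    have body: "(S i acc (Suc c), u) \<in> sem ?body \<longleftrightarrow>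
        (\<exists>y. evaluates g (i # acc # ?xs) y \<and> u = S (Suc i) y c)" for i acc c u
    proof -
      have "admissible (n # Suc n # rs') (n + 3) (n + 4) (S i acc c)"
        using rs z by (force simp: admissible_def S_def)
      moreover have "map (S i acc c) (n # Suc n # rs') = i # acc # ?xs"
        using same by (simp add: S_def)
      ultimately have 1: "(S i acc c, v) \<in> sem (compile g (n # Suc n # rs') (n + 3) (n + 4)) \<longleftrightarrow>
          (\<exists>y. evaluates g (i # acc # ?xs) y \<and> v = (S i acc c)(n + 3 := y))" for v
        using compilesD[OF g, of "n # Suc n # rs'" "n + 3" "n + 4" "S i acc c" v] by (simp only:)
      have 2: "((S i acc c)(n + 3 := y), v) \<in> sem (Seq (Clear (n + 1)) (Seq (Move (n + 3) (n + 1)) (Inc n)))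
          \<longleftrightarrow> v = S (Suc i) y c" for y v
      proof -
        have "(S i acc c)(n + 3 := y, n + 1 := 0, n + 3 := 0, n + 1 := y, n := Suc i) = S (Suc i) y c"
          using z by (auto simp: S_def fun_eq_iff)
        then show ?thesis
          unfolding sem_Seq by (simp add: sem_Clear sem_Move sem_Inc) (simp add: S_def)
      qed
      have 3: "(S i acc (Suc c), v) \<in> sem (Op (Dec (n + 2))) \<longleftrightarrow> v = S i acc c" for v
        by (auto simp: S_def fun_eq_iff)
      show ?thesis unfolding sem_Seq[of _ _ "Op (Dec (n + 2))"] 3 simp_thms
        unfolding sem_Seq[of _ _ "compile g (n # Suc n # rs') (n + 3) (n + 4)"] 1
        using 2 by blast
    qed
    \<comment> \<open>The loop invariant: \<open>acc\<close> is the value at \<open>i\<close>, and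
      \<open>i + c\<close> stays equal to the recursion argument.\<close>
    have loop: "(S i acc c, u) \<in> sem (Seq (Star ?body) (Op (Test (n + 2)))) \<longleftrightarrow>
        (\<exists>y. evaluates (Prim_Rec f g) ((i + c) # ?xs) y \<and> u = S (i + c) y 0)"
      if "evaluates (Prim_Rec f g) (i # ?xs) acc" for i acc c u
      using that
    proof (induction c arbitrary: i acc)
      case 0
      have "(S i acc 0, u) \<in> sem (Seq (Star ?body) (Op (Test (n + 2)))) \<longleftrightarrow> u = S i acc 0"
        using stuck[of i acc] by (subst sem_Star_Seq) (auto simp: S_def)
      then show ?case using 0 evaluates_deterministic by auto
    next
      case (Suc c)
      have "(S i acc (Suc c), u) \<in> sem (Seq (Star ?body) (Op (Test (n + 2)))) \<longleftrightarrow>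
          (\<exists>y. evaluates g (i # acc # ?xs) y \<and>
             (S (Suc i) y c, u) \<in> sem (Seq (Star ?body) (Op (Test (n + 2)))))"
        by (subst sem_Star_Seq, unfold body) (auto simp: S_def)
      also have "\<dots> \<longleftrightarrow> (\<exists>y. evaluates g (i # acc # ?xs) y \<and>
          (\<exists>y'. evaluates (Prim_Rec f g) ((i + Suc c) # ?xs) y' \<and> u = S (i + Suc c) y' 0))"
      proof -
        have "(S (Suc i) y c, u) \<in> sem (Seq (Star ?body) (Op (Test (n + 2)))) \<longleftrightarrow>
            (\<exists>y'. evaluates (Prim_Rec f g) ((i + Suc c) # ?xs) y' \<and> u = S (i + Suc c) y' 0)"
          if "evaluates g (i # acc # ?xs) y" for y
        proof -
          have "evaluates (Prim_Rec f g) (Suc i # ?xs) y"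
            using that Suc.prems by (rule evaluates.prim_rec_Suc[rotated])
          from Suc.IH[OF this] show ?thesis by (simp only: add_Suc_right add_Suc)
        qed
        then show ?thesis by blast
      qed
      also have "\<dots> \<longleftrightarrow> (\<exists>y'. evaluates (Prim_Rec f g) ((i + Suc c) # ?xs) y' \<and> u = S (i + Suc c) y' 0)"
      proof -
        have "\<exists>y. evaluates g (i # acc # ?xs) y"
          if "evaluates (Prim_Rec f g) ((i + Suc c) # ?xs) y'" for y'
        proof -
          obtain r where "evaluates (Prim_Rec f g) (Suc i # ?xs) r"
            using Prim_Rec_defined_mono[of f g "Suc i" c] \<open>evaluates _ ((i + Suc c) # _) _\<close> by auto
          then obtain acc' where "evaluates (Prim_Rec f g) (i # ?xs) acc'" "evaluates g (i # acc' # ?xs) r"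
            unfolding evaluates_Prim_Rec_Suc_iff by (elim exE conjE)
          then show ?thesis using evaluates_deterministic[OF Suc.prems] by metis
        qed
        then show ?thesis by blast
      qed
      finally show ?case .
    qed
    have last: "(S i y 0, u) \<in> sem (Seq (Move (n + 1) q) (Clear n)) \<longleftrightarrow> u = s(q := y)" for i y u
    proof -
      have "(S i y 0)(n + 1 := 0, q := y, n := 0) = s(q := y)"
        using q z by (auto simp: S_def fun_eq_iff)
      moreover have "n + 1 \<noteq> q" "(S i y 0) q = 0" "(S i y 0) (n + 1) = y" using q by (auto simp: S_def)
      ultimately show ?thesis unfolding sem_Seq by (simp add: sem_Clear sem_Move)
    qed
    have xs: "map s rs = s r # ?xs" using Cons by simp
    have prep: "(s, u) \<in> sem (Seq (Copy r (n + 2) (n + 4)) (compile f rs' (n + 1) (n + 4))) \<longleftrightarrow>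
        (\<exists>y. evaluates (Prim_Rec f g) (0 # ?xs) y \<and> u = S 0 y (s r))" for u
      unfolding sem_Seq first using second by simp
    have start: "\<exists>r. evaluates (Prim_Rec f g) (0 # ?xs) r"
      if "evaluates (Prim_Rec f g) (s r # ?xs) y" for y
      using Prim_Rec_defined_mono[of f g 0 "s r"] that by simp
    have finish: "(S 0 y0 (s r), t) \<in> sem (Seq (Seq (Star ?body) (Op (Test (n + 2))))
          (Seq (Move (n + 1) q) (Clear n))) \<longleftrightarrow>
        (\<exists>y. evaluates (Prim_Rec f g) (s r # ?xs) y \<and> t = s(q := y))"
      if "evaluates (Prim_Rec f g) (0 # ?xs) y0" for y0
    proof (rule sem_Seq_chain[where F = "\<lambda>y. S (s r) y 0"])
      show "(S 0 y0 (s r), u) \<in> sem (Seq (Star ?body) (Op (Test (n + 2)))) \<longleftrightarrow>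
          (\<exists>y. evaluates (Prim_Rec f g) (s r # ?xs) y \<and> u = S (s r) y 0)" for u
        using loop[OF that, of "s r"] by (simp only: add_0)
    qed (rule last)
    have "(s, t) \<in> sem (compile (Prim_Rec f g) rs q n) \<longleftrightarrow>
      (\<exists>y0. evaluates (Prim_Rec f g) (0 # ?xs) y0 \<and>
        (\<exists>y. evaluates (Prim_Rec f g) (s r # ?xs) y \<and> t = s(q := y)))"
      unfolding compile.simps Cons list.sel if_not_P[OF list.distinct(2)]
      by (rule sem_Seq_chain[OF prep finish])
    then show ?thesis unfolding xs using start by auto
  qed
qed

text \<open>No register decreases in this loop, so its two directions need separate inductions: over
  the iterations of \<open>Star\<close> for soundness, and over the distance \<open>d\<close> from
  the candidate to the zero for completeness.\<close>

lemma compiles_Minimize: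
  assumes f: "compiles f"
  shows "compiles (Minimize f)"
  unfolding compiles_def
proof (intro allI impI)
  fix rs q n s t assume a: "admissible rs q n s"
  let ?xs = "map s rs"
  have rs: "\<And>r. r \<in> set rs \<Longrightarrow> r < n" and q: "q < n" "q \<notin> set rs" "s q = 0"
    and z: "\<And>r. n \<le> r \<Longrightarrow> s r = 0"
    using a unfolding admissible_def by auto
  define S where "S i = s(n := i)" for i
  have call: "(S i, u) \<in> sem (compile f (n # rs) (n + 1) (n + 2)) \<longleftrightarrow>
      (\<exists>y. evaluates f (i # ?xs) y \<and> u = (S i)(n + 1 := y))" for i u
  proof -
    have "admissible (n # rs) (n + 1) (n + 2) (S i)"
      using rs z by (force simp: admissible_def S_def)
    moreover have "map (S i) (n # rs) = i # ?xs" using rs by (force simp: S_def)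
    ultimately show ?thesis using compilesD[OF f, of "n # rs" "n + 1" "n + 2" "S i" u] by (simp only:)
  qed
  let ?body = "Seq (compile f (n # rs) (n + 1) (n + 2))
           (Seq (Op (Dec (n + 1))) (Seq (Clear (n + 1)) (Inc n)))"
  let ?exit = "Seq (compile f (n # rs) (n + 1) (n + 2)) (Op (Test (n + 1)))"
  have body: "(S i, u) \<in> sem ?body \<longleftrightarrow> (\<exists>k. evaluates f (i # ?xs) (Suc k)) \<and> u = S (Suc i)" for i u
  proof -
    have 1: "((S i)(n + 1 := y), v) \<in> sem (Seq (Op (Dec (n + 1))) (Seq (Clear (n + 1)) (Inc n))) \<longleftrightarrow>
        (\<exists>k. y = Suc k) \<and> v = S (Suc i)" for y v
    proof -
      have eq: "(S i)(n + 1 := 0, n := Suc i) = S (Suc i)"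
        using z by (auto simp: S_def fun_eq_iff)
      have n: "S i n = i" by (simp add: S_def)
      have dec: "(u, v) \<in> sem (Op (Dec r)) \<longleftrightarrow> u r > 0 \<and> v = u(r := u r - 1)" for u v r by auto
      show ?thesis
        unfolding sem_Seq sem_Clear sem_Inc dec gr0_conv_Suc[symmetric] using eq n by auto
    qed
    have "(S i, u) \<in> sem ?body \<longleftrightarrow>
        (\<exists>y. evaluates f (i # ?xs) y \<and> (\<exists>k. y = Suc k) \<and> u = S (Suc i))"
      by (rule sem_Seq_chain[OF call 1])
    then show ?thesis by auto
  qed
  have exit: "(S i, u) \<in> sem ?exit \<longleftrightarrow> evaluates f (i # ?xs) 0 \<and> u = S i" for i u
  proof -
    have "(S i)(n + 1 := 0) = S i" "S i (n + 1) = 0" using z by (auto simp: S_def fun_eq_iff)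
    then have "((S i)(n + 1 := y), u) \<in> sem (Op (Test (n + 1))) \<longleftrightarrow> y = 0 \<and> u = S i" for y
      by auto
    then have "(S i, u) \<in> sem ?exit \<longleftrightarrow> (\<exists>y. evaluates f (i # ?xs) y \<and> y = 0 \<and> u = S i)"
      by (rule sem_Seq_chain[OF call])
    then show ?thesis by simp
  qed
  have loop1: "\<exists>j\<ge>i. evaluates f (j # ?xs) 0 \<and>
      (\<forall>m. i \<le> m \<and> m < j \<longrightarrow> (\<exists>k. evaluates f (m # ?xs) (Suc k))) \<and> u = S j"
    if "(S i, u) \<in> sem (Seq (Star ?body) ?exit)" for i u
  proof -
    from that obtain v where v: "(S i, v) \<in> (sem ?body)\<^sup>*" "(v, u) \<in> sem ?exit"
      unfolding sem_Seq[of _ _ "Star ?body"] sem.simps(3) by blast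
    from v(1) have "\<exists>j\<ge>i. v = S j \<and> (\<forall>m. i \<le> m \<and> m < j \<longrightarrow> (\<exists>k. evaluates f (m # ?xs) (Suc k)))"
    proof (induction rule: rtrancl_induct)
      case base
      show ?case by (intro exI[of _ i]) auto
    next
      case (step v w)
      then obtain j where j: "j \<ge> i" "v = S j"
        "\<forall>m. i \<le> m \<and> m < j \<longrightarrow> (\<exists>k. evaluates f (m # ?xs) (Suc k))" by blast
      have "(S j, w) \<in> sem ?body" using step.hyps(2) j(2) by (simp only:)
      then have "w = S (Suc j)" "\<exists>k. evaluates f (j # ?xs) (Suc k)" unfolding body by (rule conjunct2, rule conjunct1)
      with j show ?case by (intro exI[of _ "Suc j"]) (auto simp: less_Suc_eq)
    qed
    then obtain j where j: "j \<ge> i" "v = S j"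
        "\<forall>m. i \<le> m \<and> m < j \<longrightarrow> (\<exists>k. evaluates f (m # ?xs) (Suc k))" by blast
    have "evaluates f (j # ?xs) 0 \<and> u = S j" using v(2) unfolding j(2) exit .
    then show ?thesis using j by (intro exI[of _ j]) simp
  qed
  have loop2: "(S i, S (i + d)) \<in> sem (Seq (Star ?body) ?exit)"
    if "evaluates f ((i + d) # ?xs) 0" "\<forall>m. i \<le> m \<and> m < i + d \<longrightarrow> (\<exists>k. evaluates f (m # ?xs) (Suc k))"
    for i d
    using that
  proof (induction d arbitrary: i)
    case 0
    then show ?case by (subst sem_Star_Seq) (simp only: exit add_0_right refl simp_thms)
  next
    case (Suc d)
    have "(S (Suc i), S (Suc i + d)) \<in> sem (Seq (Star ?body) ?exit)"
      using Suc.prems by (intro Suc.IH) auto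
    moreover have "(S i, S (Suc i)) \<in> sem ?body" unfolding body using Suc.prems(2) by simp
    ultimately show ?case by (subst sem_Star_Seq) (simp only: add_Suc_right add_Suc, blast)
  qed
  have init: "s = S 0" using z by (auto simp: S_def fun_eq_iff)
  have loop: "(s, u) \<in> sem (Seq (Star ?body) ?exit) \<longleftrightarrow>
      (\<exists>y. evaluates (Minimize f) ?xs y \<and> u = S y)" for u
  proof
    assume "(s, u) \<in> sem (Seq (Star ?body) ?exit)"
    then show "\<exists>y. evaluates (Minimize f) ?xs y \<and> u = S y"
      using loop1[of 0 u] unfolding init[symmetric] evaluates_Minimize_iff by auto
  next
    assume "\<exists>y. evaluates (Minimize f) ?xs y \<and> u = S y"
    then show "(s, u) \<in> sem (Seq (Star ?body) ?exit)"
      using loop2[of 0] unfolding init[symmetric] evaluates_Minimize_iff by auto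
  qed
  have last: "(S y, u) \<in> sem (Move n q) \<longleftrightarrow> u = s(q := y)" for y u
  proof -
    have "(S y)(n := 0, q := S y q + S y n) = s(q := y)"
      using q z by (auto simp: S_def fun_eq_iff)
    then show ?thesis using q by (subst sem_Move) auto
  qed
  show "(s, t) \<in> sem (compile (Minimize f) rs q n) \<longleftrightarrow>
      (\<exists>y. evaluates (Minimize f) ?xs y \<and> t = s(q := y))"
    unfolding compile.simps by (rule sem_Seq_chain[OF loop last])
qed

lemma compiles: "compiles f"
proof (induction f)
  case (Comp f gs)
  then show ?case by (intro compiles_Comp) auto
qed (simp_all add: compiles_Zero compiles_Succ compiles_Proj compiles_Prim_Rec compiles_Minimize)

definition store_of :: "nat list \<Rightarrow> store" where
  "store_of xs = (\<lambda>r. if r < length xs then xs ! r else 0)"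

text \<open>Inputs and output are cleared at the end because acceptance has to be the all-zero
  store: this is the only store represented by the empty word of letters, where every
  \<open>stack_value\<close> is 1/2.\<close>

lemma domain_as_program:
  "\<exists>p. \<forall>xs. length xs = k \<longrightarrow> ((store_of xs, \<lambda>_. 0) \<in> sem p \<longleftrightarrow> (\<exists>y. evaluates f xs y))"
proof (intro exI allI impI)
  let ?p = "Seq (compile f [0..<k] k (Suc k)) (For (\<lambda>i. Clear (0 + i)) (Suc k))"
  fix xs :: "nat list" assume k: "length xs = k"
  have "admissible [0..<k] k (Suc k) (store_of xs)"
    using k by (auto simp: admissible_def store_of_def)
  moreover have "map (store_of xs) [0..<k] = xs"
    using k by (intro nth_equalityI) (auto simp: store_of_def)
  ultimately have "(store_of xs, t) \<in> sem (compile f [0..<k] k (Suc k)) \<longleftrightarrow>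
      (\<exists>y. evaluates f xs y \<and> t = (store_of xs)(k := y))" for t
    using compilesD[OF compiles[of f], of "[0..<k]" k "Suc k" "store_of xs" t] by (simp only:)
  moreover have "((store_of xs)(k := y), \<lambda>_. 0) \<in> sem (For (\<lambda>i. Clear (0 + i)) (Suc k))" for y
    unfolding sem_For_Clear using k by (auto simp: store_of_def fun_eq_iff)
  ultimately show "(store_of xs, \<lambda>_. 0) \<in> sem ?p \<longleftrightarrow> (\<exists>y. evaluates f xs y)"
    unfolding sem_Seq by blast
qed

section \<open>Traces of counter programs and their digits\<close>

text \<open>A list of programs stands for their concatenation and serves as an automaton state. A
  move out of \<open>Op a # k\<close> reads the letter \<open>a\<close>; all other moves are
  silent.\<close>

fun next_prog :: "prog list \<Rightarrow> prog list set" where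
  "next_prog [] = {}"
| "next_prog (Op a # k) = {k}"
| "next_prog (Seq p q # k) = {p # q # k}"
| "next_prog (Star p # k) = {k, p # Star p # k}"

inductive trace :: "prog list \<Rightarrow> op list \<Rightarrow> bool" where
  trace_Nil: "trace [] []"
| trace_Op: "trace k w \<Longrightarrow> trace (Op a # k) (a # w)"
| trace_Seq: "trace (p # q # k) w \<Longrightarrow> trace (Seq p q # k) w"
| trace_Star_exit: "trace k w \<Longrightarrow> trace (Star p # k) w"
| trace_Star_loop: "trace (p # Star p # k) w \<Longrightarrow> trace (Star p # k) w"

primrec sem_ops :: "op list \<Rightarrow> (store \<times> store) set" where
  "sem_ops [] = Id"
| "sem_ops (a # w) = op_rel a O sem_ops w"

primrec sem_list :: "prog list \<Rightarrow> (store \<times> store) set" where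
  "sem_list [] = Id"
| "sem_list (p # k) = sem p O sem_list k"

lemma sem_ops_append: "sem_ops (v @ w) = sem_ops v O sem_ops w"
  by (induction v) (auto simp: O_assoc)

lemma trace_sound: "trace k w \<Longrightarrow> sem_ops w \<subseteq> sem_list k"
proof (induction rule: trace.induct)
  case (trace_Star_loop p k w)
  have "sem p O (sem p)\<^sup>* O sem_list k \<subseteq> (sem p)\<^sup>* O sem_list k"
    by (auto intro: converse_rtrancl_into_rtrancl)
  then show ?case using trace_Star_loop.IH by simp
qed (auto simp: O_assoc)

text \<open>A run of \<open>p\<close> contributes only a prefix of a trace of \<open>p # k\<close>;
  the trace \<open>w\<close> of the continuation is carried along so that the cases of
  \<open>Seq\<close> and \<open>Star\<close> can be glued together.\<close>

lemma trace_complete: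
  "(s, t) \<in> sem p \<Longrightarrow> trace k w \<Longrightarrow> \<exists>v. trace (p # k) (v @ w) \<and> (s, t) \<in> sem_ops v"
proof (induction p arbitrary: s t k w)
  case (Op a)
  then show ?case by (intro exI[of _ "[a]"]) (auto intro: trace.intros)
next
  case (Seq p q)
  then obtain u where u: "(s, u) \<in> sem p" "(u, t) \<in> sem q" by auto
  obtain v2 where v2: "trace (q # k) (v2 @ w)" "(u, t) \<in> sem_ops v2"
    using Seq.IH(2)[OF u(2) Seq.prems(2)] by blast
  obtain v1 where "trace (p # q # k) (v1 @ v2 @ w)" "(s, u) \<in> sem_ops v1"
    using Seq.IH(1)[OF u(1) v2(1)] by blast
  then show ?case using v2(2)
    by (intro exI[of _ "v1 @ v2"]) (auto intro: trace_Seq simp: sem_ops_append)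
next
  case (Star p)
  from Star.prems(1) have "(s, t) \<in> (sem p)\<^sup>*" by simp
  then show ?case
  proof (induction rule: converse_rtrancl_induct)
    case base
    show ?case using Star.prems(2) by (intro exI[of _ "[]"]) (auto intro: trace_Star_exit)
  next
    case (step s u)
    then obtain v2 where v2: "trace (Star p # k) (v2 @ w)" "(u, t) \<in> sem_ops v2" by blast
    obtain v1 where "trace (p # Star p # k) (v1 @ v2 @ w)" "(s, u) \<in> sem_ops v1"
      using Star.IH[OF step.hyps(1) v2(1)] by blast
    then show ?case using v2(2)
      by (intro exI[of _ "v1 @ v2"]) (auto intro: trace_Star_loop simp: sem_ops_append)
  qed
qed

lemma sem_iff_trace: "(s, t) \<in> sem p \<longleftrightarrow> (\<exists>w. trace [p] w \<and> (s, t) \<in> sem_ops w)"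
proof
  assume "(s, t) \<in> sem p"
  from trace_complete[OF this trace_Nil] show "\<exists>w. trace [p] w \<and> (s, t) \<in> sem_ops w" by simp
next
  assume "\<exists>w. trace [p] w \<and> (s, t) \<in> sem_ops w"
  then obtain w where "trace [p] w" "(s, t) \<in> sem_ops w" by blast
  then show "(s, t) \<in> sem p" using trace_sound[of "[p]" w] by auto
qed

text \<open>A variant of the partial derivatives of a regular expression. The set is finite in spite
  of unbounded unfolding, because the body of a loop is always followed by the same
  \<open>Star p # k\<close>. The stack alphabet of the qBPA can thus be finite.\<close>

primrec continuations :: "prog \<Rightarrow> prog list \<Rightarrow> prog list set" where
  "continuations (Op a) k = {Op a # k}"
| "continuations (Seq p q) k = {Seq p q # k} \<union> continuations p (q # k) \<union> continuations q k"
| "continuations (Star p) k = {Star p # k} \<union> continuations p (Star p # k)"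

lemma finite_continuations: "finite (continuations p k)"
  by (induction p arbitrary: k) auto

lemma self_continuation: "p # k \<in> continuations p k"
  by (cases p) auto

lemma continuations_closed:
  "l \<in> continuations p k \<Longrightarrow> next_prog l \<subseteq> insert k (continuations p k)"
proof (induction p arbitrary: k)
  case (Seq p q)
  then show ?case using self_continuation[of p "q # k"] self_continuation[of q k] by fastforce
next
  case (Star p)
  then show ?case using self_continuation[of p "Star p # k"] by fastforce
qed auto

text \<open>
  Two digits \<open>d\<close> make each operation a pair of contractions of the unit interval. Their
  inverses multiply the denominator by 4 and 1/2: a number with odd numerator
  over \<open>2^(k+1)\<close> represents the counter value \<open>k\<close>.
\<close>

primrec value_step :: "nat \<Rightarrow> op \<Rightarrow> bool \<Rightarrow> real \<Rightarrow> real" where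
  "value_step r (Add2 q) d x = (if q = r then (4 * x + of_bool d) / 5 else x)"
| "value_step r (Dec q) d x = (if q = r then (x + of_bool d) / 2 else x)"
| "value_step r (Test q) d x = x"

primrec stack_value :: "nat \<Rightarrow> (op \<times> bool) list \<Rightarrow> real" where
  "stack_value r [] = 1 / 2"
| "stack_value r (l # w) = value_step r (fst l) (snd l) (stack_value r w)"

primrec tests_ok :: "(op \<times> bool) list \<Rightarrow> bool" where
  "tests_ok [] \<longleftrightarrow> True"
| "tests_ok (l # w) \<longleftrightarrow> (\<forall>r. fst l = Test r \<longrightarrow> stack_value r w = 1 / 2) \<and> tests_ok w"

section \<open>Dyadic denominators as counter values\<close>

definition represents :: "real \<Rightarrow> nat \<Rightarrow> bool" where
  "represents x k \<longleftrightarrow> (\<exists>N::int. odd N \<and> x = of_int N / 2 ^ Suc k)"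

lemma stack_value_bounds: "0 < stack_value r w \<and> stack_value r w < 1"
proof (induction w)
  case (Cons l w)
  then show ?case by (cases "fst l") (auto simp: of_bool_def)
qed simp

lemma represents_half: "represents (1 / 2) k \<longleftrightarrow> k = 0"
proof
  assume "represents (1 / 2) k"
  then obtain N where N: "odd N" "(1 / 2 :: real) = of_int N / 2 ^ Suc k"
    unfolding represents_def by blast
  then have "real_of_int N = of_int (2 ^ k)" by (simp add: field_simps)
  then have "N = 2 ^ k" using of_int_eq_iff by blast
  then show "k = 0" using N by (cases k) auto
qed (auto simp: represents_def intro!: exI[of _ 1])

lemma represents_0:
  assumes "represents x 0" "0 < x" "x < 1" shows "x = 1 / 2"
proof -
  from assms(1) obtain N :: int where N: "odd N" "x = of_int N / 2" unfolding represents_def by auto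
  then have "N > 0" "N < 2" using assms by auto
  then have "N = 1" by simp
  then show ?thesis using N by simp
qed

text \<open>The value above a letter belongs to the store before the operation, the value below it
  to the store after. The new numerator is \<open>5 * N\<close> minus an even number, hence odd for
  either digit.\<close>

lemma represents_Add2:
  assumes "represents ((4 * x + of_bool d) / 5) k" shows "represents x (k + 2)"
proof -
  from assms obtain N :: int where N: "odd N" "(4 * x + of_bool d) / 5 = of_int N / 2 ^ Suc k"
    unfolding represents_def by blast
  then have "x = of_int (5 * N - of_bool d * 2 ^ Suc k) / 2 ^ Suc (k + 2)" by (simp add: field_simps)
  moreover have "odd (5 * N - of_bool d * 2 ^ Suc k)" using N(1) by simp
  ultimately show ?thesis unfolding represents_def by blast
qed

text \<open>If \<open>k\<close> were 0, then \<open>x\<close> would be the integer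
  \<open>N - d\<close>, which the bounds exclude. This is how a decrement at zero is detected
  without a test.\<close>

lemma represents_Dec:
  assumes "represents ((x + of_bool d) / 2) k" "0 < x" "x < 1"
  shows "k > 0 \<and> represents x (k - 1)"
proof -
  from assms(1) obtain N :: int where N: "odd N" "(x + of_bool d) / 2 = of_int N / 2 ^ Suc k"
    unfolding represents_def by blast
  have x: "x = of_int (N - of_bool d * 2 ^ k) / 2 ^ k" using N(2) by (simp add: field_simps)
  have k: "k > 0"
  proof (rule ccontr)
    assume "\<not> k > 0"
    then have "x = of_int (N - of_bool d)" using x by simp
    then have "0 < N - of_bool d" "N - of_bool d < 1" using assms(2,3) by linarith+
    then show False by linarith
  qed
  have "odd (N - of_bool d * 2 ^ k)" using N(1) k by simp
  moreover have "2 ^ Suc (k - 1) = (2 ^ k :: real)" using k by (metis Suc_pred')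
  ultimately show ?thesis using x k unfolding represents_def by (metis (no_types, lifting))
qed

lemma represents_Add2_inverse:
  assumes "represents x k" shows "represents ((5 * x - of_bool d) / 4) (k + 2)"
proof -
  from assms obtain N :: int where N: "odd N" "x = of_int N / 2 ^ Suc k"
    unfolding represents_def by blast
  then have "(5 * x - of_bool d) / 4 = of_int (5 * N - of_bool d * 2 ^ Suc k) / 2 ^ Suc (k + 2)"
    by (simp add: field_simps)
  moreover have "odd (5 * N - of_bool d * 2 ^ Suc k)" using N(1) by simp
  ultimately show ?thesis unfolding represents_def by blast
qed

lemma represents_Dec_inverse:
  assumes "represents x (Suc k)" shows "represents (2 * x - of_bool d) k"
proof -
  from assms obtain N :: int where N: "odd N" "x = of_int N / 2 ^ Suc (Suc k)"
    unfolding represents_def by blast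
  then have "2 * x - of_bool d = of_int (N - of_bool d * 2 ^ Suc k) / 2 ^ Suc k"
    by (simp add: field_simps)
  moreover have "odd (N - of_bool d * 2 ^ Suc k)" using N(1) by simp
  ultimately show ?thesis unfolding represents_def by blast
qed

text \<open>At the end of the word all values are 1/2, and 1/2 represents 0 only; this forces the
  final store to be zero.\<close>

lemma values_sound:
  assumes "\<And>r. represents (stack_value r w) (s r)" "tests_ok w"
  shows "(s, \<lambda>_. 0) \<in> sem_ops (map fst w)"
  using assms
proof (induction w arbitrary: s)
  case Nil
  then have "s = (\<lambda>_. 0)" by (simp add: represents_half fun_eq_iff)
  then show ?case by simp
next
  case (Cons l w)
  obtain a d where l: "l = (a, d)" by (cases l)
  have ok: "tests_ok w" using Cons.prems by simp
  show ?case
  proof (cases a)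
    case (Add2 q)
    have "represents (stack_value r w) ((s(q := s q + 2)) r)" for r
      using Cons.prems(1)[of r] represents_Add2[of "stack_value q w" d "s q"] l Add2 by auto
    then show ?thesis using Cons.IH ok l Add2 by auto
  next
    case (Dec q)
    have "represents ((stack_value q w + of_bool d) / 2) (s q)" using Cons.prems(1)[of q] l Dec by simp
    then have q: "s q > 0" "represents (stack_value q w) (s q - 1)"
      using represents_Dec stack_value_bounds by blast+
    have "represents (stack_value r w) ((s(q := s q - 1)) r)" for r
      using Cons.prems(1)[of r] q l Dec by auto
    then show ?thesis using Cons.IH ok q l Dec by auto
  next
    case (Test q)
    have "stack_value q w = 1 / 2" using Cons.prems(2) l Test by simp
    moreover have "represents (stack_value q w) (s q)" using Cons.prems(1)[of q] l Test by simp
    ultimately have "s q = 0" using represents_half by metis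
    moreover have "represents (stack_value r w) (s r)" for r using Cons.prems(1)[of r] l Test by simp
    ultimately show ?thesis using Cons.IH ok l Test by auto
  qed
qed

lemma values_complete:
  assumes "(s, \<lambda>_. 0) \<in> sem_ops v" "\<And>r. represents (x r) (s r) \<and> 0 < x r \<and> x r < 1"
  shows "\<exists>w. map fst w = v \<and> (\<forall>r. stack_value r w = x r) \<and> tests_ok w"
  using assms
proof (induction v arbitrary: s x)
  case Nil
  then have s: "s = (\<lambda>_. 0)" by simp
  have "x r = 1 / 2" for r using Nil.prems(2)[of r] unfolding s by (intro represents_0) simp_all
  then show ?case by simp
next
  case (Cons a v)
  then obtain u where u: "(s, u) \<in> op_rel a" "(u, \<lambda>_. 0) \<in> sem_ops v" by auto
  have xs: "represents (x r) (s r)" "0 < x r" "x r < 1" for r using Cons.prems(2) by auto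
  show ?case
  proof (cases a)
    case (Add2 q)
    \<comment> \<open>The number \<open>(5x - d)/4\<close> lies in the open unit interval for
      \<open>d = 0\<close> iff \<open>x < 4/5\<close>, and for \<open>d = 1\<close> iff
      \<open>x > 1/5\<close>. The ranges overlap, and 4/5 is one of the possible thresholds.\<close>
    define d where "d \<longleftrightarrow> x q \<ge> 4 / 5"
    let ?x = "x(q := (5 * x q - of_bool d) / 4)"
    have us: "u = s(q := s q + 2)" using u(1) Add2 by simp
    have "0 < ?x q \<and> ?x q < 1" using xs[of q] by (auto simp: d_def)
    moreover have "represents (?x q) (u q)"
      using represents_Add2_inverse[OF xs(1)] us by simp
    ultimately have "represents (?x r) (u r) \<and> 0 < ?x r \<and> ?x r < 1" for r
      using xs[of r] us by (cases "r = q") auto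
    from Cons.IH[OF u(2) this] obtain w
      where w: "map fst w = v" "\<forall>r. stack_value r w = ?x r" "tests_ok w" by blast
    have "stack_value r ((a, d) # w) = x r" for r
      using w(2) Add2 by (cases "r = q") (simp_all add: field_simps)
    then show ?thesis using w(1,3) Add2 by (intro exI[of _ "(a, d) # w"]) simp
  next
    case (Dec q)
    \<comment> \<open>Here the ranges for the two digits meet at 1/2 without containing it; but 1/2
      would mean that the counter is zero, where the operation is not applicable.\<close>
    define d where "d \<longleftrightarrow> x q > 1 / 2"
    let ?x = "x(q := 2 * x q - of_bool d)"
    have pos: "s q > 0" and us: "u = s(q := s q - 1)" using u(1) Dec by auto
    have "x q \<noteq> 1 / 2" using xs(1)[of q] represents_half[of "s q"] pos by force
    then have "0 < ?x q \<and> ?x q < 1" using xs[of q] by (auto simp: d_def)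
    moreover have "represents (?x q) (u q)"
      using represents_Dec_inverse[of "x q" "s q - 1" d] xs(1)[of q] pos us by simp
    ultimately have "represents (?x r) (u r) \<and> 0 < ?x r \<and> ?x r < 1" for r
      using xs[of r] us by (cases "r = q") auto
    from Cons.IH[OF u(2) this] obtain w
      where w: "map fst w = v" "\<forall>r. stack_value r w = ?x r" "tests_ok w" by blast
    have "stack_value r ((a, d) # w) = x r" for r
      using w(2) Dec by (cases "r = q") (simp_all add: field_simps)
    then show ?thesis using w(1,3) Dec by (intro exI[of _ "(a, d) # w"]) simp
  next
    case (Test q)
    then have "s q = 0" and us: "u = s" using u(1) by auto
    then have q: "x q = 1 / 2" using xs[of q] by (intro represents_0) simp_all
    have "represents (x r) (u r) \<and> 0 < x r \<and> x r < 1" for r using xs us by simp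
    from Cons.IH[OF u(2) this] obtain w
      where w: "map fst w = v" "\<forall>r. stack_value r w = x r" "tests_ok w" by blast
    then show ?thesis using Test q by (intro exI[of _ "(a, False) # w"]) simp
  qed
qed

lemma represents_power: "represents (1 / 2 ^ Suc k) k"
  unfolding represents_def by (intro exI[of _ 1]) simp

text \<open>Among the representatives of a counter value the one with numerator 1 is taken, so that
  a formula can fix the initial store by the rational constants
  \<open>1 / 2 ^ Suc (s r)\<close>.\<close>

theorem sem_iff_values:
  "(s, \<lambda>_. 0) \<in> sem p \<longleftrightarrow>
     (\<exists>w. trace [p] (map fst w) \<and> tests_ok w \<and> (\<forall>r. stack_value r w = 1 / 2 ^ Suc (s r)))"
proof -
  have "(s, \<lambda>_. 0) \<in> sem_ops v \<longleftrightarrow>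
      (\<exists>w. map fst w = v \<and> tests_ok w \<and> (\<forall>r. stack_value r w = 1 / 2 ^ Suc (s r)))" for v
  proof
    assume v: "(s, \<lambda>_. 0) \<in> sem_ops v"
    have "represents (1 / 2 ^ Suc k) k \<and> 0 < (1 :: real) / 2 ^ Suc k \<and> (1 :: real) / 2 ^ Suc k < 1" for k
      using represents_power one_less_power[of "2 :: real" "Suc k"] by (simp del: power_Suc)
    from values_complete[OF v this]
    show "\<exists>w. map fst w = v \<and> tests_ok w \<and> (\<forall>r. stack_value r w = 1 / 2 ^ Suc (s r))" by blast
  next
    assume "\<exists>w. map fst w = v \<and> tests_ok w \<and> (\<forall>r. stack_value r w = 1 / 2 ^ Suc (s r))"
    then obtain w where w: "map fst w = v" "tests_ok w" "\<And>r. stack_value r w = 1 / 2 ^ Suc (s r)"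
      by blast
    have "represents (stack_value r w) (s r)" for r unfolding w(3) by (rule represents_power)
    from values_sound[OF this w(2)] show "(s, \<lambda>_. 0) \<in> sem_ops v" unfolding w(1) .
  qed
  then show ?thesis unfolding sem_iff_trace by (simp only: ex_simps simp_thms) blast
qed

section \<open>Runs of a stateless pushdown system\<close>

locale qbpa_runs =
  fixes \<Delta> :: "'g qbpa"
  assumes qbpa: "is_qbpa \<Delta>"
begin

abbreviation M :: "'g list qmc" where "M \<equiv> qmc_of \<Delta>"

definition weight :: "'g \<Rightarrow> 'g list \<Rightarrow> real" where
  "weight X \<alpha> = (cmod (rule_amplitude \<Delta> (X, \<alpha>)))\<^sup>2"

definition rule_pmf :: "'g \<Rightarrow> 'g list pmf" where
  "rule_pmf X = embed_pmf (\<lambda>\<alpha>. if (X, \<alpha>) \<in> rules \<Delta> then weight X \<alpha> else 0)"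

lemma finite_alphabet: "finite (alphabet \<Delta>)"
  using qbpa unfolding is_qbpa_def by blast

lemma finite_rules_from: "finite {\<alpha>. (X, \<alpha>) \<in> rules \<Delta>}"
proof -
  have "finite (snd ` rules \<Delta>)" using qbpa unfolding is_qbpa_def by blast
  moreover have "{\<alpha>. (X, \<alpha>) \<in> rules \<Delta>} \<subseteq> snd ` rules \<Delta>" by force
  ultimately show ?thesis by (rule finite_subset[rotated])
qed

lemma rule_in_lists: "(X, \<alpha>) \<in> rules \<Delta> \<Longrightarrow> \<alpha> \<in> lists (alphabet \<Delta>)"
  using qbpa unfolding is_qbpa_def by fast

lemma pmf_rule_pmf:
  assumes "X \<in> alphabet \<Delta>"
  shows "pmf (rule_pmf X) \<alpha> = (if (X, \<alpha>) \<in> rules \<Delta> then weight X \<alpha> else 0)"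
  unfolding rule_pmf_def
proof (rule pmf_embed_pmf)
  let ?f = "\<lambda>\<alpha>. if (X, \<alpha>) \<in> rules \<Delta> then weight X \<alpha> else 0"
  let ?A = "{\<alpha>. (X, \<alpha>) \<in> rules \<Delta>}"
  show "0 \<le> ?f \<alpha>" for \<alpha> by (simp add: weight_def)
  have "(\<integral>\<^sup>+\<alpha>. ennreal (?f \<alpha>) \<partial>count_space UNIV) = (\<Sum>\<alpha>\<in>?A. ennreal (?f \<alpha>))"
    by (rule nn_integral_count_space') (use finite_rules_from in auto)
  also have "\<dots> = (\<Sum>\<alpha>\<in>?A. ennreal (weight X \<alpha>))" by (intro sum.cong) auto
  also have "\<dots> = ennreal (\<Sum>\<alpha>\<in>?A. weight X \<alpha>)" by (rule sum_ennreal) (simp add: weight_def)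
  also have "(\<Sum>\<alpha>\<in>?A. weight X \<alpha>) = 1" using qbpa assms unfolding is_qbpa_def weight_def by simp
  finally show "(\<integral>\<^sup>+\<alpha>. ennreal (?f \<alpha>) \<partial>count_space UNIV) = 1" by simp
qed

lemma set_rule_pmf:
  "X \<in> alphabet \<Delta> \<Longrightarrow> \<alpha> \<in> set_pmf (rule_pmf X) \<Longrightarrow> (X, \<alpha>) \<in> rules \<Delta>"
  using pmf_rule_pmf by (metis set_pmf_iff)

text \<open>
  The runs are driven by independent choice functions, one per step, each of which picks a
  rule for every stack symbol.
\<close>

definition choice :: "('g \<Rightarrow> 'g list) pmf" where
  "choice = Pi_pmf (alphabet \<Delta>) [] rule_pmf"

text \<open>Off the support of \<open>choice\<close> the word \<open>x X\<close> need not be the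
  right side of a rule. Replacing it by some rule makes \<open>run_of s u\<close> a run for every
  \<open>u\<close>, not just almost surely, so that it maps into \<open>runs M s\<close>.\<close>

definition chosen :: "'g \<Rightarrow> ('g \<Rightarrow> 'g list) \<Rightarrow> 'g list" where
  "chosen X x = (if (X, x X) \<in> rules \<Delta> then x X else (SOME \<alpha>. (X, \<alpha>) \<in> rules \<Delta>))"

primrec advance :: "'g list \<Rightarrow> ('g \<Rightarrow> 'g list) \<Rightarrow> 'g list" where
  "advance [] x = []"
| "advance (X # \<beta>) x = chosen X x @ \<beta>"

primrec run_of :: "'g list \<Rightarrow> (nat \<Rightarrow> 'g \<Rightarrow> 'g list) \<Rightarrow> nat \<Rightarrow> 'g list" where
  "run_of s u 0 = s"
| "run_of s u (Suc n) = advance (run_of s u n) (u n)"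

abbreviation choices :: "(nat \<Rightarrow> 'g \<Rightarrow> 'g list) measure" where
  "choices \<equiv> \<Pi>\<^sub>M i\<in>UNIV. measure_pmf choice"

lemma choices_sequence_space: "sequence_space (measure_pmf choice)"
  by unfold_locales

lemma space_choices: "space choices = UNIV"
  by (simp add: space_PiM)

lemma map_choice: "X \<in> alphabet \<Delta> \<Longrightarrow> map_pmf (\<lambda>x. x X) choice = rule_pmf X"
  by (simp add: choice_def Pi_pmf_component finite_alphabet)

lemma chosen_rule: "X \<in> alphabet \<Delta> \<Longrightarrow> (X, chosen X x) \<in> rules \<Delta>"
proof -
  assume "X \<in> alphabet \<Delta>"
  then have "\<exists>\<alpha>. (X, \<alpha>) \<in> rules \<Delta>" using qbpa unfolding is_qbpa_def by blast
  then show ?thesis unfolding chosen_def by (auto intro: someI_ex)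
qed

lemma chosen_eq:
  assumes "X \<in> alphabet \<Delta>" "x \<in> set_pmf choice"
  shows "chosen X x = x X"
proof -
  have "x X \<in> set_pmf (map_pmf (\<lambda>x. x X) choice)" using assms(2) by auto
  then show ?thesis using assms(1) set_rule_pmf unfolding chosen_def map_choice[OF assms(1)] by simp
qed

lemma nn_integral_chosen:
  assumes "X \<in> alphabet \<Delta>"
  shows "(\<integral>\<^sup>+x. h (chosen X x) \<partial>measure_pmf choice) =
    (\<Sum>\<alpha> | (X, \<alpha>) \<in> rules \<Delta>. h \<alpha> * ennreal (weight X \<alpha>))"
proof -
  have "(\<integral>\<^sup>+x. h (chosen X x) \<partial>measure_pmf choice) = (\<integral>\<^sup>+x. h (x X) \<partial>measure_pmf choice)"
    by (rule nn_integral_cong_AE) (auto simp: AE_measure_pmf_iff chosen_eq[OF assms])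
  also have "\<dots> = (\<integral>\<^sup>+\<alpha>. h \<alpha> \<partial>measure_pmf (rule_pmf X))"
    unfolding map_choice[OF assms, symmetric] nn_integral_map_pmf ..
  also have "\<dots> = (\<Sum>\<alpha>\<in>{\<alpha>. (X, \<alpha>) \<in> rules \<Delta>}. h \<alpha> * ennreal (pmf (rule_pmf X) \<alpha>))"
    by (rule nn_integral_measure_pmf_support) (use finite_rules_from set_rule_pmf[OF assms] in auto)
  also have "\<dots> = (\<Sum>\<alpha>\<in>{\<alpha>. (X, \<alpha>) \<in> rules \<Delta>}. h \<alpha> * ennreal (weight X \<alpha>))"
    by (intro sum.cong) (auto simp: pmf_rule_pmf[OF assms])
  finally show ?thesis .
qed

lemma advance_trans: "s \<in> lists (alphabet \<Delta>) \<Longrightarrow> (s, advance s x) \<in> trans M"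
  using chosen_rule by (cases s) (auto simp: qmc_of_def)

lemma trans_lists: "(s, t) \<in> trans M \<Longrightarrow> s \<in> lists (alphabet \<Delta>) \<and> t \<in> lists (alphabet \<Delta>)"
  using is_qmc_qmc_of[OF qbpa] by (auto simp: is_qmc_def qmc_of_def)

lemma run_of_lists: "s \<in> lists (alphabet \<Delta>) \<Longrightarrow> run_of s u n \<in> lists (alphabet \<Delta>)"
proof (induction n)
  case (Suc n)
  then show ?case using trans_lists[OF advance_trans[of "run_of s u n" "u n"]] by simp
qed simp

lemma run_of_runs: "s \<in> lists (alphabet \<Delta>) \<Longrightarrow> run_of s u \<in> runs M s"
  using run_of_lists advance_trans by (auto simp: runs_def)

lemma run_of_shift: "run_of s (case_nat x u) (Suc n) = run_of (advance s x) u n"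
  by (induction n) auto

lemma emeasure_advance:
  assumes "(s, t) \<in> trans M"
  shows "emeasure (measure_pmf choice) {x. advance s x = t} = ennreal ((cmod (amplitude M (s, t)))\<^sup>2)"
proof (cases s)
  case Nil
  then have "t = []" using assms by (auto simp: qmc_of_def)
  then show ?thesis using Nil measure_pmf.emeasure_space_1[of choice] by (simp add: qmc_of_def)
next
  case (Cons X \<beta>)
  then obtain \<alpha> where \<alpha>: "(X, \<alpha>) \<in> rules \<Delta>" "t = \<alpha> @ \<beta>" using assms by (auto simp: qmc_of_def)
  have X: "X \<in> alphabet \<Delta>" using trans_lists[OF assms] Cons by simp
  have "emeasure (measure_pmf choice) {x. advance s x = t} =
      (\<integral>\<^sup>+x. indicator {x. advance s x = t} x \<partial>measure_pmf choice)"
    by (rule nn_integral_indicator[symmetric]) simp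
  also have "\<dots> = (\<integral>\<^sup>+x. indicator {\<alpha>} (chosen X x) \<partial>measure_pmf choice)"
    by (intro nn_integral_cong) (simp add: Cons \<alpha> indicator_def)
  also have "\<dots> = (\<Sum>\<alpha>' | (X, \<alpha>') \<in> rules \<Delta>. indicator {\<alpha>} \<alpha>' * ennreal (weight X \<alpha>'))"
    by (rule nn_integral_chosen[OF X])
  also have "\<dots> = (\<Sum>\<alpha>'\<in>{\<alpha>}. indicator {\<alpha>} \<alpha>' * ennreal (weight X \<alpha>'))"
    by (rule sum.mono_neutral_right) (use finite_rules_from \<alpha> in auto)
  also have "\<dots> = ennreal ((cmod (amplitude M (s, t)))\<^sup>2)"
    using Cons \<alpha> by (simp add: weight_def qmc_of_def)
  finally show ?thesis .
qed

text \<open>The prescribed path fixes the state before each step. A condition on the dependent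
  states of the run thus becomes a separate condition on each of the independent choices, whose
  probabilities multiply.\<close>

lemma run_of_prefix_iff:
  assumes "w \<in> finite_paths M s"
  shows "(\<forall>i<length w. run_of s u i = w ! i) \<longleftrightarrow>
    (\<forall>i\<in>{..<length w - 1}. u i \<in> {x. advance (w ! i) x = w ! Suc i})"
proof
  assume *: "\<forall>i<length w. run_of s u i = w ! i"
  show "\<forall>i\<in>{..<length w - 1}. u i \<in> {x. advance (w ! i) x = w ! Suc i}"
  proof
    fix i assume "i \<in> {..<length w - 1}"
    then have "i < length w" "Suc i < length w" by auto
    then have "run_of s u i = w ! i" "run_of s u (Suc i) = w ! Suc i" using * by blast+
    then show "u i \<in> {x. advance (w ! i) x = w ! Suc i}" by simp
  qed
next
  assume *: "\<forall>i\<in>{..<length w - 1}. u i \<in> {x. advance (w ! i) x = w ! Suc i}"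
  have "i < length w \<Longrightarrow> run_of s u i = w ! i" for i
  proof (induction i)
    case 0
    then show ?case using assms by (auto simp: finite_paths_def hd_conv_nth)
  next
    case (Suc i)
    then have "i \<in> {..<length w - 1}" "i < length w" by auto
    then have "advance (w ! i) (u i) = w ! Suc i" "run_of s u i = w ! i" using * Suc.IH by blast+
    then show ?case by simp
  qed
  then show "\<forall>i<length w. run_of s u i = w ! i" by blast
qed

abbreviation prefix_event :: "'g list \<Rightarrow> 'g list list \<Rightarrow> (nat \<Rightarrow> 'g \<Rightarrow> 'g list) set" where
  "prefix_event s w \<equiv> {u \<in> space choices. \<forall>i<length w. run_of s u i = w ! i}"

lemma prefix_event:
  assumes "w \<in> finite_paths M s"
  shows "prefix_event s w \<in> sets choices" "emeasure choices (prefix_event s w) = ennreal (path_prob M w)"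
proof -
  interpret sequence_space "measure_pmf choice" by (rule choices_sequence_space)
  let ?X = "\<lambda>i. {x. advance (w ! i) x = w ! Suc i}"
  have eq: "prefix_event s w = {u \<in> space choices. \<forall>i\<in>{..<length w - 1}. u i \<in> ?X i}"
    by (simp only: run_of_prefix_iff[OF assms])
  have "{u \<in> space choices. u i \<in> ?X i} \<in> sets choices" for i
  proof -
    have "(\<lambda>u. u i) -` ?X i \<inter> space choices \<in> sets choices"
      by (rule measurable_sets[OF measurable_component_singleton]) simp_all
    moreover have "(\<lambda>u. u i) -` ?X i \<inter> space choices = {u \<in> space choices. u i \<in> ?X i}" by auto
    ultimately show ?thesis by simp
  qed
  then show "prefix_event s w \<in> sets choices"
    unfolding eq by (intro sets.sets_Collect_finite_All) simp_all
  have "emeasure choices (prefix_event s w) = (\<Prod>i\<in>{..<length w - 1}. emeasure (measure_pmf choice) (?X i))"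
    unfolding eq by (rule emeasure_PiM_Collect) auto
  also have "\<dots> = (\<Prod>i\<in>{..<length w - 1}. ennreal ((cmod (amplitude M (w ! i, w ! Suc i)))\<^sup>2))"
    using assms by (intro prod.cong refl emeasure_advance) (auto simp: finite_paths_def)
  also have "\<dots> = ennreal (path_prob M w)"
    by (simp add: prod_ennreal path_prob_def prod_norm[symmetric] prod_power_distrib)
  finally show "emeasure choices (prefix_event s w) = ennreal (path_prob M w)" .
qed

section \<open>The measure on runs as the law of a random run\<close>

abbreviation cylinders :: "'g list \<Rightarrow> (nat \<Rightarrow> 'g list) set set" where
  "cylinders s \<equiv> cylinder M s ` finite_paths M s"

lemma cylinders_Pow: "cylinders s \<subseteq> Pow (runs M s)"
  by (auto simp: cylinder_def)

definition run_distribution :: "'g list \<Rightarrow> (nat \<Rightarrow> 'g list) measure" where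
  "run_distribution s = distr choices (sigma (runs M s) (cylinders s)) (run_of s)"

lemma vimage_cylinder:
  assumes "s \<in> lists (alphabet \<Delta>)"
  shows "run_of s -` cylinder M s w \<inter> space choices = prefix_event s w"
proof -
  have "run_of s u \<in> cylinder M s w \<longleftrightarrow> (\<forall>i<length w. run_of s u i = w ! i)" for u
    using run_of_runs[OF assms, of u] unfolding cylinder_def by simp
  then show ?thesis unfolding vimage_def by (simp only: mem_Collect_eq space_choices) simp
qed

lemma run_of_measurable:
  assumes "s \<in> lists (alphabet \<Delta>)"
  shows "run_of s \<in> measurable choices (sigma (runs M s) (cylinders s))"
proof (rule measurable_measure_of[OF cylinders_Pow])
  show "run_of s \<in> space choices \<rightarrow> runs M s" using run_of_runs[OF assms] by blast
  fix A assume "A \<in> cylinders s"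
  then obtain w where w: "w \<in> finite_paths M s" "A = cylinder M s w" by blast
  show "run_of s -` A \<inter> space choices \<in> sets choices"
    unfolding w(2) vimage_cylinder[OF assms] by (rule prefix_event(1)[OF w(1)])
qed

lemma emeasure_run_distribution_cylinder:
  assumes "s \<in> lists (alphabet \<Delta>)" "w \<in> finite_paths M s"
  shows "emeasure (run_distribution s) (cylinder M s w) = ennreal (path_prob M w)"
proof -
  have "cylinder M s w \<in> sets (sigma (runs M s) (cylinders s))"
    unfolding sets_measure_of[OF cylinders_Pow] using assms(2) by (intro sigma_sets.Basic imageI)
  then have "emeasure (run_distribution s) (cylinder M s w) =
      emeasure choices (run_of s -` cylinder M s w \<inter> space choices)"
    unfolding run_distribution_def by (rule emeasure_distr[OF run_of_measurable[OF assms(1)]])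
  also have "\<dots> = ennreal (path_prob M w)"
    unfolding vimage_cylinder[OF assms(1)] by (rule prefix_event(2)[OF assms(2)])
  finally show ?thesis .
qed

lemma sets_run_measure: "sets (run_measure M s) = sigma_sets (runs M s) (cylinders s)"
  unfolding run_measure_def by (rule sets_extend_measure[OF cylinders_Pow])

text \<open>\<open>extend_measure\<close> has the prescribed values only if some measure extends
  them; \<open>run_distribution s\<close> is the witness.\<close>

lemma emeasure_run_measure_cylinder:
  assumes "s \<in> lists (alphabet \<Delta>)" "w \<in> finite_paths M s"
  shows "emeasure (run_measure M s) (cylinder M s w) = ennreal (path_prob M w)"
proof (rule emeasure_extend_measure[OF run_measure_def _ cylinders_Pow])
  show "emeasure (run_distribution s) (cylinder M s w) = ennreal (path_prob M w)"
    if "w \<in> finite_paths M s" for w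
    by (rule emeasure_run_distribution_cylinder[OF assms(1) that])
  have sets: "sets (run_measure M s) = sets (run_distribution s)"
    unfolding sets_run_measure by (simp add: run_distribution_def sets_measure_of cylinders_Pow)
  show "positive (sets (run_measure M s)) (emeasure (run_distribution s))"
    unfolding sets by (rule emeasure_positive)
  show "countably_additive (sets (run_measure M s)) (emeasure (run_distribution s))"
    unfolding sets by (rule emeasure_countably_additive)
qed (rule assms(2))

lemma cylinder_Int:
  assumes "w \<in> finite_paths M s" "w' \<in> finite_paths M s" "length w \<le> length w'"
  shows "cylinder M s w \<inter> cylinder M s w' \<in> insert {} (cylinders s)"
proof (cases "\<forall>i<length w. w ! i = w' ! i")
  case True
  have "\<omega> \<in> cylinder M s w" if "\<omega> \<in> cylinder M s w'" for \<omega>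
    unfolding cylinder_def
  proof (intro CollectI conjI allI impI)
    show "\<omega> \<in> runs M s" using that by (simp add: cylinder_def)
    fix i assume i: "i < length w"
    then have "i < length w'" using assms(3) by simp
    then have "\<omega> i = w' ! i" using that by (simp add: cylinder_def)
    then show "\<omega> i = w ! i" using True i by simp
  qed
  then have "cylinder M s w \<inter> cylinder M s w' = cylinder M s w'" by blast
  then show ?thesis using assms(2) by simp
next
  case False
  then obtain i where i: "i < length w" "w ! i \<noteq> w' ! i" by blast
  have "\<omega> \<notin> cylinder M s w'" if "\<omega> \<in> cylinder M s w" for \<omega>
  proof
    assume "\<omega> \<in> cylinder M s w'"
    then have "\<omega> i = w' ! i" using i(1) assms(3) by (simp add: cylinder_def)
    moreover have "\<omega> i = w ! i" using that i(1) by (simp add: cylinder_def)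
    ultimately show False using i(2) by simp
  qed
  then have "cylinder M s w \<inter> cylinder M s w' = {}" by blast
  then show ?thesis by simp
qed

text \<open>Cylinders are nested or disjoint, so adding the empty set makes them stable under
  intersection, and measures that agree on such a generator agree.\<close>

lemma run_measure_eq:
  assumes "s \<in> lists (alphabet \<Delta>)"
  shows "run_measure M s = run_distribution s"
proof (rule measure_eqI_generator_eq)
  let ?E = "insert {} (cylinders s)"
  show "Int_stable ?E"
  proof (rule Int_stableI)
    fix A B assume AB: "A \<in> ?E" "B \<in> ?E"
    show "A \<inter> B \<in> ?E"
    proof (cases "A = {} \<or> B = {}")
      case False
      then obtain w w' where w: "w \<in> finite_paths M s" "A = cylinder M s w"
        "w' \<in> finite_paths M s" "B = cylinder M s w'" using AB by blast
      show ?thesis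
      proof (cases "length w \<le> length w'")
        case True
        from cylinder_Int[OF w(1,3) True] show ?thesis unfolding w(2,4) .
      next
        case False
        then have "length w' \<le> length w" by simp
        from cylinder_Int[OF w(3,1) this] show ?thesis unfolding w(2,4) by (simp only: Int_commute)
      qed
    qed auto
  qed
  show "?E \<subseteq> Pow (runs M s)" using cylinders_Pow by blast
  have sigma: "sigma_sets (runs M s) (cylinders s) = sigma_sets (runs M s) ?E"
    by (rule sigma_sets_eqI) (auto intro: sigma_sets.intros)
  show "sets (run_measure M s) = sigma_sets (runs M s) ?E"
    unfolding sets_run_measure sigma ..
  show "sets (run_distribution s) = sigma_sets (runs M s) ?E"
    unfolding sigma[symmetric] by (simp add: run_distribution_def sets_measure_of cylinders_Pow)
  show "emeasure (run_measure M s) A = emeasure (run_distribution s) A" if "A \<in> ?E" for A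
    using that emeasure_run_measure_cylinder[OF assms] emeasure_run_distribution_cylinder[OF assms]
    by auto
  \<comment> \<open>The path without steps yields the whole space, which therefore has finite
    measure.\<close>
  have whole: "cylinder M s [s] = runs M s" "[s] \<in> finite_paths M s"
    by (auto simp: cylinder_def runs_def finite_paths_def)
  then show "range (\<lambda>_. runs M s) \<subseteq> ?E" by auto
  show "emeasure (run_measure M s) (runs M s) \<noteq> \<infinity>"
    using emeasure_run_measure_cylinder[OF assms whole(2)] whole(1) by simp
qed auto

section \<open>Probabilities of until events\<close>

definition until_event :: "('g list \<Rightarrow> bool) \<Rightarrow> ('g list \<Rightarrow> bool) \<Rightarrow> (nat \<Rightarrow> 'g list) \<Rightarrow> bool" where
  "until_event P Q \<omega> \<longleftrightarrow> (\<exists>k. Q (\<omega> k) \<and> (\<forall>j<k. P (\<omega> j)))"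

text \<open>There are only countably many stacks, so any condition on the state at time
  \<open>j\<close> is a countable union of cylinders of length \<open>Suc j\<close>;
  \<open>P\<close> may be an arbitrary predicate.\<close>

lemma state_event_measurable:
  "{\<omega> \<in> runs M s. P (\<omega> j)} \<in> sigma_sets (runs M s) (cylinders s)"
proof -
  interpret sigma_algebra "runs M s" "sigma_sets (runs M s) (cylinders s)"
    using cylinders_Pow by (rule sigma_algebra_sigma_sets)
  let ?W = "{w \<in> finite_paths M s. length w = Suc j \<and> P (w ! j) \<and> set w \<subseteq> lists (alphabet \<Delta>)}"
  have "{\<omega> \<in> runs M s. P (\<omega> j)} = (\<Union>w\<in>?W. cylinder M s w)"
  proof (intro equalityI subsetI)
    fix \<omega> assume "\<omega> \<in> {\<omega> \<in> runs M s. P (\<omega> j)}"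
    then have \<omega>: "\<omega> \<in> runs M s" "P (\<omega> j)" by auto
    have tr: "(\<omega> i, \<omega> (Suc i)) \<in> trans M" for i using \<omega>(1) by (simp add: runs_def)
    let ?w = "map \<omega> [0..<Suc j]"
    have nth: "?w ! i = \<omega> i" if "i < Suc j" for i using that by (simp del: upt_Suc)
    have "hd ?w = s" using \<omega>(1) by (simp add: runs_def hd_map hd_upt del: upt_Suc)
    moreover have "(?w ! i, ?w ! Suc i) \<in> trans M" if "Suc i < length ?w" for i
      using that nth[of i] nth[of "Suc i"] tr by (simp del: upt_Suc)
    ultimately have "?w \<in> finite_paths M s" by (simp add: finite_paths_def del: upt_Suc)
    moreover have "set ?w \<subseteq> lists (alphabet \<Delta>)" using tr trans_lists by fastforce
    ultimately have "?w \<in> ?W" using nth[of j] \<omega>(2) by (simp del: upt_Suc)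
    moreover have "\<omega> \<in> cylinder M s ?w" using \<omega>(1) nth by (simp add: cylinder_def del: upt_Suc)
    ultimately show "\<omega> \<in> (\<Union>w\<in>?W. cylinder M s w)" by blast
  qed (auto simp: cylinder_def)
  moreover have "countable ?W"
  proof (rule countable_subset)
    show "?W \<subseteq> lists (lists (alphabet \<Delta>))" by auto
    show "countable (lists (lists (alphabet \<Delta>)))"
      using finite_alphabet by (simp add: countable_finite)
  qed
  ultimately show ?thesis by (simp, intro countable_UN') (auto intro: sigma_sets.Basic)
qed

lemma until_event_measurable:
  "{\<omega> \<in> runs M s. until_event P Q \<omega>} \<in> sigma_sets (runs M s) (cylinders s)"
proof -
  interpret sigma_algebra "runs M s" "sigma_sets (runs M s) (cylinders s)"
    using cylinders_Pow by (rule sigma_algebra_sigma_sets)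
  have all: "{\<omega> \<in> runs M s. \<forall>j\<in>{..<k}. P (\<omega> j)} \<in> sigma_sets (runs M s) (cylinders s)" for k
    by (rule sets_Collect_finite_All[OF state_event_measurable finite_lessThan])
  have "{\<omega> \<in> runs M s. Q (\<omega> k) \<and> (\<forall>j\<in>{..<k}. P (\<omega> j))} \<in> sigma_sets (runs M s) (cylinders s)" for k
    by (intro sets_Collect_conj state_event_measurable all)
  from sets_Collect_countable_Ex[OF this] show ?thesis
    unfolding until_event_def Ball_def lessThan_iff .
qed

definition until_prob :: "('g list \<Rightarrow> bool) \<Rightarrow> ('g list \<Rightarrow> bool) \<Rightarrow> 'g list \<Rightarrow> real" where
  "until_prob P Q s = measure (run_measure M s) {\<omega> \<in> runs M s. until_event P Q \<omega>}"

lemma emeasure_until: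
  assumes s: "s \<in> lists (alphabet \<Delta>)"
  shows "{u. until_event P Q (run_of s u)} \<in> sets choices"
    and "ennreal (until_prob P Q s) = emeasure choices {u. until_event P Q (run_of s u)}"
proof -
  interpret sequence_space "measure_pmf choice" by (rule choices_sequence_space)
  let ?E = "{\<omega> \<in> runs M s. until_event P Q \<omega>}"
  have E: "?E \<in> sets (sigma (runs M s) (cylinders s))"
    using until_event_measurable cylinders_Pow by (simp add: sets_measure_of)
  have eq: "run_of s -` ?E \<inter> space choices = {u. until_event P Q (run_of s u)}"
    unfolding vimage_def by (simp add: run_of_runs[OF s] space_choices)
  show *: "{u. until_event P Q (run_of s u)} \<in> sets choices"
    using measurable_sets[OF run_of_measurable[OF s] E] unfolding eq .
  have "emeasure (run_measure M s) ?E = emeasure choices {u. until_event P Q (run_of s u)}"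
    unfolding run_measure_eq[OF s] run_distribution_def
    using emeasure_distr[OF run_of_measurable[OF s] E] unfolding eq .
  then show "ennreal (until_prob P Q s) = emeasure choices {u. until_event P Q (run_of s u)}"
    unfolding until_prob_def by (subst emeasure_eq_ennreal_measure[symmetric]) auto
qed

lemma until_event_unfold:
  "until_event P Q \<omega> \<longleftrightarrow> Q (\<omega> 0) \<or> P (\<omega> 0) \<and> until_event P Q (\<lambda>n. \<omega> (Suc n))"
proof -
  have "(\<exists>k. R k) \<longleftrightarrow> R 0 \<or> (\<exists>k. R (Suc k))" for R :: "nat \<Rightarrow> bool"
    by (metis not0_implies_Suc)
  from this[of "\<lambda>k. Q (\<omega> k) \<and> (\<forall>j<k. P (\<omega> j))"] show ?thesis
    unfolding until_event_def All_less_Suc2 by auto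
qed

lemma until_prob_1:
  assumes "s \<in> lists (alphabet \<Delta>)" "Q s"
  shows "until_prob P Q s = 1"
proof -
  interpret sequence_space "measure_pmf choice" by (rule choices_sequence_space)
  have "until_event P Q (run_of s u)" for u
    using assms(2) by (subst until_event_unfold) simp
  then have "{u. until_event P Q (run_of s u)} = space choices" by (simp add: space_choices)
  then have "ennreal (until_prob P Q s) = ennreal 1"
    unfolding emeasure_until(2)[OF assms(1)] using emeasure_space_1 by simp
  then show ?thesis by (simp add: until_prob_def)
qed

lemma until_prob_0:
  assumes "s \<in> lists (alphabet \<Delta>)" "\<And>\<omega>. \<omega> \<in> runs M s \<Longrightarrow> \<not> until_event P Q \<omega>"
  shows "until_prob P Q s = 0"
proof -
  have "{\<omega> \<in> runs M s. until_event P Q \<omega>} = {}" using assms(2) by blast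
  then show ?thesis unfolding until_prob_def by (simp only: measure_empty)
qed

text \<open>First-step analysis. By \<open>PiM_iter\<close> the sequence of choices is distributed
  like an independent first choice put in front of a fresh sequence; Fubini integrates over the
  first choice, after which the run restarts from \<open>chosen X x @ \<beta>\<close>.\<close>

lemma until_prob_step:
  assumes "X # \<beta> \<in> lists (alphabet \<Delta>)" "P (X # \<beta>)" "\<not> Q (X # \<beta>)"
  shows "until_prob P Q (X # \<beta>) = (\<Sum>\<alpha> | (X, \<alpha>) \<in> rules \<Delta>. weight X \<alpha> * until_prob P Q (\<alpha> @ \<beta>))"
proof -
  interpret sequence_space "measure_pmf choice" by (rule choices_sequence_space)
  have X: "X \<in> alphabet \<Delta>" and \<beta>: "\<beta> \<in> lists (alphabet \<Delta>)" using assms(1) by auto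
  let ?s = "X # \<beta>"
  let ?E = "\<lambda>s. {u. until_event P Q (run_of s u)}"
  let ?g = "\<lambda>(x, u). case_nat x u"
  have g: "?g \<in> measurable (measure_pmf choice \<Otimes>\<^sub>M choices) choices" by measurable
  have E: "?E ?s \<in> sets choices" by (rule emeasure_until(1)[OF assms(1)])
  have pre: "?g -` ?E ?s \<inter> space (measure_pmf choice \<Otimes>\<^sub>M choices) =
      {z. snd z \<in> ?E (chosen X (fst z) @ \<beta>)}"
  proof -
    have "until_event P Q (run_of ?s (case_nat x u)) \<longleftrightarrow> until_event P Q (run_of (chosen X x @ \<beta>) u)" for x u
      using assms(2,3) run_of_shift[of ?s x u] by (subst until_event_unfold) (simp del: run_of.simps(2))
    then show ?thesis by (auto simp: space_pair_measure space_choices)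
  qed
  have "ennreal (until_prob P Q ?s) = emeasure choices (?E ?s)"
    by (rule emeasure_until(2)[OF assms(1)])
  also have "\<dots> = emeasure (distr (measure_pmf choice \<Otimes>\<^sub>M choices) choices ?g) (?E ?s)"
    unfolding PiM_iter ..
  also have "\<dots> = emeasure (measure_pmf choice \<Otimes>\<^sub>M choices) {z. snd z \<in> ?E (chosen X (fst z) @ \<beta>)}"
    unfolding emeasure_distr[OF g E] pre ..
  also have "\<dots> = (\<integral>\<^sup>+x. emeasure choices (Pair x -` {z. snd z \<in> ?E (chosen X (fst z) @ \<beta>)}) \<partial>measure_pmf choice)"
    by (rule emeasure_pair_measure_alt) (use measurable_sets[OF g E] pre in simp)
  also have "\<dots> = (\<integral>\<^sup>+x. ennreal (until_prob P Q (chosen X x @ \<beta>)) \<partial>measure_pmf choice)"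
  proof (rule nn_integral_cong)
    fix x
    have "chosen X x @ \<beta> \<in> lists (alphabet \<Delta>)"
      using chosen_rule[OF X] rule_in_lists \<beta> by auto
    then show "emeasure choices (Pair x -` {z. snd z \<in> ?E (chosen X (fst z) @ \<beta>)}) =
        ennreal (until_prob P Q (chosen X x @ \<beta>))"
      using emeasure_until(2) by (simp add: vimage_def)
  qed
  also have "\<dots> = (\<Sum>\<alpha> | (X, \<alpha>) \<in> rules \<Delta>. ennreal (until_prob P Q (\<alpha> @ \<beta>)) * ennreal (weight X \<alpha>))"
    by (rule nn_integral_chosen[OF X])
  also have "\<dots> = (\<Sum>\<alpha> | (X, \<alpha>) \<in> rules \<Delta>. ennreal (weight X \<alpha> * until_prob P Q (\<alpha> @ \<beta>)))"
  proof (intro sum.cong refl)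
    fix \<alpha>
    have "ennreal (weight X \<alpha> * until_prob P Q (\<alpha> @ \<beta>)) =
        ennreal (weight X \<alpha>) * ennreal (until_prob P Q (\<alpha> @ \<beta>))"
      by (rule ennreal_mult') (simp add: weight_def)
    then show "ennreal (until_prob P Q (\<alpha> @ \<beta>)) * ennreal (weight X \<alpha>) =
        ennreal (weight X \<alpha> * until_prob P Q (\<alpha> @ \<beta>))" by (simp only: mult.commute)
  qed
  also have "\<dots> = ennreal (\<Sum>\<alpha> | (X, \<alpha>) \<in> rules \<Delta>. weight X \<alpha> * until_prob P Q (\<alpha> @ \<beta>))"
    by (rule sum_ennreal) (simp add: weight_def until_prob_def)
  finally show ?thesis
    by (subst (asm) ennreal_inj) (auto intro!: sum_nonneg simp: weight_def until_prob_def)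
qed

text \<open>A finite path has positive probability when no amplitude vanishes. Positive probability
  is thus plain reachability, which supplies the existential quantifier of the final
  formula.\<close>

lemma until_prob_true_pos_iff:
  assumes s: "s \<in> lists (alphabet \<Delta>)"
    and amp: "\<And>X \<alpha>. (X, \<alpha>) \<in> rules \<Delta> \<Longrightarrow> rule_amplitude \<Delta> (X, \<alpha>) \<noteq> 0"
  shows "until_prob (\<lambda>_. True) Q s > 0 \<longleftrightarrow> (\<exists>t. (s, t) \<in> (trans M)\<^sup>* \<and> Q t)"
proof
  assume "until_prob (\<lambda>_. True) Q s > 0"
  then obtain \<omega> where \<omega>: "\<omega> \<in> runs M s" "until_event (\<lambda>_. True) Q \<omega>"
    using until_prob_0[OF s] by force
  have "(s, \<omega> n) \<in> (trans M)\<^sup>*" for n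
  proof (induction n)
    case 0
    then show ?case using \<omega>(1) by (simp add: runs_def)
  next
    case (Suc n)
    then show ?case using \<omega>(1) by (auto simp: runs_def intro: rtrancl_into_rtrancl)
  qed
  then show "\<exists>t. (s, t) \<in> (trans M)\<^sup>* \<and> Q t" using \<omega>(2) by (auto simp: until_event_def)
next
  assume "\<exists>t. (s, t) \<in> (trans M)\<^sup>* \<and> Q t"
  then obtain t where "(s, t) \<in> (trans M)\<^sup>*" "Q t" by blast
  then show "until_prob (\<lambda>_. True) Q s > 0" using s
  proof (induction rule: converse_rtrancl_induct)
    case base
    then show ?case using until_prob_1 by simp
  next
    case (step s v)
    have v: "v \<in> lists (alphabet \<Delta>)" using trans_lists step.hyps(1) by blast
    have pos: "until_prob (\<lambda>_. True) Q v > 0" using step.IH step.prems v by blast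
    show ?case
    \<comment> \<open>On the empty stack the only step is the self-loop, so that
      \<open>v = s\<close>; \<open>until_prob_step\<close> needs a top symbol.\<close>
    proof (cases "Q s \<or> s = []")
      case True
      then show ?thesis
      proof
        assume "s = []"
        then have "v = s" using step.hyps(1) by (auto simp: qmc_of_def)
        then show ?thesis using pos by simp
      qed (use until_prob_1 step.prems in simp)
    next
      case False
      then obtain X \<beta> where Xb: "s = X # \<beta>" by (cases s) auto
      then obtain \<alpha> where \<alpha>: "(X, \<alpha>) \<in> rules \<Delta>" "v = \<alpha> @ \<beta>"
        using step.hyps(1) by (auto simp: qmc_of_def)
      have "0 < weight X \<alpha> * until_prob (\<lambda>_. True) Q (\<alpha> @ \<beta>)"
        using amp[OF \<alpha>(1)] pos \<alpha>(2) by (simp add: weight_def)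
      also have "\<dots> \<le> (\<Sum>\<alpha> | (X, \<alpha>) \<in> rules \<Delta>. weight X \<alpha> * until_prob (\<lambda>_. True) Q (\<alpha> @ \<beta>))"
        using \<alpha>(1) finite_rules_from
        by (intro member_le_sum) (auto simp: weight_def until_prob_def)
      also have "\<dots> = until_prob (\<lambda>_. True) Q s"
        unfolding Xb by (rule until_prob_step[symmetric]) (use False step.prems Xb in auto)
      finally show ?thesis .
    qed
  qed
qed

lemma sat_Prob_Until:
  "sat M \<nu> (Prob cmp r (Until \<Phi> \<Phi>')) s \<longleftrightarrow>
     compares cmp (until_prob (sat M \<nu> \<Phi>) (sat M \<nu> \<Phi>') s) (of_rat r)"
  by (simp add: until_prob_def until_event_def)

end

section \<open>The pushdown system of a program\<close>

text \<open>While the word is guessed, the top symbol \<open>State k\<close> acts as control state,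
  and the letters below it form a trace of \<open>k\<close>. \<open>Check\<close> ends the guessing,
  and from then on the stack is only consumed, up to a mark or a base symbol that is pushed and
  popped again. Such control is lost with the first popped letter, so everything later has to be
  expressed by probabilities.\<close>

datatype sym = State "prog list" | Check | Bottom | Base | Goal nat | Fail nat | Letter op bool

instance op :: countable by countable_datatype
instance prog :: countable by countable_datatype
instance sym :: countable by countable_datatype

abbreviation enc :: "sym \<Rightarrow> nat" where "enc \<equiv> to_nat"
abbreviation dec :: "nat \<Rightarrow> sym" where "dec \<equiv> from_nat"

primrec reg :: "op \<Rightarrow> nat" where
  "reg (Add2 r) = r" | "reg (Dec r) = r" | "reg (Test r) = r"

primrec is_test :: "op \<Rightarrow> bool" where
  "is_test (Add2 r) = False" | "is_test (Dec r) = False" | "is_test (Test r) = True"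

section \<open>Amplitudes with rational parts\<close>

text \<open>Rational parts guarantee that the amplitude has a name; being nonzero makes each rule
  count in reachability.\<close>

definition rational_amplitude :: "complex \<Rightarrow> bool" where
  "rational_amplitude z \<longleftrightarrow> z \<noteq> 0 \<and> (\<exists>x y. z = Complex (of_rat x) (of_rat y))"

lemma rational_amplitude_Complex:
  "x \<noteq> 0 \<Longrightarrow> rational_amplitude (Complex (of_rat x) (of_rat y))"
  unfolding rational_amplitude_def by (auto simp: complex_eq_iff)

lemma rational_amplitudes:
  "rational_amplitude 1" "rational_amplitude (Complex (1 / 2) (1 / 2))"
  "rational_amplitude (Complex (4 / 5) (2 / 5))" "rational_amplitude (Complex (2 / 5) (1 / 5))"
  using rational_amplitude_Complex[of 1 0] rational_amplitude_Complex[of "1 / 2" "1 / 2"]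
    rational_amplitude_Complex[of "4 / 5" "2 / 5"] rational_amplitude_Complex[of "2 / 5" "1 / 5"]
  by (simp_all add: of_rat_divide one_complex.code)

text \<open>None of 1/2, 4/5 and 1/5 is the square of a rational, but each is a sum of two: 1/4 +
  1/4, 16/25 + 4/25 and 4/25 + 1/25.\<close>

lemma cmod_squares:
  "(cmod (Complex (1 / 2) (1 / 2)))\<^sup>2 = 1 / 2"
  "(cmod (Complex (4 / 5) (2 / 5)))\<^sup>2 = 4 / 5"
  "(cmod (Complex (2 / 5) (1 / 5)))\<^sup>2 = 1 / 5"
  by (simp_all add: cmod_power2 power_divide)

text \<open>A new element gets weight 1/2, and the old amplitudes are multiplied by
  \<open>(1 + i)/2\<close>, which halves their weights and keeps their parts rational. The result
  serves the symbols \<open>State l\<close>, which may have any number of rules and for which only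
  positivity matters.\<close>

lemma rational_amplitude_exists:
  assumes "finite S" "S \<noteq> {}"
  shows "\<exists>f :: 'a \<Rightarrow> complex. (\<forall>a\<in>S. rational_amplitude (f a)) \<and> (\<Sum>a\<in>S. (cmod (f a))\<^sup>2) = 1"
  using assms
proof (induction rule: finite_ne_induct)
  case (singleton a)
  show ?case by (intro exI[of _ "\<lambda>_. 1"]) (simp add: rational_amplitudes)
next
  case (insert a S)
  then obtain f :: "'a \<Rightarrow> complex" where f: "\<And>b. b \<in> S \<Longrightarrow> rational_amplitude (f b)"
    "(\<Sum>b\<in>S. (cmod (f b))\<^sup>2) = 1" by blast
  let ?h = "Complex (1 / 2) (1 / 2)"
  let ?g = "\<lambda>b. if b = a then ?h else ?h * f b"
  have half: "(cmod ?h)\<^sup>2 = 1 / 2" by (rule cmod_squares)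
  have "rational_amplitude (?h * z)" if "rational_amplitude z" for z
  proof -
    from that obtain x y where z: "z \<noteq> 0" "z = Complex (of_rat x) (of_rat y)"
      unfolding rational_amplitude_def by blast
    have "?h * z = Complex (of_rat ((x - y) / 2)) (of_rat ((x + y) / 2))"
      by (simp add: z(2) complex_eq_iff of_rat_divide of_rat_add of_rat_diff field_simps)
    moreover have "?h \<noteq> 0" by (simp add: complex_eq_iff)
    then have "?h * z \<noteq> 0" using z(1) by simp
    ultimately show ?thesis unfolding rational_amplitude_def by blast
  qed
  then have "\<forall>b\<in>insert a S. rational_amplitude (?g b)" using f(1) rational_amplitudes(2) by simp
  moreover have "(\<Sum>b\<in>insert a S. (cmod (?g b))\<^sup>2) = 1"
  proof -
    have "(\<Sum>b\<in>S. (cmod (?g b))\<^sup>2) = (\<Sum>b\<in>S. 1 / 2 * (cmod (f b))\<^sup>2)"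
      using insert.hyps by (intro sum.cong) (auto simp: norm_mult power_mult_distrib half)
    also have "\<dots> = 1 / 2" unfolding sum_distrib_left[symmetric] f(2) by simp
    finally show ?thesis using insert.hyps half by simp
  qed
  ultimately show ?case by (intro exI[of _ ?g] conjI)
qed

text \<open>Uniform in the set, not in its elements: some fixed choice whose weights are positive
  and sum to 1, not necessarily equal weights.\<close>

definition uniform_amplitude :: "'a set \<Rightarrow> 'a \<Rightarrow> complex" where
  "uniform_amplitude S = (SOME f. (\<forall>a\<in>S. rational_amplitude (f a)) \<and> (\<Sum>a\<in>S. (cmod (f a))\<^sup>2) = 1)"

lemma uniform_amplitude:
  assumes "finite S" "S \<noteq> {}"
  shows "\<forall>a\<in>S. rational_amplitude (uniform_amplitude S a)"
    and "(\<Sum>a\<in>S. (cmod (uniform_amplitude S a))\<^sup>2) = 1"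
  unfolding uniform_amplitude_def using someI_ex[OF rational_amplitude_exists[OF assms]] by auto

definition mark :: "bool \<Rightarrow> nat \<Rightarrow> sym" where
  "mark d r = (if d then Goal r else Fail r)"

text \<open>The moves of the automaton that read no letter; a move out of \<open>Op a # l\<close> is
  excluded because its reversal has to push a letter.\<close>

definition silent_moves :: "prog list \<Rightarrow> prog list set" where
  "silent_moves k = (if \<exists>a l. k = Op a # l then {} else next_prog k)"

locale encoded_program =
  fixes p :: prog and R :: nat
  assumes reg_bound: "\<And>k a. Op a # k \<in> insert [] (continuations p []) \<Longrightarrow> reg a < R"
begin

definition K :: "prog list set" where "K = insert [] (continuations p [])"

definition ops :: "op set" where "ops = {a. \<exists>k. Op a # k \<in> K}"

definition syms :: "sym set" where
  "syms = State ` K \<union> {Check, Bottom, Base} \<union> Goal ` {..<R} \<union> Fail ` {..<R} \<union>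
     {Letter a d | a d. a \<in> ops}"

text \<open>
  The machine guesses a trace backwards, so that its first operation ends up on top of the stack.
\<close>

primrec rhs :: "sym \<Rightarrow> sym list set" where
  "rhs (State l) = insert [State l] ({[State k] | k. k \<in> K \<and> l \<in> silent_moves k} \<union>
     {[State (Op a # l), Letter a d] | a d. Op a # l \<in> K} \<union> {[Check] | u :: unit. l = [p]})"
| "rhs Check = {[]}"
| "rhs Bottom = {[], [Base]}"
| "rhs Base = {[]}"
| "rhs (Goal r) = {[]}"
| "rhs (Fail r) = {[]}"
| "rhs (Letter a d) = (if is_test a then {[]} else {[], [mark d (reg a)]})"

text \<open>
  The squared moduli are 4/5 and 1/5 for \<open>Add2\<close>, and 1/2 and 1/2 for \<open>Dec\<close> and \<open>Bottom\<close>: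
  a popped letter thus applies \<^const>\<open>value_step\<close> to the reachability probability.
\<close>

primrec amp_of :: "sym \<Rightarrow> sym list \<Rightarrow> complex" where
  "amp_of (State l) \<alpha> = uniform_amplitude (rhs (State l)) \<alpha>"
| "amp_of Check \<alpha> = 1"
| "amp_of Bottom \<alpha> = Complex (1 / 2) (1 / 2)"
| "amp_of Base \<alpha> = 1"
| "amp_of (Goal r) \<alpha> = 1"
| "amp_of (Fail r) \<alpha> = 1"
| "amp_of (Letter a d) \<alpha> = (case a of
     Add2 r \<Rightarrow> if \<alpha> = [] then Complex (4 / 5) (2 / 5) else Complex (2 / 5) (1 / 5)
   | Dec r \<Rightarrow> Complex (1 / 2) (1 / 2)
   | Test r \<Rightarrow> 1)"

definition \<Delta> :: "nat qbpa" where
  "\<Delta> = \<lparr> alphabet = enc ` syms,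
     rules = {(enc X, map enc \<alpha>) | X \<alpha>. X \<in> syms \<and> \<alpha> \<in> rhs X},
     rule_amplitude = (\<lambda>(x, \<alpha>). amp_of (dec x) (map dec \<alpha>)) \<rparr>"

text \<open>Residues modulo 3 keep the three kinds of atoms of a register apart: goal, fail and
  test. \<open>Base\<close> is a goal of all registers at once, so a single bottom symbol
  initializes each of them.\<close>

definition holds :: "nat \<Rightarrow> sym \<Rightarrow> bool" where
  "holds q X \<longleftrightarrow> (case X of
     Check \<Rightarrow> q = 0
   | Goal r \<Rightarrow> q = 3 * r + 1
   | Base \<Rightarrow> q mod 3 = 1
   | Fail r \<Rightarrow> q = 3 * r + 2
   | Letter a d \<Rightarrow> is_test a \<and> q = 3 * reg a + 3
   | _ \<Rightarrow> False)"

definition \<nu> :: "nat \<Rightarrow> nat list set" where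
  "\<nu> q = {w \<in> lists (enc ` syms). w \<noteq> [] \<and> holds q (dec (hd w))}"

lemma dec_enc: "map dec (map enc \<alpha>) = \<alpha>"
  by (simp add: map_idI)

lemma finite_K: "finite K"
  by (simp add: K_def finite_continuations)

lemma program_in_K: "[p] \<in> K"
  by (simp add: K_def self_continuation)

lemma K_closed: "k \<in> K \<Longrightarrow> l \<in> next_prog k \<Longrightarrow> l \<in> K"
  using continuations_closed[of k p "[]"] by (cases "k = []") (auto simp: K_def)

lemma reg_ops: "a \<in> ops \<Longrightarrow> reg a < R"
  using reg_bound by (auto simp: ops_def K_def)

lemma finite_ops: "finite ops"
proof -
  have "ops \<subseteq> (\<lambda>k. SOME a. \<exists>l. k = Op a # l) ` K"
  proof
    fix a assume "a \<in> ops"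
    then obtain l where "Op a # l \<in> K" by (auto simp: ops_def)
    then show "a \<in> (\<lambda>k. SOME a. \<exists>l. k = Op a # l) ` K" by (intro image_eqI[of _ _ "Op a # l"]) auto
  qed
  then show ?thesis using finite_K finite_surj by blast
qed

lemma finite_syms: "finite syms"
proof -
  have "{Letter a d | a d. a \<in> ops} = (\<lambda>(a, d). Letter a d) ` (ops \<times> UNIV)" by auto
  then show ?thesis by (simp add: syms_def finite_K finite_ops)
qed

lemma rhs_syms: "X \<in> syms \<Longrightarrow> \<alpha> \<in> rhs X \<Longrightarrow> \<alpha> \<in> lists syms \<and> length \<alpha> \<le> 2"
proof (cases X)
  case (State l)
  assume "X \<in> syms" "\<alpha> \<in> rhs X"
  moreover have "a \<in> ops" if "Op a # l \<in> K" for a using that by (auto simp: ops_def)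
  ultimately show ?thesis unfolding State by (auto simp: syms_def)
next
  case (Letter a d)
  assume "X \<in> syms" "\<alpha> \<in> rhs X"
  then show ?thesis using reg_ops unfolding Letter
    by (auto simp: syms_def mark_def split: if_splits)
qed (auto simp: syms_def)

lemma finite_rhs: "X \<in> syms \<Longrightarrow> finite (rhs X)"
proof -
  assume "X \<in> syms"
  then have "rhs X \<subseteq> {\<alpha>. set \<alpha> \<subseteq> syms \<and> length \<alpha> \<le> 2}" using rhs_syms by fastforce
  then show ?thesis using finite_lists_length_le[OF finite_syms] finite_subset by blast
qed

text \<open>For \<open>State l\<close> this is due to the self-loop \<open>[State l]\<close>: a
  continuation may have no predecessor in \<open>K\<close>. Waiting changes nothing in
  reachability.\<close>

lemma rhs_nonempty: "rhs X \<noteq> {}"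
  by (cases X) auto

lemma amp_of_rational:
  assumes "X \<in> syms" "\<alpha> \<in> rhs X" shows "rational_amplitude (amp_of X \<alpha>)"
proof -
  show ?thesis
  proof (cases X)
    case (State l)
    have "finite (rhs (State l))" using finite_rhs[OF assms(1)] unfolding State .
    from uniform_amplitude(1)[OF this rhs_nonempty] show ?thesis
      using assms(2) unfolding State amp_of.simps by blast
  qed (auto simp: rational_amplitudes split: op.splits)
qed

lemma sum_amp_of:
  assumes "X \<in> syms" shows "(\<Sum>\<alpha>\<in>rhs X. (cmod (amp_of X \<alpha>))\<^sup>2) = 1"
proof (cases X)
  case (State l)
  have "finite (rhs (State l))" using finite_rhs[OF assms] unfolding State .
  from uniform_amplitude(2)[OF this rhs_nonempty] show ?thesis unfolding State amp_of.simps .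
next
  case (Letter a d)
  then show ?thesis by (cases a) (simp_all add: cmod_squares)
qed (simp_all add: cmod_squares)

lemma rules_from:
  "X \<in> syms \<Longrightarrow> {\<alpha>. (enc X, \<alpha>) \<in> rules \<Delta>} = map enc ` rhs X"
  by (auto simp: \<Delta>_def)

lemma sum_rules_from:
  assumes "X \<in> syms"
  shows "(\<Sum>\<alpha> | (enc X, \<alpha>) \<in> rules \<Delta>. f \<alpha>) = (\<Sum>\<alpha>\<in>rhs X. f (map enc \<alpha>))"
  unfolding rules_from[OF assms]
  by (subst sum.reindex) (auto intro: inj_onI simp: inj_map_eq_map)

lemma rule_amplitude_\<Delta>: "rule_amplitude \<Delta> (enc X, map enc \<alpha>) = amp_of X \<alpha>"
  by (simp add: \<Delta>_def dec_enc del: map_map)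

lemma is_qbpa_\<Delta>: "is_qbpa \<Delta>"
  unfolding is_qbpa_def
proof (intro conjI)
  show "finite (alphabet \<Delta>)" by (simp add: \<Delta>_def finite_syms)
  have "rules \<Delta> = (\<lambda>(X, \<alpha>). (enc X, map enc \<alpha>)) ` (Sigma syms rhs)" by (auto simp: \<Delta>_def)
  then show "finite (rules \<Delta>)" using finite_syms finite_rhs by (simp add: finite_SigmaI)
  show "\<forall>(X, \<alpha>)\<in>rules \<Delta>. X \<in> alphabet \<Delta> \<and> \<alpha> \<in> lists (alphabet \<Delta>) \<and> length \<alpha> \<le> 2"
  proof (intro ballI, clarify)
    fix x \<alpha> assume "(x, \<alpha>) \<in> rules \<Delta>"
    then obtain X \<beta> where X: "x = enc X" "\<alpha> = map enc \<beta>" "X \<in> syms" "\<beta> \<in> rhs X"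
      by (auto simp: \<Delta>_def)
    then show "x \<in> alphabet \<Delta> \<and> \<alpha> \<in> lists (alphabet \<Delta>) \<and> length \<alpha> \<le> 2"
      using rhs_syms[OF X(3,4)] by (auto simp: \<Delta>_def)
  qed
  show "\<forall>X\<in>alphabet \<Delta>. \<exists>\<alpha>. (X, \<alpha>) \<in> rules \<Delta>"
    using rhs_nonempty by (fastforce simp: \<Delta>_def)
  show "\<forall>X\<in>alphabet \<Delta>. (\<Sum>\<alpha> | (X, \<alpha>) \<in> rules \<Delta>. (cmod (rule_amplitude \<Delta> (X, \<alpha>)))\<^sup>2) = 1"
  proof
    fix x assume "x \<in> alphabet \<Delta>"
    then obtain X where "x = enc X" "X \<in> syms" by (auto simp: \<Delta>_def)
    then show "(\<Sum>\<alpha> | (x, \<alpha>) \<in> rules \<Delta>. (cmod (rule_amplitude \<Delta> (x, \<alpha>)))\<^sup>2) = 1"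
      by (simp only: sum_rules_from rule_amplitude_\<Delta> sum_amp_of)
  qed
qed

sublocale qbpa_runs \<Delta>
  by unfold_locales (rule is_qbpa_\<Delta>)

lemma regular_assignment_\<nu>: "regular_assignment (alphabet \<Delta>) \<nu>"
  unfolding regular_assignment_def
proof
  fix q
  \<comment> \<open>State 0 means that nothing has been read; 1 and 2 are absorbing and record the
    verdict on the first letter.\<close>
  let ?step = "\<lambda>x n. if n = 0 then (if holds q (dec x) then 1 else 2) else n :: nat"
  have fold: "n \<noteq> 0 \<Longrightarrow> fold ?step w n = n" for n w by (induction w) auto
  have "\<nu> q = {w \<in> lists (alphabet \<Delta>). fold ?step w 0 \<in> {1}}"
  proof (rule set_eqI)
    fix w
    have "w \<noteq> [] \<and> holds q (dec (hd w)) \<longleftrightarrow> fold ?step w 0 \<in> {1}"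
      by (cases w) (auto simp: fold)
    then show "w \<in> \<nu> q \<longleftrightarrow> w \<in> {w \<in> lists (alphabet \<Delta>). fold ?step w 0 \<in> {1}}"
      by (simp add: \<nu>_def \<Delta>_def)
  qed
  then show "regular_language (alphabet \<Delta>) (\<nu> q)"
    unfolding regular_language_def
    by (intro exI[of _ "{0, 1, 2}"] exI[of _ 0] exI[of _ ?step] exI[of _ "{1}"]) auto
qed

lemma simple_assignment_\<nu>: "simple_assignment (alphabet \<Delta>) \<nu>"
  unfolding simple_assignment_def
proof
  fix q
  show "\<exists>H\<subseteq>alphabet \<Delta>. \<forall>X\<in>alphabet \<Delta>. \<forall>\<beta>\<in>lists (alphabet \<Delta>). (X # \<beta> \<in> \<nu> q) = (X \<in> H)"
    by (intro exI[of _ "{x \<in> alphabet \<Delta>. holds q (dec x)}"]) (auto simp: \<nu>_def \<Delta>_def)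
qed

lemma enc_in_\<nu>: "\<sigma> \<in> lists syms \<Longrightarrow> map enc \<sigma> \<in> \<nu> q \<longleftrightarrow> \<sigma> \<noteq> [] \<and> holds q (hd \<sigma>)"
  by (cases \<sigma>) (auto simp: \<nu>_def)

lemma enc_lists: "\<sigma> \<in> lists syms \<Longrightarrow> map enc \<sigma> \<in> lists (alphabet \<Delta>)"
  by (auto simp: \<Delta>_def)

section \<open>Goal probabilities as stack values\<close>

definition hit :: "nat \<Rightarrow> sym list \<Rightarrow> real" where
  "hit r \<sigma> = until_prob (\<lambda>s. s \<notin> \<nu> (3 * r + 2)) (\<lambda>s. s \<in> \<nu> (3 * r + 1)) (map enc \<sigma>)"

lemma hit_goal: "X # \<sigma> \<in> lists syms \<Longrightarrow> holds (3 * r + 1) X \<Longrightarrow> hit r (X # \<sigma>) = 1"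
  unfolding hit_def by (intro until_prob_1 enc_lists) (simp_all only: enc_in_\<nu>, simp)

lemma hit_fail:
  assumes "X # \<sigma> \<in> lists syms" "holds (3 * r + 2) X" "\<not> holds (3 * r + 1) X"
  shows "hit r (X # \<sigma>) = 0"
  unfolding hit_def
proof (intro until_prob_0 enc_lists assms(1))
  fix \<omega> assume "\<omega> \<in> runs M (map enc (X # \<sigma>))"
  then have "\<omega> 0 = map enc (X # \<sigma>)" by (simp add: runs_def)
  then show "\<not> until_event (\<lambda>s. s \<notin> \<nu> (3 * r + 2)) (\<lambda>s. s \<in> \<nu> (3 * r + 1)) \<omega>"
    using assms(2,3) enc_in_\<nu>[OF assms(1)] by (subst until_event_unfold) simp
qed

text \<open>The self-loop of the empty stack never meets a goal, so emptying the stack counts as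
  failure. This is the losing half of \<open>Bottom\<close>, whose value is therefore 1/2.\<close>

lemma hit_Nil: "hit r [] = 0"
  unfolding hit_def
proof (intro until_prob_0 enc_lists)
  fix \<omega> assume \<omega>: "\<omega> \<in> runs M (map enc [])"
  have "\<omega> n = []" for n
  proof (induction n)
    case (Suc n)
    have "(\<omega> n, \<omega> (Suc n)) \<in> trans M" using \<omega> by (simp add: runs_def)
    then show ?case unfolding Suc by (auto simp: qmc_of_def)
  qed (use \<omega> in \<open>simp add: runs_def\<close>)
  then show "\<not> until_event (\<lambda>s. s \<notin> \<nu> (3 * r + 2)) (\<lambda>s. s \<in> \<nu> (3 * r + 1)) \<omega>"
    by (simp add: until_event_def \<nu>_def)
qed simp

lemma hit_step:
  assumes "X # \<sigma> \<in> lists syms" "\<not> holds (3 * r + 1) X" "\<not> holds (3 * r + 2) X"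
  shows "hit r (X # \<sigma>) = (\<Sum>\<alpha>\<in>rhs X. (cmod (amp_of X \<alpha>))\<^sup>2 * hit r (\<alpha> @ \<sigma>))"
proof -
  have "hit r (X # \<sigma>) = (\<Sum>\<alpha> | (enc X, \<alpha>) \<in> rules \<Delta>. weight (enc X) \<alpha> *
      until_prob (\<lambda>s. s \<notin> \<nu> (3 * r + 2)) (\<lambda>s. s \<in> \<nu> (3 * r + 1)) (\<alpha> @ map enc \<sigma>))"
    unfolding hit_def list.map
    by (rule until_prob_step)
      (use assms enc_in_\<nu>[OF assms(1)] enc_lists[OF assms(1)] in simp_all)
  also have "\<dots> = (\<Sum>\<alpha>\<in>rhs X. (cmod (amp_of X \<alpha>))\<^sup>2 * hit r (\<alpha> @ \<sigma>))"
    using assms(1) by (simp add: sum_rules_from weight_def rule_amplitude_\<Delta> hit_def)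
  finally show ?thesis .
qed

abbreviation letters :: "(op \<times> bool) list \<Rightarrow> sym list" where
  "letters w \<equiv> map (\<lambda>(a, d). Letter a d) w"

lemma letters_syms: "fst ` set w \<subseteq> ops \<Longrightarrow> letters w \<in> lists syms"
  by (force simp: syms_def)

lemma Bottom_syms: "[Bottom] \<in> lists syms" by (simp add: syms_def)

lemma hit_Bottom: "hit r [Bottom] = 1 / 2"
proof -
  have "hit r [Base] = 1" by (rule hit_goal) (simp_all add: syms_def holds_def)
  moreover have "hit r [Bottom] = (\<Sum>\<alpha>\<in>rhs Bottom. (cmod (amp_of Bottom \<alpha>))\<^sup>2 * hit r (\<alpha> @ []))"
    by (rule hit_step) (simp_all add: syms_def holds_def)
  ultimately show ?thesis by (simp add: hit_Nil cmod_squares)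
qed

text \<open>A mark of register \<open>r\<close> decides the event at once: the run has reached its
  goal or has violated the until condition. A mark of another register is popped without effect on
  the value.\<close>

lemma hit_mark:
  assumes "mark d q # \<sigma> \<in> lists syms"
  shows "hit r (mark d q # \<sigma>) = (if q = r then of_bool d else hit r \<sigma>)"
proof (cases "q = r")
  case True
  show ?thesis
  proof (cases d)
    case True
    then show ?thesis using hit_goal[OF assms, of r] \<open>q = r\<close> by (simp add: mark_def holds_def)
  next
    case False
    then show ?thesis using hit_fail[OF assms, of r] \<open>q = r\<close> by (simp add: mark_def holds_def)
  qed
next
  case False
  have "3 * r + 1 \<noteq> 3 * q + 2" "3 * r + 2 \<noteq> 3 * q + 1" by presburger+
  then have "\<not> holds (3 * r + 1) (mark d q)" "\<not> holds (3 * r + 2) (mark d q)"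
    using False by (auto simp: mark_def holds_def)
  from hit_step[OF assms this] show ?thesis using False by (auto simp: mark_def)
qed

lemma hit_Check: "Check # \<sigma> \<in> lists syms \<Longrightarrow> hit r (Check # \<sigma>) = hit r \<sigma>"
  using hit_step[of Check \<sigma> r] by (simp add: holds_def)

text \<open>For another register both outcomes of the letter continue with the same value, and the
  weights sum to 1. This is why all registers can share one stack without disturbing each
  other.\<close>

lemma hit_Letter:
  assumes "Letter a d # \<sigma> \<in> lists syms"
  shows "hit r (Letter a d # \<sigma>) = value_step r a d (hit r \<sigma>)"
proof -
  have no: "\<not> holds (3 * r + 1) (Letter a d)" "\<not> holds (3 * r + 2) (Letter a d)"
    unfolding holds_def by (simp_all, presburger+)
  have a: "a \<in> ops" using assms by (auto simp: syms_def)
  have m: "hit r (mark d (reg a) # \<sigma>) = (if reg a = r then of_bool d else hit r \<sigma>)"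
    using assms reg_ops[OF a] by (intro hit_mark) (auto simp: mark_def syms_def)
  show ?thesis
    unfolding hit_step[OF assms no]
    by (cases a) (use m in \<open>auto simp: cmod_squares field_simps\<close>)
qed

lemma hit_letters:
  "fst ` set w \<subseteq> ops \<Longrightarrow> hit r (letters w @ [Bottom]) = stack_value r w"
proof (induction w)
  case Nil
  show ?case by (simp add: hit_Bottom)
next
  case (Cons l w)
  obtain a d where l: "l = (a, d)" by (cases l)
  have "Letter a d # letters w @ [Bottom] \<in> lists syms"
    using letters_syms[OF Cons.prems] Bottom_syms l by simp
  then show ?case using Cons hit_Letter l by simp
qed

end


section \<open>The formula\<close>

definition true_formula :: state_formula where
  "true_formula = Neg (Conj (Atom 0) (Neg (Atom 0)))"

definition value_formula :: "nat \<Rightarrow> nat \<Rightarrow> state_formula" where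
  "value_formula r k = Prob Equal (1 / 2 ^ Suc k) (Until (Neg (Atom (3 * r + 2))) (Atom (3 * r + 1)))"

definition possibly :: "state_formula \<Rightarrow> state_formula" where
  "possibly \<Phi> = Prob Greater 0 (Until true_formula \<Phi>)"

text \<open>An "always" written as the negation of "possibly not": whenever a test of
  \<open>r\<close> is on top, the value of \<open>r\<close> is 1/2, that is, the counter is
  zero.\<close>

definition tests_formula :: "nat \<Rightarrow> state_formula" where
  "tests_formula R = Neg (possibly (Neg (foldr Conj
     (map (\<lambda>r. Neg (Conj (Atom (3 * r + 3)) (Neg (value_formula r 0)))) [0..<R]) true_formula)))"

text \<open>The part of the formula that does not mention the inputs. Its code is a fixed number and
  can itself be an input. The four inputs occupy registers 0 to 3, and the others start at zero;
  \<open>Atom 0\<close> demands that the guess is complete.\<close>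

definition rest_formula :: "nat \<Rightarrow> state_formula" where
  "rest_formula R =
     foldr Conj (map (\<lambda>r. value_formula r 0) [4..<R]) (Conj (Atom 0) (tests_formula R))"

definition start_formula :: "nat list \<Rightarrow> state_formula \<Rightarrow> state_formula" where
  "start_formula xs \<Phi> = possibly (foldr Conj (map (\<lambda>r. value_formula r (xs ! r)) [0..<4]) \<Phi>)"

lemma stack_value_untouched:
  "(\<And>a. a \<in> fst ` set w \<Longrightarrow> reg a \<noteq> r) \<Longrightarrow> stack_value r w = 1 / 2"
proof (induction w)
  case (Cons l w)
  then have "stack_value r w = 1 / 2" "reg (fst l) \<noteq> r" by auto
  then show ?case by (cases "fst l") auto
qed simp

text \<open>The recursion as a condition on all suffixes of the word, which is what reachability
  from \<open>Check\<close> can express.\<close>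

lemma tests_ok_iff:
  "tests_ok w \<longleftrightarrow> (\<forall>v r d u. w = v @ (Test r, d) # u \<longrightarrow> stack_value r u = 1 / 2)"
proof (induction w)
  case (Cons l w)
  show ?case
  proof
    assume ok: "tests_ok (l # w)"
    show "\<forall>v r d u. l # w = v @ (Test r, d) # u \<longrightarrow> stack_value r u = 1 / 2"
    proof (intro allI impI)
      fix v r d u assume eq: "l # w = v @ (Test r, d) # u"
      show "stack_value r u = 1 / 2"
      proof (cases v)
        case Nil
        then show ?thesis using ok eq by simp
      next
        case (Cons x v')
        then have "w = v' @ (Test r, d) # u" using eq by simp
        moreover have "tests_ok w" using ok by simp
        ultimately show ?thesis using Cons.IH by blast
      qed
    qed
  next
    assume *: "\<forall>v r d u. l # w = v @ (Test r, d) # u \<longrightarrow> stack_value r u = 1 / 2"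
    have "stack_value r u = 1 / 2" if "w = v @ (Test r, d) # u" for v r d u
      using *[rule_format, of "l # v" r d u] that by simp
    moreover have "stack_value r w = 1 / 2" if "fst l = Test r" for r
      using *[rule_format, of "[]" r "snd l" w] that by (cases l) simp
    ultimately show "tests_ok (l # w)" using Cons.IH by simp
  qed
qed simp

context encoded_program
begin

section \<open>Reachable stacks\<close>

definition moves :: "(sym list \<times> sym list) set" where
  "moves = insert ([], []) {(X # \<sigma>, \<alpha> @ \<sigma>) | X \<sigma> \<alpha>. X \<in> syms \<and> \<alpha> \<in> rhs X \<and> \<sigma> \<in> lists syms}"

lemma moves_syms: "(\<sigma>, \<tau>) \<in> moves \<Longrightarrow> \<sigma> \<in> lists syms \<Longrightarrow> \<tau> \<in> lists syms"
proof -
  assume "(\<sigma>, \<tau>) \<in> moves" "\<sigma> \<in> lists syms"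
  then consider "\<tau> = []" | X \<rho> \<alpha> where "\<tau> = \<alpha> @ \<rho>" "X \<in> syms" "\<alpha> \<in> rhs X" "\<rho> \<in> lists syms"
    unfolding moves_def by blast
  then show "\<tau> \<in> lists syms"
  proof cases
    case 2
    then show ?thesis using rhs_syms[OF 2(2,3)] by simp
  qed simp
qed

lemma moves_rtrancl_syms: "(\<sigma>, \<tau>) \<in> moves\<^sup>* \<Longrightarrow> \<sigma> \<in> lists syms \<Longrightarrow> \<tau> \<in> lists syms"
  by (induction rule: rtrancl_induct) (use moves_syms in blast)+

lemma move: "X # \<sigma> \<in> lists syms \<Longrightarrow> \<alpha> \<in> rhs X \<Longrightarrow> (X # \<sigma>, \<alpha> @ \<sigma>) \<in> moves"
  by (auto simp: moves_def)

lemma trans_iff: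
  assumes "\<sigma> \<in> lists syms"
  shows "(map enc \<sigma>, t) \<in> trans M \<longleftrightarrow> (\<exists>\<tau>. t = map enc \<tau> \<and> (\<sigma>, \<tau>) \<in> moves)"
proof (cases \<sigma>)
  case Nil
  then show ?thesis by (auto simp: qmc_of_def moves_def)
next
  case (Cons X \<rho>)
  have X: "X \<in> syms" "\<rho> \<in> lists syms" using assms Cons by auto
  have "(map enc \<sigma>, t) \<in> trans M \<longleftrightarrow> (\<exists>\<alpha>'. (enc X, \<alpha>') \<in> rules \<Delta> \<and> t = \<alpha>' @ map enc \<rho>)"
    using enc_lists[OF X(2)] Cons by (auto simp: qmc_of_def)
  also have "\<dots> \<longleftrightarrow> (\<exists>\<alpha>'\<in>{\<alpha>'. (enc X, \<alpha>') \<in> rules \<Delta>}. t = \<alpha>' @ map enc \<rho>)" by blast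
  also have "\<dots> \<longleftrightarrow> (\<exists>\<alpha>\<in>rhs X. t = map enc (\<alpha> @ \<rho>))"
    unfolding rules_from[OF X(1)] by simp
  also have "\<dots> \<longleftrightarrow> (\<exists>\<tau>. t = map enc \<tau> \<and> (\<sigma>, \<tau>) \<in> moves)"
  proof -
    have "(\<sigma>, \<tau>) \<in> moves \<longleftrightarrow> (\<exists>\<alpha>\<in>rhs X. \<tau> = \<alpha> @ \<rho>)" for \<tau>
      using X Cons by (auto simp: moves_def)
    then have eq: "(\<exists>\<tau>. t = map enc \<tau> \<and> (\<sigma>, \<tau>) \<in> moves) \<longleftrightarrow>
        (\<exists>\<tau>. t = map enc \<tau> \<and> (\<exists>\<alpha>\<in>rhs X. \<tau> = \<alpha> @ \<rho>))" by (simp only:)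
    show ?thesis unfolding eq
    proof
      assume "\<exists>\<alpha>\<in>rhs X. t = map enc (\<alpha> @ \<rho>)"
      then obtain \<alpha> where "\<alpha> \<in> rhs X" "t = map enc (\<alpha> @ \<rho>)" by (elim bexE)
      then show "\<exists>\<tau>. t = map enc \<tau> \<and> (\<exists>\<alpha>\<in>rhs X. \<tau> = \<alpha> @ \<rho>)"
        by (intro exI[of _ "\<alpha> @ \<rho>"] conjI bexI[of _ \<alpha>] refl)
    next
      assume "\<exists>\<tau>. t = map enc \<tau> \<and> (\<exists>\<alpha>\<in>rhs X. \<tau> = \<alpha> @ \<rho>)"
      then obtain \<tau> \<alpha> where "t = map enc \<tau>" "\<alpha> \<in> rhs X" "\<tau> = \<alpha> @ \<rho>"
        by (elim exE conjE bexE)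
      then show "\<exists>\<alpha>\<in>rhs X. t = map enc (\<alpha> @ \<rho>)" by (intro bexI[of _ \<alpha>]) simp_all
    qed
  qed
  finally show ?thesis .
qed

lemma trans_rtrancl_iff:
  assumes "\<sigma> \<in> lists syms"
  shows "(map enc \<sigma>, t) \<in> (trans M)\<^sup>* \<longleftrightarrow> (\<exists>\<tau>. t = map enc \<tau> \<and> (\<sigma>, \<tau>) \<in> moves\<^sup>*)"
proof
  assume "(map enc \<sigma>, t) \<in> (trans M)\<^sup>*"
  then show "\<exists>\<tau>. t = map enc \<tau> \<and> (\<sigma>, \<tau>) \<in> moves\<^sup>*"
  proof (induction rule: rtrancl_induct)
    case (step t u)
    then obtain \<tau> where \<tau>: "t = map enc \<tau>" "(\<sigma>, \<tau>) \<in> moves\<^sup>*" by (elim exE conjE)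
    obtain \<rho> where "u = map enc \<rho>" "(\<tau>, \<rho>) \<in> moves"
      using step.hyps(2) unfolding \<tau>(1) trans_iff[OF moves_rtrancl_syms[OF \<tau>(2) assms]]
      by (elim exE conjE)
    then show ?case using rtrancl_into_rtrancl[OF \<tau>(2)] by (intro exI[of _ \<rho>] conjI)
  qed (intro exI[of _ \<sigma>] conjI refl rtrancl_refl)
next
  assume "\<exists>\<tau>. t = map enc \<tau> \<and> (\<sigma>, \<tau>) \<in> moves\<^sup>*"
  then obtain \<tau> where t: "t = map enc \<tau>" and "(\<sigma>, \<tau>) \<in> moves\<^sup>*" by (elim exE conjE)
  from this(2) show "(map enc \<sigma>, t) \<in> (trans M)\<^sup>*" unfolding t
  proof (induction rule: rtrancl_induct)
    case (step \<tau> \<rho>)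
    have "(map enc \<tau>, map enc \<rho>) \<in> trans M"
      unfolding trans_iff[OF moves_rtrancl_syms[OF step.hyps(1) assms]]
      using step.hyps(2) by (intro exI[of _ \<rho>] conjI refl)
    with step.IH show ?case by (rule rtrancl_into_rtrancl)
  qed (rule rtrancl_refl)
qed

lemma sat_foldr_Conj: "sat M \<nu> (foldr Conj \<Phi>s \<Phi>) s \<longleftrightarrow> (\<forall>\<Psi>\<in>set \<Phi>s. sat M \<nu> \<Psi> s) \<and> sat M \<nu> \<Phi> s"
  by (induction \<Phi>s) auto

lemma sat_true_formula: "sat M \<nu> true_formula = (\<lambda>_. True)"
  by (auto simp: true_formula_def)

lemma sat_value_formula: "sat M \<nu> (value_formula r k) (map enc \<sigma>) \<longleftrightarrow> hit r \<sigma> = 1 / 2 ^ Suc k"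
proof -
  have "sat M \<nu> (Neg (Atom q)) = (\<lambda>s. s \<notin> \<nu> q)" "sat M \<nu> (Atom q) = (\<lambda>s. s \<in> \<nu> q)" for q
    by auto
  then show ?thesis
    unfolding value_formula_def sat_Prob_Until compares.simps hit_def
    by (simp only: of_rat_divide of_rat_power of_rat_1 of_rat_numeral_eq)
qed

lemma sat_possibly:
  assumes "\<sigma> \<in> lists syms"
  shows "sat M \<nu> (possibly \<Phi>) (map enc \<sigma>) \<longleftrightarrow> (\<exists>\<tau>. (\<sigma>, \<tau>) \<in> moves\<^sup>* \<and> sat M \<nu> \<Phi> (map enc \<tau>))"
proof -
  have amp: "rule_amplitude \<Delta> (X, \<alpha>) \<noteq> 0" if rule: "(X, \<alpha>) \<in> rules \<Delta>" for X \<alpha>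
  proof -
    obtain Y \<beta> where Y: "X = enc Y" "\<alpha> = map enc \<beta>" "Y \<in> syms" "\<beta> \<in> rhs Y"
      using rule by (auto simp: \<Delta>_def)
    then show ?thesis
      unfolding Y(1,2) rule_amplitude_\<Delta> using amp_of_rational by (simp add: rational_amplitude_def)
  qed
  have "sat M \<nu> (possibly \<Phi>) (map enc \<sigma>) \<longleftrightarrow>
      (\<exists>t. (map enc \<sigma>, t) \<in> (trans M)\<^sup>* \<and> sat M \<nu> \<Phi> t)"
    unfolding possibly_def sat_Prob_Until sat_true_formula compares.simps of_rat_0
    by (rule until_prob_true_pos_iff[OF enc_lists[OF assms] amp])
  then show ?thesis unfolding trans_rtrancl_iff[OF assms] by blast
qed

abbreviation start :: "sym list" where "start \<equiv> [State [], Bottom]"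

lemma start_syms: "start \<in> lists syms"
  by (simp add: syms_def K_def)

lemma trace_ops: "trace k v \<Longrightarrow> k \<in> K \<Longrightarrow> set v \<subseteq> ops"
proof (induction rule: trace.induct)
  case (trace_Op k w a)
  then show ?case using K_closed[of "Op a # k" k] by (auto simp: ops_def)
next
  case (trace_Seq p q k w)
  then show ?case using K_closed[of "Seq p q # k"] by simp
next
  case (trace_Star_exit k w p)
  then show ?case using K_closed[of "Star p # k"] by simp
next
  case (trace_Star_loop p k w)
  then show ?case using K_closed[of "Star p # k"] by simp
qed simp

lemma config_syms:
  assumes "trace k (map fst w)" "k \<in> K"
  shows "letters w @ [Bottom] \<in> lists syms" "State k # letters w @ [Bottom] \<in> lists syms"
    "Check # letters w @ [Bottom] \<in> lists syms"
proof -
  have "fst ` set w \<subseteq> ops" using trace_ops[OF assms] by simp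
  from letters_syms[OF this] show "letters w @ [Bottom] \<in> lists syms" using Bottom_syms by simp
  then show "State k # letters w @ [Bottom] \<in> lists syms" "Check # letters w @ [Bottom] \<in> lists syms"
    using assms(2) by (auto simp: syms_def)
qed

lemma silent_generation:
  assumes "(start, State l # \<sigma>) \<in> moves\<^sup>*" "State l # \<sigma> \<in> lists syms" "k \<in> K" "l \<in> silent_moves k"
  shows "(start, State k # \<sigma>) \<in> moves\<^sup>*"
proof -
  have "[State k] \<in> rhs (State l)" using assms(3,4) by simp
  from move[OF assms(2) this] have "(State l # \<sigma>, State k # \<sigma>) \<in> moves" by simp
  with assms(1) show ?thesis by (rule rtrancl_into_rtrancl)
qed

text \<open>The rules of \<open>trace\<close> build a trace from its end, in the order in which the
  machine pushes, so rule induction follows the machine step by step. Any digits may be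
  attached.\<close>

lemma generation_complete:
  "trace k v \<Longrightarrow> k \<in> K \<Longrightarrow> map fst w = v \<Longrightarrow>
     (start, State k # letters w @ [Bottom]) \<in> moves\<^sup>*"
proof (induction arbitrary: w rule: trace.induct)
  case (trace_Op k v a)
  then obtain d u where w: "w = (a, d) # u" "map fst u = v" by (cases w) auto
  have k: "k \<in> K" using K_closed trace_Op.prems(1) by simp
  have "[State (Op a # k), Letter a d] \<in> rhs (State k)" using trace_Op.prems(1) by auto
  from move[OF config_syms(2) this, of u] trace_Op.hyps w k
  have "(State k # letters u @ [Bottom], State (Op a # k) # letters w @ [Bottom]) \<in> moves" by simp
  with trace_Op.IH[OF k w(2)] show ?case by (rule rtrancl_into_rtrancl)
next
  case (trace_Seq p q k v)
  have k: "p # q # k \<in> K" using K_closed trace_Seq.prems(1) by simp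
  show ?case
    by (rule silent_generation[OF trace_Seq.IH[OF k trace_Seq.prems(2)] config_syms(2)[OF _ k]])
      (use trace_Seq in \<open>simp_all add: silent_moves_def\<close>)
next
  case (trace_Star_exit k v p)
  have k: "k \<in> K" using K_closed trace_Star_exit.prems(1) by simp
  show ?case
    by (rule silent_generation[OF trace_Star_exit.IH[OF k trace_Star_exit.prems(2)] config_syms(2)[OF _ k]])
      (use trace_Star_exit in \<open>simp_all add: silent_moves_def\<close>)
next
  case (trace_Star_loop p k v)
  have k: "p # Star p # k \<in> K" using K_closed trace_Star_loop.prems(1) by simp
  show ?case
    by (rule silent_generation[OF trace_Star_loop.IH[OF k trace_Star_loop.prems(2)] config_syms(2)[OF _ k]])
      (use trace_Star_loop in \<open>simp_all add: silent_moves_def\<close>)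
qed simp

lemma trace_silent: "l \<in> silent_moves k \<Longrightarrow> trace l v \<Longrightarrow> trace k v"
  by (cases k rule: next_prog.cases)
    (auto simp: silent_moves_def intro: trace_Seq trace_Star_exit trace_Star_loop split: if_splits)

text \<open>The invariant of reachable stacks. The last alternative covers everything after
  \<open>Check\<close> is popped: no guessing symbol ever returns, so a stack with
  \<open>Check\<close> on top comes directly from a completed guess.\<close>

definition generated :: "sym list \<Rightarrow> bool" where
  "generated \<sigma> \<longleftrightarrow> (\<exists>k w. k \<in> K \<and> trace k (map fst w) \<and> \<sigma> = State k # letters w @ [Bottom]) \<or>
     (\<exists>w. trace [p] (map fst w) \<and> \<sigma> = Check # letters w @ [Bottom]) \<or>
     (\<forall>X\<in>set \<sigma>. X \<noteq> Check \<and> (\<forall>k. X \<noteq> State k))"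

lemma generated_step:
  assumes "generated \<sigma>" "(\<sigma>, \<tau>) \<in> moves" shows "generated \<tau>"
proof -
  consider (state) k w where "k \<in> K" "trace k (map fst w)" "\<sigma> = State k # letters w @ [Bottom]"
    | (check) w where "trace [p] (map fst w)" "\<sigma> = Check # letters w @ [Bottom]"
    | (pop) "\<forall>X\<in>set \<sigma>. X \<noteq> Check \<and> (\<forall>k. X \<noteq> State k)"
    using assms(1) unfolding generated_def by blast
  then show ?thesis
  proof cases
    case state
    then obtain \<alpha> where \<alpha>: "\<alpha> \<in> rhs (State k)" "\<tau> = \<alpha> @ letters w @ [Bottom]"
      using assms(2) by (auto simp: moves_def)
    from \<alpha>(1) consider "\<alpha> = [State k]" | l where "\<alpha> = [State l]" "l \<in> K" "k \<in> silent_moves l"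
      | a d where "\<alpha> = [State (Op a # k), Letter a d]" "Op a # k \<in> K" | "\<alpha> = [Check]" "k = [p]"
      by auto
    then show ?thesis
    proof cases
      case 1
      then show ?thesis using state \<alpha> assms(1) by simp
    next
      case 2
      then have "trace l (map fst w)" using trace_silent state by blast
      then show ?thesis using 2 \<alpha>(2) unfolding generated_def by auto
    next
      case 3
      then have "trace (Op a # k) (map fst ((a, d) # w))" using trace_Op state by simp
      moreover have "\<tau> = State (Op a # k) # letters ((a, d) # w) @ [Bottom]" using 3 \<alpha>(2) by simp
      ultimately show ?thesis using 3 unfolding generated_def by blast
    next
      case 4
      then show ?thesis using state \<alpha>(2) unfolding generated_def by auto
    qed
  next
    case check
    then have "\<tau> = letters w @ [Bottom]" using assms(2) by (auto simp: moves_def)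
    then show ?thesis unfolding generated_def by auto
  next
    case pop
    show ?thesis
    proof (cases \<sigma>)
      case Nil
      then show ?thesis using assms by (auto simp: moves_def)
    next
      case (Cons X \<rho>)
      then obtain \<alpha> where \<alpha>: "\<alpha> \<in> rhs X" "\<tau> = \<alpha> @ \<rho>" using assms(2) by (auto simp: moves_def)
      have "\<forall>Y\<in>set \<alpha>. Y \<noteq> Check \<and> (\<forall>k. Y \<noteq> State k)"
        using \<alpha>(1) pop Cons by (cases X) (auto simp: mark_def split: if_splits)
      then show ?thesis using pop Cons \<alpha>(2) unfolding generated_def by auto
    qed
  qed
qed

lemma generated_reachable: "(start, \<sigma>) \<in> moves\<^sup>* \<Longrightarrow> generated \<sigma>"
proof (induction rule: rtrancl_induct)
  case base
  have "start = State [] # letters [] @ [Bottom]" "trace [] (map fst [])" "[] \<in> K"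
    by (simp_all add: trace_Nil K_def)
  then show ?case unfolding generated_def by blast
qed (rule generated_step)

text \<open>Reachability of a stack topped by \<open>Check\<close> is the existential quantifier
  over traces with digits in \<open>sem_iff_values\<close>.\<close>

lemma check_reachable_iff:
  "(start, Check # \<sigma>) \<in> moves\<^sup>* \<longleftrightarrow> (\<exists>w. trace [p] (map fst w) \<and> \<sigma> = letters w @ [Bottom])"
proof
  assume "(start, Check # \<sigma>) \<in> moves\<^sup>*"
  from generated_reachable[OF this] show "\<exists>w. trace [p] (map fst w) \<and> \<sigma> = letters w @ [Bottom]"
    unfolding generated_def by auto
next
  assume "\<exists>w. trace [p] (map fst w) \<and> \<sigma> = letters w @ [Bottom]"
  then obtain w where w: "trace [p] (map fst w)" "\<sigma> = letters w @ [Bottom]" by blast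
  have "[Check] \<in> rhs (State [p])" by simp
  from move[OF config_syms(2)[OF w(1) program_in_K] this]
  have "(State [p] # \<sigma>, Check # \<sigma>) \<in> moves" unfolding w(2) by simp
  with generation_complete[OF w(1) program_in_K refl] show "(start, Check # \<sigma>) \<in> moves\<^sup>*"
    unfolding w(2) by (rule rtrancl_into_rtrancl)
qed

lemma suffix_reachable:
  "letters (v @ u) @ [Bottom] \<in> lists syms \<Longrightarrow>
     (letters (v @ u) @ [Bottom], letters u @ [Bottom]) \<in> moves\<^sup>*"
proof (induction v)
  case (Cons l v)
  obtain a d where l: "l = (a, d)" by (cases l)
  have "(Letter a d # letters (v @ u) @ [Bottom], [] @ letters (v @ u) @ [Bottom]) \<in> moves"
    by (rule move) (use Cons.prems l in auto)
  moreover have "(letters (v @ u) @ [Bottom], letters u @ [Bottom]) \<in> moves\<^sup>*"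
    using Cons by simp
  ultimately show ?case unfolding l by (simp add: converse_rtrancl_into_rtrancl)
qed simp

text \<open>After \<open>Check\<close> only suffixes of the guessed word occur, up to one transient
  symbol on top, besides the two stacks that replace \<open>Bottom\<close>. The "always" in the
  formula thus ranges over suffixes of this word alone.\<close>

lemma popping_reachable:
  assumes "(Check # letters w @ [Bottom], \<tau>) \<in> moves\<^sup>*"
  shows "\<tau> \<in> {[], [Base]} \<or> (\<exists>v u \<mu>. w = v @ u \<and> \<tau> = \<mu> @ letters u @ [Bottom] \<and>
    (\<mu> = [] \<or> \<mu> = [Check] \<or> (\<exists>d r. \<mu> = [mark d r])))"
  using assms
proof (induction rule: rtrancl_induct)
  case base
  show ?case by (intro disjI2 exI[of _ "[]"] exI[of _ w] exI[of _ "[Check]"]) simp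
next
  case (step \<tau> \<rho>)
  from step.IH show ?case
  proof (elim disjE exE conjE)
    assume "\<tau> \<in> {[], [Base]}"
    then show ?thesis using step.hyps(2) by (auto simp: moves_def)
  next
    fix v u \<mu> assume *: "w = v @ u" "\<tau> = \<mu> @ letters u @ [Bottom]" "\<mu> = []"
    show ?thesis
    proof (cases u)
      case Nil
      then show ?thesis using step.hyps(2) * by (auto simp: moves_def)
    next
      case (Cons l u')
      obtain a d where l: "l = (a, d)" by (cases l)
      from step.hyps(2) obtain \<alpha> where \<alpha>: "\<alpha> \<in> rhs (Letter a d)" "\<rho> = \<alpha> @ letters u' @ [Bottom]"
        using * Cons l by (auto simp: moves_def)
      have "\<alpha> = [] \<or> \<alpha> = [mark d (reg a)]" using \<alpha>(1) by (auto split: if_splits)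
      then show ?thesis using \<alpha>(2) *(1) Cons
        by (intro disjI2 exI[of _ "v @ [l]"] exI[of _ u'] exI[of _ \<alpha>]) auto
    qed
  next
    fix v u \<mu> assume *: "w = v @ u" "\<tau> = \<mu> @ letters u @ [Bottom]" "\<mu> = [Check]"
    then have "\<rho> = letters u @ [Bottom]" using step.hyps(2) by (auto simp: moves_def)
    then show ?thesis using * by (intro disjI2 exI[of _ v] exI[of _ u] exI[of _ "[]"]) simp
  next
    fix v u \<mu> d r assume *: "w = v @ u" "\<tau> = \<mu> @ letters u @ [Bottom]" "\<mu> = [mark d r]"
    then have "\<rho> = letters u @ [Bottom]"
      using step.hyps(2) by (cases d) (auto simp: moves_def mark_def)
    then show ?thesis using * by (intro disjI2 exI[of _ v] exI[of _ u] exI[of _ "[]"]) simp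
  qed
qed

text \<open>The atom is a positive multiple of 3, which excludes \<open>Check\<close> (only 0),
  \<open>Goal\<close> and \<open>Base\<close> (residue 1) and \<open>Fail\<close> (residue
  2).\<close>

lemma holds_test:
  assumes "holds (3 * r + 3) X" shows "\<exists>d. X = Letter (Test r) d"
proof (cases X)
  case (Goal q)
  then have "3 * r + 3 = 3 * q + 1" using assms by (simp add: holds_def)
  then have False by presburger
  then show ?thesis ..
next
  case (Fail q)
  then have "3 * r + 3 = 3 * q + 2" using assms by (simp add: holds_def)
  then have False by presburger
  then show ?thesis ..
next
  case Base
  then have "(3 * r + 3) mod 3 = 1" using assms unfolding holds_def by (simp only: sym.case)
  then have False by presburger
  then show ?thesis ..
next
  case (Letter a d)
  then show ?thesis using assms by (cases a) (auto simp: holds_def)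
qed (use assms in \<open>auto simp: holds_def\<close>)

section \<open>Correctness of the formula\<close>

lemma sat_tests_formula:
  assumes w: "trace [p] (map fst w)"
  shows "sat M \<nu> (tests_formula R) (map enc (Check # letters w @ [Bottom])) \<longleftrightarrow> tests_ok w"
proof -
  let ?c = "Check # letters w @ [Bottom]"
  have syms: "?c \<in> lists syms" "letters w @ [Bottom] \<in> lists syms"
    using config_syms[OF w program_in_K] by blast+
  have ops: "fst ` set w \<subseteq> ops" using trace_ops[OF w program_in_K] by simp
  have "sat M \<nu> (tests_formula R) (map enc ?c) \<longleftrightarrow>
      (\<forall>\<tau>. (?c, \<tau>) \<in> moves\<^sup>* \<longrightarrow> (\<forall>r<R. map enc \<tau> \<in> \<nu> (3 * r + 3) \<longrightarrow> hit r \<tau> = 1 / 2))"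
    unfolding tests_formula_def sat.simps(2) sat_possibly[OF syms(1)] sat_foldr_Conj sat_true_formula
    by (auto simp: sat_value_formula simp del: list.map)
  also have "\<dots> \<longleftrightarrow> tests_ok w"
  proof
    assume *: "\<forall>\<tau>. (?c, \<tau>) \<in> moves\<^sup>* \<longrightarrow> (\<forall>r<R. map enc \<tau> \<in> \<nu> (3 * r + 3) \<longrightarrow> hit r \<tau> = 1 / 2)"
    show "tests_ok w" unfolding tests_ok_iff
    proof (intro allI impI)
      fix v r d u assume eq: "w = v @ (Test r, d) # u"
      let ?\<tau> = "letters ((Test r, d) # u) @ [Bottom]"
      have "(?c, letters w @ [Bottom]) \<in> moves" using move[OF syms(1), of "[]"] by simp
      moreover have "(letters w @ [Bottom], ?\<tau>) \<in> moves\<^sup>*"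
        using suffix_reachable[of v "(Test r, d) # u"] syms(2) eq by simp
      ultimately have reach: "(?c, ?\<tau>) \<in> moves\<^sup>*" by (rule converse_rtrancl_into_rtrancl)
      have \<tau>: "?\<tau> \<in> lists syms" by (rule moves_rtrancl_syms[OF reach syms(1)])
      have "r < R" using reg_ops[of "Test r"] ops eq by simp
      moreover have "map enc ?\<tau> \<in> \<nu> (3 * r + 3)"
        unfolding enc_in_\<nu>[OF \<tau>] by (simp add: holds_def)
      ultimately have "hit r ?\<tau> = 1 / 2" using * reach by blast
      moreover have "hit r ?\<tau> = stack_value r ((Test r, d) # u)"
        by (rule hit_letters) (use ops eq in auto)
      ultimately show "stack_value r u = 1 / 2" by simp
    qed
  next
    assume ok: "tests_ok w"
    show "\<forall>\<tau>. (?c, \<tau>) \<in> moves\<^sup>* \<longrightarrow> (\<forall>r<R. map enc \<tau> \<in> \<nu> (3 * r + 3) \<longrightarrow> hit r \<tau> = 1 / 2)"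
    proof (intro allI impI)
      fix \<tau> r assume \<tau>: "(?c, \<tau>) \<in> moves\<^sup>*" and "r < R" and hd: "map enc \<tau> \<in> \<nu> (3 * r + 3)"
      have h: "\<tau> \<noteq> []" "holds (3 * r + 3) (hd \<tau>)"
        using hd enc_in_\<nu>[OF moves_rtrancl_syms[OF \<tau> syms(1)]] by auto
      obtain d where d: "hd \<tau> = Letter (Test r) d" using holds_test[OF h(2)] by blast
      have "\<tau> \<notin> {[], [Base]}" using h(1) d by auto
      obtain v u \<mu> where *: "w = v @ u" "\<tau> = \<mu> @ letters u @ [Bottom]"
        "\<mu> = [] \<or> \<mu> = [Check] \<or> (\<exists>d r. \<mu> = [mark d r])"
        using popping_reachable[OF \<tau>] \<open>\<tau> \<notin> {[], [Base]}\<close> by blast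
      \<comment> \<open>A \<open>Check\<close> or a mark on top would contradict the test letter on
        top. In the next line, an empty \<open>u\<close> would put \<open>Bottom\<close>
        there.\<close>
      have "\<mu> = []" using * d by (auto simp: mark_def split: if_splits)
      then obtain u' where u: "u = (Test r, d) # u'" using * d by (cases u) auto
      have "hit r \<tau> = stack_value r u"
        unfolding *(2) \<open>\<mu> = []\<close> append_Nil by (rule hit_letters) (use ops *(1) in auto)
      also have "\<dots> = stack_value r u'" using u by simp
      also have "\<dots> = 1 / 2" using ok *(1) u unfolding tests_ok_iff by blast
      finally show "hit r \<tau> = 1 / 2" .
    qed
  qed
  finally show ?thesis .
qed

lemma sat_start_formula:
  assumes xs: "length xs = 4" and "4 \<le> R"
  shows "sat M \<nu> (start_formula xs (rest_formula R)) (map enc start) \<longleftrightarrow>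
    (store_of xs, \<lambda>_. 0) \<in> sem p"
proof -
  let ?\<Phi> = "foldr Conj (map (\<lambda>r. value_formula r (xs ! r)) [0..<4]) (rest_formula R)"
  have \<Phi>: "sat M \<nu> ?\<Phi> (map enc \<tau>) \<longleftrightarrow> (\<forall>r<R. hit r \<tau> = 1 / 2 ^ Suc (store_of xs r)) \<and>
      map enc \<tau> \<in> \<nu> 0 \<and> sat M \<nu> (tests_formula R) (map enc \<tau>)" for \<tau>
  proof -
    have "(\<forall>r\<in>{0..<4}. hit r \<tau> = 1 / 2 ^ Suc (xs ! r)) \<and> (\<forall>r\<in>{4..<R}. hit r \<tau> = 1 / 2 ^ Suc 0) \<longleftrightarrow>
      (\<forall>r<R. hit r \<tau> = 1 / 2 ^ Suc (store_of xs r))" (is "?A \<and> ?B \<longleftrightarrow> ?C")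
    proof
      assume AB: "?A \<and> ?B"
      show ?C
      proof (intro allI impI)
        fix r assume "r < R"
        then show "hit r \<tau> = 1 / 2 ^ Suc (store_of xs r)"
          using AB xs by (cases "r < 4") (auto simp: store_of_def)
      qed
    next
      assume C: ?C
      have ?A using C xs \<open>4 \<le> R\<close> by (auto simp: store_of_def)
      moreover have ?B
      proof
        fix r assume "r \<in> {4..<R}"
        then show "hit r \<tau> = 1 / 2 ^ Suc 0"
          using C[rule_format, of r] xs by (simp add: store_of_def)
      qed
      ultimately show "?A \<and> ?B" by blast
    qed
    moreover have "(\<forall>\<Psi>\<in>set (map f [a..<b]). sat M \<nu> \<Psi> s) \<longleftrightarrow> (\<forall>r\<in>{a..<b}. sat M \<nu> (f r) s)" for f a b s
      by auto
    ultimately show ?thesis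
      unfolding rest_formula_def sat_foldr_Conj sat.simps(1,3) by (simp only: sat_value_formula conj_assoc[symmetric])
  qed
  \<comment> \<open>Atom 0 holds only with \<open>Check\<close> on top, so the search over reachable
    stacks becomes a search over words.\<close>
  have check: "(\<exists>\<tau>. (start, \<tau>) \<in> moves\<^sup>* \<and> Q \<tau> \<and> map enc \<tau> \<in> \<nu> 0) \<longleftrightarrow>
      (\<exists>w. trace [p] (map fst w) \<and> Q (Check # letters w @ [Bottom]))" for Q
  proof
    assume "\<exists>\<tau>. (start, \<tau>) \<in> moves\<^sup>* \<and> Q \<tau> \<and> map enc \<tau> \<in> \<nu> 0"
    then obtain \<tau> where \<tau>: "(start, \<tau>) \<in> moves\<^sup>*" "Q \<tau>" "map enc \<tau> \<in> \<nu> 0" by blast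
    have h: "\<tau> \<noteq> []" "holds 0 (hd \<tau>)"
      using \<tau>(3) enc_in_\<nu>[OF moves_rtrancl_syms[OF \<tau>(1) start_syms]] by auto
    then have "hd \<tau> = Check" by (auto simp: holds_def split: sym.splits)
    then have "\<tau> = Check # tl \<tau>" using h(1) by (cases \<tau>) auto
    then show "\<exists>w. trace [p] (map fst w) \<and> Q (Check # letters w @ [Bottom])"
      using \<tau>(1,2) check_reachable_iff[of "tl \<tau>"] by metis
  next
    assume "\<exists>w. trace [p] (map fst w) \<and> Q (Check # letters w @ [Bottom])"
    then obtain w where w: "trace [p] (map fst w)" "Q (Check # letters w @ [Bottom])" by blast
    have "(start, Check # letters w @ [Bottom]) \<in> moves\<^sup>*" using check_reachable_iff w(1) by blast
    moreover have "map enc (Check # letters w @ [Bottom]) \<in> \<nu> 0"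
      unfolding enc_in_\<nu>[OF config_syms(3)[OF w(1) program_in_K]] by (simp add: holds_def)
    ultimately show "\<exists>\<tau>. (start, \<tau>) \<in> moves\<^sup>* \<and> Q \<tau> \<and> map enc \<tau> \<in> \<nu> 0" using w(2) by blast
  qed
  have val: "hit r (Check # letters w @ [Bottom]) = stack_value r w" if "trace [p] (map fst w)" for w r
    using hit_Check[OF config_syms(3)[OF that program_in_K]] hit_letters trace_ops[OF that program_in_K]
    by simp
  \<comment> \<open>The formula fixes finitely many registers. The remaining ones occur in no
    letter, so they keep the value 1/2, and their initial contents are zero because \<open>R\<close>
    is at least 4.\<close>
  have all: "(\<forall>r<R. stack_value r w = 1 / 2 ^ Suc (store_of xs r)) \<longleftrightarrow>
      (\<forall>r. stack_value r w = 1 / 2 ^ Suc (store_of xs r))" if "trace [p] (map fst w)" for w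
  proof -
    have "stack_value r w = 1 / 2 ^ Suc (store_of xs r)" if "\<not> r < R" for r
    proof -
      have "stack_value r w = 1 / 2"
        using trace_ops[OF \<open>trace [p] (map fst w)\<close> program_in_K] reg_ops that
        by (intro stack_value_untouched) auto
      moreover have "store_of xs r = 0" using that assms by (simp add: store_of_def)
      ultimately show ?thesis by simp
    qed
    then show ?thesis by blast
  qed
  have "sat M \<nu> (start_formula xs (rest_formula R)) (map enc start) \<longleftrightarrow>
      (\<exists>w. trace [p] (map fst w) \<and>
        ((\<forall>r<R. hit r (Check # letters w @ [Bottom]) = 1 / 2 ^ Suc (store_of xs r)) \<and>
         sat M \<nu> (tests_formula R) (map enc (Check # letters w @ [Bottom]))))"
    unfolding start_formula_def sat_possibly[OF start_syms] \<Phi> check[symmetric, where Q = "\<lambda>\<tau>.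
        (\<forall>r<R. hit r \<tau> = 1 / 2 ^ Suc (store_of xs r)) \<and> sat M \<nu> (tests_formula R) (map enc \<tau>)"]
    by (simp only: conj_ac)
  also have "\<dots> \<longleftrightarrow> (\<exists>w. trace [p] (map fst w) \<and> tests_ok w \<and>
      (\<forall>r. stack_value r w = 1 / 2 ^ Suc (store_of xs r)))"
  proof (rule ex_cong1, rule conj_cong[OF refl])
    fix w :: "(op \<times> bool) list" assume w: "trace [p] (map fst w)"
    show "(\<forall>r<R. hit r (Check # letters w @ [Bottom]) = 1 / 2 ^ Suc (store_of xs r)) \<and>
        sat M \<nu> (tests_formula R) (map enc (Check # letters w @ [Bottom])) \<longleftrightarrow>
      tests_ok w \<and> (\<forall>r. stack_value r w = 1 / 2 ^ Suc (store_of xs r))"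
      unfolding val[OF w] all[OF w] sat_tests_formula[OF w] by (rule conj_commute)
  qed
  finally show ?thesis unfolding sem_iff_values .
qed

end

section \<open>Computable functions\<close>

text \<open>Total functions of a fixed arity. The code of the formula depends on its inputs only
  through pairing and powers of 2, so few closure properties suffice.\<close>

definition computes :: "nat \<Rightarrow> (nat list \<Rightarrow> nat) \<Rightarrow> bool" where
  "computes n F \<longleftrightarrow> (\<exists>f. \<forall>xs. length xs = n \<longrightarrow> evaluates f xs (F xs))"

lemma computes_proj: "i < n \<Longrightarrow> computes n (\<lambda>xs. xs ! i)"
  unfolding computes_def by (auto intro: evaluates.proj)

lemma computes_compose:
  assumes "computes (length Fs) G" "\<And>F. F \<in> set Fs \<Longrightarrow> computes n F"
  shows "computes n (\<lambda>xs. G (map (\<lambda>F. F xs) Fs))"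
proof -
  obtain g where g: "\<And>xs. length xs = length Fs \<Longrightarrow> evaluates g xs (G xs)"
    using assms(1) unfolding computes_def by blast
  have "\<forall>F\<in>set Fs. \<exists>f. \<forall>xs. length xs = n \<longrightarrow> evaluates f xs (F xs)"
    using assms(2) unfolding computes_def by blast
  then obtain f where f: "\<And>F xs. F \<in> set Fs \<Longrightarrow> length xs = n \<Longrightarrow> evaluates (f F) xs (F xs)"
    by metis
  have "evaluates (Comp g (map f Fs)) xs (G (map (\<lambda>F. F xs) Fs))" if "length xs = n" for xs
    by (rule evaluates.comp[where ys = "map (\<lambda>F. F xs) Fs"]) (use f g that in auto)
  then show ?thesis unfolding computes_def by blast
qed

lemma computes_Suc: "computes n F \<Longrightarrow> computes n (\<lambda>xs. Suc (F xs))"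
proof -
  assume F: "computes n F"
  have "evaluates Succ xs (Suc (hd xs))" if "length xs = length [F]" for xs
    using that evaluates.succ[of "hd xs"] by (cases xs) auto
  then have "computes (length [F]) (\<lambda>xs. Suc (hd xs))" unfolding computes_def by blast
  from computes_compose[OF this] F show ?thesis by simp
qed

lemma computes_const: "computes n (\<lambda>_. c)"
proof (induction c)
  case 0
  show ?case unfolding computes_def using evaluates.zero by blast
qed (rule computes_Suc)

lemma computes_unary:
  "computes 1 (\<lambda>xs. g (xs ! 0)) \<Longrightarrow> computes n F \<Longrightarrow> computes n (\<lambda>xs. g (F xs))"
  using computes_compose[of "[F]" "\<lambda>xs. g (xs ! 0)" n] by simp

lemma computes_binary:
  "computes 2 (\<lambda>xs. g (xs ! 0) (xs ! 1)) \<Longrightarrow> computes n F \<Longrightarrow> computes n G \<Longrightarrow>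
     computes n (\<lambda>xs. g (F xs) (G xs))"
  using computes_compose[of "[F, G]" "\<lambda>xs. g (xs ! 0) (xs ! 1)" n]
  by (auto simp: numeral_2_eq_2)

lemma computes_prim_rec:
  assumes "computes n F" "computes (Suc (Suc n)) G"
    and "\<And>xs. length xs = n \<Longrightarrow> R (0 # xs) = F xs"
    and "\<And>k xs. length xs = n \<Longrightarrow> R (Suc k # xs) = G (k # R (k # xs) # xs)"
  shows "computes (Suc n) R"
proof -
  obtain f where f: "\<And>xs. length xs = n \<Longrightarrow> evaluates f xs (F xs)"
    using assms(1) unfolding computes_def by blast
  obtain g where g: "\<And>xs. length xs = Suc (Suc n) \<Longrightarrow> evaluates g xs (G xs)"
    using assms(2) unfolding computes_def by blast
  have "evaluates (Prim_Rec f g) (k # xs) (R (k # xs))" if "length xs = n" for k xs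
  proof (induction k)
    case 0
    show ?case using f[OF that] assms(3)[OF that] by (simp add: evaluates.prim_rec_0)
  next
    case (Suc k)
    show ?case unfolding assms(4)[OF that]
      by (rule evaluates.prim_rec_Suc[OF Suc.IH]) (use g that in simp)
  qed
  then have "\<forall>xs. length xs = Suc n \<longrightarrow> evaluates (Prim_Rec f g) xs (R xs)"
    by (auto simp: length_Suc_conv)
  then show ?thesis unfolding computes_def by blast
qed

lemma computes_add:
  assumes "computes n F" "computes n G" shows "computes n (\<lambda>xs. F xs + G xs)"
proof (rule computes_binary[OF _ assms])
  have "computes (Suc 1) (\<lambda>xs. xs ! 0 + xs ! 1)"
    by (rule computes_prim_rec[where F = "\<lambda>xs. xs ! 0" and G = "\<lambda>xs. Suc (xs ! 1)"])
      (auto intro!: computes_Suc computes_proj)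
  then show "computes 2 (\<lambda>xs. xs ! 0 + xs ! 1)" by (simp add: numeral_2_eq_2)
qed

lemma computes_power_2:
  assumes "computes n F" shows "computes n (\<lambda>xs. 2 ^ F xs)"
proof (rule computes_unary[OF _ assms])
  have "computes (Suc 0) (\<lambda>xs. 2 ^ (xs ! 0))"
    by (rule computes_prim_rec[where F = "\<lambda>xs. 1" and G = "\<lambda>xs. xs ! 1 + xs ! 1"])
      (auto intro!: computes_add computes_proj computes_const)
  then show "computes 1 (\<lambda>xs. 2 ^ (xs ! 0))" by simp
qed

text \<open>Cantor pairing is \<open>triangle (m + n) + m\<close>, and triangular numbers satisfy a
  primitive recursion.\<close>

lemma computes_prod_encode:
  assumes "computes n F" "computes n G" shows "computes n (\<lambda>xs. prod_encode (F xs, G xs))"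
proof -
  have "computes (Suc 0) (\<lambda>xs. triangle (xs ! 0))"
    by (rule computes_prim_rec[where F = "\<lambda>xs. 0" and G = "\<lambda>xs. xs ! 1 + Suc (xs ! 0)"])
      (auto intro!: computes_add computes_Suc computes_proj computes_const)
  then have "computes 1 (\<lambda>xs. triangle (xs ! 0))" by simp
  from computes_unary[OF this computes_add[OF assms]] show ?thesis
    unfolding prod_encode_def by (simp add: computes_add assms)
qed

section \<open>Codes of formulas as functions of the inputs\<close>

text \<open>The fraction is already reduced, and \<open>int_encode\<close> doubles nonnegative
  integers. The code is thus computable from the exponent without any arithmetic of
  fractions.\<close>

lemma code_rat_half_power: "code_rat (1 / 2 ^ k) = prod_encode (2, 2 * 2 ^ k)"
proof -
  have "quotient_of (1 / 2 ^ k) = (1, 2 ^ k)"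
  proof -
    have "1 / 2 ^ k = Fract 1 (2 ^ k)" by (simp add: Fract_of_int_quotient)
    then show ?thesis by (simp add: quotient_of_Fract normalize_def)
  qed
  moreover have "int_encode 1 = 2" "int_encode (2 ^ k) = 2 * 2 ^ k"
    by (simp_all add: int_encode_def sum_encode_def nat_power_eq)
  ultimately show ?thesis by (simp add: code_rat_def)
qed

section \<open>Undecidability\<close>

lemma code_value_formula:
  "code_state_formula (value_formula r k) = prod_encode (3, prod_encode (1, prod_encode (prod_encode (2, 2 ^ Suc (Suc k)),
     code_path_formula (Until (Neg (Atom (3 * r + 2))) (Atom (3 * r + 1))))))"
  unfolding value_formula_def code_state_formula.simps code_comparison.simps code_rat_half_power by simp

lemma computes_code_value_formula:
  "computes n F \<Longrightarrow> computes n (\<lambda>xs. code_state_formula (value_formula r (F xs)))"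
  unfolding code_value_formula
  by (intro computes_prod_encode computes_const computes_power_2 computes_Suc)

text \<open>Codes are structural, so the code of the conjunction is obtained from the code of
  \<open>\<Phi>\<close> without decoding it. The number \<open>xs ! 3\<close> has two roles: the
  content of register 3 and the code of the last conjunct.\<close>

lemma computes_code_start_formula:
  "\<exists>H. computes 4 H \<and> (\<forall>xs \<Phi>. length xs = 4 \<longrightarrow> xs ! 3 = code_state_formula \<Phi> \<longrightarrow>
     code_state_formula (start_formula xs \<Phi>) = H xs)"
proof -
  define H where "H xs = prod_encode (3, prod_encode (0, prod_encode (code_rat 0, prod_encode (1,
      prod_encode (code_state_formula true_formula,
        foldr (\<lambda>r c. prod_encode (2, prod_encode (code_state_formula (value_formula r (xs ! r)), c)))
          [0..<4] (xs ! 3))))))" for xs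
  \<comment> \<open>An arbitrary list \<open>rs\<close> of registers takes the place of
    \<open>[0..<4]\<close> for the sake of the induction.\<close>
  have codes: "computes 4 (\<lambda>xs. foldr (\<lambda>r c. prod_encode (2, prod_encode
      (code_state_formula (value_formula r (xs ! r)), c))) rs (xs ! 3))"
    if "set rs \<subseteq> {..<4}" for rs
    using that
    by (induction rs)
      (auto intro!: computes_prod_encode computes_const computes_code_value_formula computes_proj)
  have "computes 4 H"
    unfolding H_def by (intro computes_prod_encode computes_const codes) auto
  moreover have "code_state_formula (foldr Conj (map \<Phi> rs) \<Psi>) =
      foldr (\<lambda>r c. prod_encode (2, prod_encode (code_state_formula (\<Phi> r), c))) rs (code_state_formula \<Psi>)"
    for \<Phi> :: "nat \<Rightarrow> state_formula" and rs \<Psi>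
    by (induction rs) auto
  then have "code_state_formula (start_formula xs \<Phi>) = H xs"
    if "xs ! 3 = code_state_formula \<Phi>" for xs \<Phi>
    unfolding start_formula_def possibly_def H_def code_state_formula.simps code_path_formula.simps
      code_comparison.simps that by (simp only:)
  ultimately show ?thesis by blast
qed

text \<open>The formula is computed from the remaining parts, which are copied; the code
  \<open>g\<close> of the configuration is built in as a constant.\<close>

lemma computes_instance_code:
  "\<exists>f. \<forall>A B V \<Phi>. evaluates f [A, B, V, code_state_formula \<Phi>]
     (list_encode [A, B, V, g, code_state_formula (start_formula [A, B, V, code_state_formula \<Phi>] \<Phi>)])"
proof -
  obtain H where H: "computes 4 H" "\<And>xs \<Phi>. length xs = 4 \<Longrightarrow> xs ! 3 = code_state_formula \<Phi> \<Longrightarrow>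
     code_state_formula (start_formula xs \<Phi>) = H xs"
    using computes_code_start_formula by blast
  have "computes 4 (\<lambda>xs. list_encode [xs ! 0, xs ! 1, xs ! 2, g, H xs])"
    unfolding list_encode.simps
    by (intro computes_Suc computes_prod_encode computes_const computes_proj H(1)) simp_all
  then obtain f where f: "\<And>xs. length xs = 4 \<Longrightarrow>
      evaluates f xs (list_encode [xs ! 0, xs ! 1, xs ! 2, g, H xs])"
    unfolding computes_def by blast
  have "evaluates f [A, B, V, code_state_formula \<Phi>]
     (list_encode [A, B, V, g, code_state_formula (start_formula [A, B, V, code_state_formula \<Phi>] \<Phi>)])"
    for A B V \<Phi>
    using f[of "[A, B, V, code_state_formula \<Phi>]"] H(2)[of "[A, B, V, code_state_formula \<Phi>]" \<Phi>]
    by (simp add: numeral_3_eq_3 numeral_2_eq_2 del: list_encode.simps)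
  then show ?thesis by blast
qed

section \<open>Codes of instances\<close>

text \<open>The names of the amplitudes are only chosen, never computed. \<open>A\<close>,
  \<open>B\<close> and \<open>V\<close> depend on the formula through its set of atoms alone, so
  they can be fixed before the formula that mentions them as constants.\<close>

lemma instance_code_exists:
  fixes \<Delta> :: "nat qbpa"
  assumes "finite (alphabet \<Delta>)" "finite (rules \<Delta>)"
    and amp: "\<And>x. x \<in> rules \<Delta> \<Longrightarrow> \<exists>k. amp k = Some (rule_amplitude \<Delta> x)"
    and "finite S"
  shows "\<exists>A B V. \<forall>\<gamma> \<Psi>. state_atoms \<Psi> = S \<longrightarrow>
    instance_code amp \<Delta> \<nu> \<gamma> \<Psi> (list_encode [A, B, V, list_encode \<gamma>, code_state_formula \<Psi>])"
proof -
  obtain Xs where Xs: "set Xs = alphabet \<Delta>" using finite_list[OF assms(1)] by blast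
  obtain L where L: "set L = rules \<Delta>" using finite_list[OF assms(2)] by blast
  obtain ps where ps: "set ps = S" using finite_list[OF assms(4)] by blast
  obtain name where name: "\<And>x. x \<in> rules \<Delta> \<Longrightarrow> amp (name x) = Some (rule_amplitude \<Delta> x)"
    using amp by metis
  have "\<exists>Hs. set Hs = {X \<in> alphabet \<Delta>. [X] \<in> \<nu> q}" for q
    using assms(1) by (intro finite_list) simp
  then obtain hs where hs: "\<And>q. set (hs q) = {X \<in> alphabet \<Delta>. [X] \<in> \<nu> q}" by metis
  let ?rs = "map (\<lambda>(X, \<alpha>). (X, \<alpha>, name (X, \<alpha>))) L"
  let ?vs = "map (\<lambda>q. (q, hs q, [] \<in> \<nu> q)) ps"
  have "instance_code amp \<Delta> \<nu> \<gamma> \<Psi> (list_encode [list_encode Xs, list_encode (map code_rule ?rs),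
      list_encode (map code_valuation ?vs), list_encode \<gamma>, code_state_formula \<Psi>])"
    if "state_atoms \<Psi> = S" for \<gamma> \<Psi>
    unfolding instance_code_def
  proof (intro exI[of _ Xs] exI[of _ ?rs] exI[of _ ?vs] conjI refl)
    show "set Xs = alphabet \<Delta>" by (rule Xs)
    show "{(X, \<alpha>) | X \<alpha> k. (X, \<alpha>, k) \<in> set ?rs} = rules \<Delta>"
      unfolding L[symmetric] by (force simp: image_iff)
    show "\<forall>(X, \<alpha>, k)\<in>set ?rs. amp k = Some (rule_amplitude \<Delta> (X, \<alpha>))"
      using name unfolding L[symmetric] by auto
    show "{q | q Hs e. (q, Hs, e) \<in> set ?vs} = state_atoms \<Psi>"
      unfolding that ps[symmetric] by auto
    show "\<forall>(q, Hs, e)\<in>set ?vs. set Hs = {X \<in> alphabet \<Delta>. [X] \<in> \<nu> q} \<and> (e \<longleftrightarrow> [] \<in> \<nu> q)"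
      using hs by auto
  qed
  then show ?thesis by blast
qed

lemma finite_state_atoms: "finite (state_atoms \<Phi>)" and finite_path_atoms: "finite (path_atoms \<phi>)"
  by (induction \<Phi> and \<phi>) auto

lemma state_atoms_foldr_Conj:
  "state_atoms (foldr Conj \<Phi>s \<Phi>) = (\<Union>\<Psi>\<in>set \<Phi>s. state_atoms \<Psi>) \<union> state_atoms \<Phi>"
  by (induction \<Phi>s) auto

lemma wf_foldr_Conj:
  "wf_state_formula (foldr Conj \<Phi>s \<Phi>) \<longleftrightarrow> (\<forall>\<Psi>\<in>set \<Phi>s. wf_state_formula \<Psi>) \<and> wf_state_formula \<Phi>"
  by (induction \<Phi>s) auto

text \<open>Inputs occur only in the bounds of probability operators. This breaks the circularity
  between the listing of the valuation and the formula that contains the code of this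
  listing.\<close>

lemma state_atoms_start_formula: "state_atoms (start_formula xs \<Phi>) = state_atoms (start_formula ys \<Phi>)"
  by (simp add: start_formula_def possibly_def state_atoms_foldr_Conj value_formula_def)

lemma wf_value_formula: "wf_state_formula (value_formula r k)"
  using one_le_power[of "2 :: rat" "Suc k"] by (simp add: value_formula_def del: power_Suc)

lemma wf_true_formula: "wf_state_formula true_formula"
  by (simp add: true_formula_def)

lemma wf_start_formula: "wf_state_formula (start_formula xs (rest_formula R))"
  by (auto simp: start_formula_def rest_formula_def tests_formula_def possibly_def wf_foldr_Conj
      wf_value_formula wf_true_formula)

definition top_reg :: "prog list \<Rightarrow> nat" where
  "top_reg k = (case k of Op a # l \<Rightarrow> reg a | _ \<Rightarrow> 0)"

lemma encoded_program_exists: "\<exists>R\<ge>4. encoded_program p R"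
proof -
  have "finite (top_reg ` insert [] (continuations p []))" by (simp add: finite_continuations)
  then obtain R where R: "\<And>n. n \<in> top_reg ` insert [] (continuations p []) \<Longrightarrow> n < R"
    unfolding finite_nat_set_iff_bounded by blast
  have "encoded_program p (R + 4)"
  proof
    fix k a assume "Op a # k \<in> insert [] (continuations p [])"
    then have "top_reg (Op a # k) < R" by (intro R imageI)
    then show "reg a < R + 4" by (simp add: top_reg_def)
  qed
  then show ?thesis by (intro exI[of _ "R + 4"]) simp
qed

theorem theorem2:
  fixes amp :: "nat \<Rightarrow> complex option"
  assumes "\<And>x y :: rat. \<exists>k. amp k = Some (Complex (of_rat x) (of_rat y))"
  shows "\<not> (\<exists>f. \<forall>(\<Delta> :: nat qbpa) \<nu> \<gamma> \<Psi> c.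
            is_qbpa \<Delta> \<longrightarrow>
            regular_assignment (alphabet \<Delta>) \<nu> \<longrightarrow>
            simple_assignment (alphabet \<Delta>) \<nu> \<longrightarrow>
            \<gamma> \<in> lists (alphabet \<Delta>) \<longrightarrow>
            wf_state_formula \<Psi> \<longrightarrow>
            instance_code amp \<Delta> \<nu> \<gamma> \<Psi> c \<longrightarrow>
            evaluates f [c] (if sat (qmc_of \<Delta>) \<nu> \<Psi> \<gamma> then 1 else 0))"
proof
  let ?\<gamma> = "map enc [State [], Bottom]"
  assume "\<exists>f. \<forall>(\<Delta> :: nat qbpa) \<nu> \<gamma> \<Psi> c.
            is_qbpa \<Delta> \<longrightarrow>
            regular_assignment (alphabet \<Delta>) \<nu> \<longrightarrow>
            simple_assignment (alphabet \<Delta>) \<nu> \<longrightarrow>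
            \<gamma> \<in> lists (alphabet \<Delta>) \<longrightarrow>
            wf_state_formula \<Psi> \<longrightarrow>
            instance_code amp \<Delta> \<nu> \<gamma> \<Psi> c \<longrightarrow>
            evaluates f [c] (if sat (qmc_of \<Delta>) \<nu> \<Psi> \<gamma> then 1 else 0)"
  then obtain f where f: "\<And>(\<Delta> :: nat qbpa) \<nu> \<gamma> \<Psi> c. is_qbpa \<Delta> \<Longrightarrow>
      regular_assignment (alphabet \<Delta>) \<nu> \<Longrightarrow> simple_assignment (alphabet \<Delta>) \<nu> \<Longrightarrow>
      \<gamma> \<in> lists (alphabet \<Delta>) \<Longrightarrow> wf_state_formula \<Psi> \<Longrightarrow> instance_code amp \<Delta> \<nu> \<gamma> \<Psi> c \<Longrightarrow>
      evaluates f [c] (if sat (qmc_of \<Delta>) \<nu> \<Psi> \<gamma> then 1 else 0)"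
    by blast
  \<comment> \<open>The initial stack is the same for every program, so \<open>g\<close> can be
    obtained before \<open>p\<close>, which is going to contain it.\<close>
  obtain g where g: "\<And>A B V \<Phi>. evaluates g [A, B, V, code_state_formula \<Phi>]
     (list_encode [A, B, V, list_encode ?\<gamma>, code_state_formula (start_formula [A, B, V, code_state_formula \<Phi>] \<Phi>)])"
    using computes_instance_code by blast
  \<comment> \<open>The search looks for \<open>n\<close> such that entry 1 of \<open>[n, v]\<close>
    is 0, where \<open>v\<close> is the answer of \<open>f\<close>. So \<open>h\<close> is defined
    iff the answer is 0.\<close>
  define h where "h = Comp (Minimize (Proj 1)) [Comp f [g]]"
  obtain p where p: "\<And>xs. length xs = 4 \<Longrightarrow>
      (store_of xs, \<lambda>_. 0) \<in> sem p \<longleftrightarrow> (\<exists>y. evaluates h xs y)"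
    using domain_as_program[of 4 h] by blast
  obtain R where R: "4 \<le> R" "encoded_program p R" using encoded_program_exists by blast
  interpret encoded_program p R by (rule R(2))
  define \<Phi> where "\<Phi> = rest_formula R"
  have names: "\<exists>k. amp k = Some (rule_amplitude \<Delta> x)" if rule: "x \<in> rules \<Delta>" for x
  proof -
    obtain X \<alpha> where X: "x = (enc X, map enc \<alpha>)" "X \<in> syms" "\<alpha> \<in> rhs X"
      using rule by (auto simp: \<Delta>_def)
    obtain a b where "amp_of X \<alpha> = Complex (of_rat a) (of_rat b)"
      using amp_of_rational[OF X(2,3)] unfolding rational_amplitude_def by blast
    then show ?thesis using assms unfolding X(1) rule_amplitude_\<Delta> by simp
  qed
  have fin: "finite (alphabet \<Delta>)" "finite (rules \<Delta>)"
    using is_qbpa_\<Delta> unfolding is_qbpa_def by blast+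
  \<comment> \<open>The empty list is a placeholder: the atoms are the same for all inputs, while
    the actual inputs contain the numbers still to be found.\<close>
  let ?S = "state_atoms (start_formula [] \<Phi>)"
  obtain A B V where ABV: "\<And>\<gamma> \<Psi>. state_atoms \<Psi> = ?S \<Longrightarrow>
      instance_code amp \<Delta> \<nu> \<gamma> \<Psi> (list_encode [A, B, V, list_encode \<gamma>, code_state_formula \<Psi>])"
    using instance_code_exists[OF fin names finite_state_atoms, of "start_formula [] \<Phi>" \<nu>] by blast
  \<comment> \<open>The self-application: the inputs of the program are the codes of the instance
    built from this very program, and \<open>g\<close> assembles the full code \<open>c\<close> from
    them.\<close>
  define xs where "xs = [A, B, V, code_state_formula \<Phi>]"
  define c where "c = list_encode [A, B, V, list_encode ?\<gamma>, code_state_formula (start_formula xs \<Phi>)]"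
  let ?sat = "sat (qmc_of \<Delta>) \<nu> (start_formula xs \<Phi>) ?\<gamma>"
  have "instance_code amp \<Delta> \<nu> ?\<gamma> (start_formula xs \<Phi>) c"
    unfolding c_def by (rule ABV) (rule state_atoms_start_formula)
  moreover have "wf_state_formula (start_formula xs \<Phi>)"
    unfolding \<Phi>_def by (rule wf_start_formula)
  ultimately have fc: "evaluates f [c] (if ?sat then 1 else 0)"
    using is_qbpa_\<Delta> regular_assignment_\<nu> simple_assignment_\<nu> enc_lists[OF start_syms] by (intro f)
  have gc: "evaluates g xs c" using g unfolding c_def xs_def .
  have "evaluates (Comp f [g]) xs v \<longleftrightarrow> v = (if ?sat then 1 else 0)" for v
  proof
    assume "evaluates (Comp f [g]) xs v"
    then obtain ys where "length ys = 1" "evaluates g xs (ys ! 0)" "evaluates f ys v"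
      unfolding evaluates_Comp_iff by auto
    moreover from this(2) have "ys ! 0 = c" using gc by (rule evaluates_deterministic)
    ultimately have "evaluates f [c] v" by (cases ys) auto
    then show "v = (if ?sat then 1 else 0)" using fc by (rule evaluates_deterministic)
  next
    assume "v = (if ?sat then 1 else 0)"
    then show "evaluates (Comp f [g]) xs v"
      unfolding evaluates_Comp_iff using gc fc by (intro exI[of _ "[c]"]) simp
  qed
  moreover have "(\<exists>y. evaluates h xs y) \<longleftrightarrow> evaluates (Comp f [g]) xs 0"
  proof
    assume "\<exists>y. evaluates h xs y"
    then obtain ys y where "length ys = 1" "evaluates (Comp f [g]) xs (ys ! 0)"
      "evaluates (Proj 1) (y # ys) 0"
      unfolding h_def evaluates_Comp_iff[of "Minimize (Proj 1)"] evaluates_Minimize_iff by auto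
    then show "evaluates (Comp f [g]) xs 0" unfolding evaluates_Proj_iff by simp
  next
    assume *: "evaluates (Comp f [g]) xs 0"
    have "evaluates (Minimize (Proj 1)) [0] 0"
      unfolding evaluates_Minimize_iff evaluates_Proj_iff by simp
    then show "\<exists>y. evaluates h xs y"
      unfolding h_def evaluates_Comp_iff[of "Minimize (Proj 1)"] using *
      by (intro exI[of _ 0] exI[of _ "[0]"]) simp
  qed
  moreover have "?sat \<longleftrightarrow> (store_of xs, \<lambda>_. 0) \<in> sem p"
    unfolding \<Phi>_def by (rule sat_start_formula[OF _ R(1)]) (simp add: xs_def)
  moreover have "(store_of xs, \<lambda>_. 0) \<in> sem p \<longleftrightarrow> (\<exists>y. evaluates h xs y)"
    by (rule p) (simp add: xs_def)
  \<comment> \<open>The formula holds iff \<open>h\<close> is defined at \<open>xs\<close>, iff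
    \<open>f\<close> answers 0 on \<open>c\<close>, iff the formula does not hold.\<close>
  ultimately show False by (cases ?sat) simp_all
qed

end
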